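(* Let $n\ge 3$, let $(S^n,g_0)$ be the standard unit sphere, and let $\Lambda_k=\{p_1,p_2,\dots,p_k\}\subset S^n$ be a set of $k>2$ distinct points. Let $\bar g$ be a complete Riemannian metric on $S^n-\Lambda_k$ which is conformal to (the restriction of) $g_0$ and has positive constant scalar curvature. Then $\bar g$ has harmonic curvature and, except when $\bar g$ is the standard metric $g_0$, its Ricci tensor is not parallel.
   Context: A metric $\bar g$ on $S^n-\Lambda_k$ is conformal to $g_0$ if $\bar g=u^{\frac{4}{n-2}}g_0$ for some positive $C^\infty$ function $u$ on $S^n-\Lambda_k$. A Riemannian metric has harmonic curvature if the formal divergence of its curvature tensor vanishes, $\delta\mathcal{R}=0$. Equivalently, its Ricci tensor is a Codazzi tensor: $D_k\mathcal{R}_{ij}=D_i\mathcal{R}_{kj}$, where $D$ is the Levi-Civita connection and $\mathcal{R}_{ij}$ are the components of the Ricci tensor. The Ricci tensor $\mathrm{Ric}$ of a metric is parallel if $D\,\mathrm{Ric}=0$ identically, where $D$ is the Levi-Civita connection of that metric. *)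

theory Defs
  imports "HOL-Analysis.Analysis"
begin

text \<open>
  Riemannian geometry on relatively open subsets \<open>M\<close> of the unit sphere \<open>S\<^sup>n = sphere 0 1\<close> of a
  Euclidean space of dimension \<open>n + 1\<close>.  Points and tangent vectors are elements of the ambient
  space; functions and vector fields on \<open>M\<close> are functions on the ambient space of which only the
  values on \<open>M\<close> matter.
\<close>


section \<open>Smooth functions and vector fields\<close>

primrec C_k_on :: "nat \<Rightarrow> 'a::real_normed_vector set \<Rightarrow> ('a \<Rightarrow> 'b::real_normed_vector) \<Rightarrow> bool" where
  "C_k_on 0 S f \<longleftrightarrow> continuous_on S f"
| "C_k_on (Suc k) S f \<longleftrightarrow>
     (\<forall>x\<in>S. f differentiable (at x)) \<and> (\<forall>v. C_k_on k S (\<lambda>x. frechet_derivative f (at x) v))"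

text \<open>
  The map \<open>sgn x = x /\<^sub>R norm x\<close> is a smooth retraction of the punctured space onto the sphere.
  Hence \<open>f\<close> is smooth on the submanifold \<open>M\<close> iff its radial extension \<open>f \<circ> sgn\<close> is smooth on the
  open cone over \<open>M\<close>, and the differential of \<open>f\<close> at \<open>p \<in> M\<close> is the restriction to the tangent
  space of the Frechet derivative of \<open>f \<circ> sgn\<close>.
\<close>

definition smooth_fun :: "'a::euclidean_space set \<Rightarrow> ('a \<Rightarrow> 'b::real_normed_vector) \<Rightarrow> bool" where
  "smooth_fun M f \<longleftrightarrow> (\<forall>k. C_k_on k {x. sgn x \<in> M} (\<lambda>x. f (sgn x)))"

definition tangent_space :: "'a::euclidean_space \<Rightarrow> 'a set" where
  "tangent_space p = {v. v \<bullet> p = 0}"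

definition vector_fields :: "'a::euclidean_space set \<Rightarrow> ('a \<Rightarrow> 'a) set" where
  "vector_fields M = {X. smooth_fun M X \<and> (\<forall>p\<in>M. X p \<in> tangent_space p)}"

definition deriv_along ::
    "('a::euclidean_space \<Rightarrow> 'a) \<Rightarrow> ('a \<Rightarrow> 'b::real_normed_vector) \<Rightarrow> 'a \<Rightarrow> 'b" where
  "deriv_along X f p = frechet_derivative (\<lambda>x. f (sgn x)) (at p) (X p)"

definition lie_bracket ::
    "('a::euclidean_space \<Rightarrow> 'a) \<Rightarrow> ('a \<Rightarrow> 'a) \<Rightarrow> 'a \<Rightarrow> 'a" where
  "lie_bracket X Y p = deriv_along X Y p - deriv_along Y X p"

text \<open>
  A canonical smooth vector field on the sphere with the value \<open>v\<close> at every point \<open>p\<close> such that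
  \<open>v \<in> tangent_space p\<close>.  It serves to evaluate tensors, given as operations on vector fields,
  at individual tangent vectors; by tensoriality the choice of the extension is immaterial.
\<close>

definition extend :: "'a::euclidean_space \<Rightarrow> 'a \<Rightarrow> 'a" where
  "extend v q = v - (v \<bullet> q) *\<^sub>R q"


section \<open>Riemannian metrics\<close>

type_synonym 'a metric_tensor = "'a \<Rightarrow> 'a \<Rightarrow> 'a \<Rightarrow> real"

definition riemannian_metric :: "'a::euclidean_space set \<Rightarrow> 'a metric_tensor \<Rightarrow> bool" where
  "riemannian_metric M g \<longleftrightarrow>
     (\<forall>p\<in>M.
        (\<forall>v\<in>tangent_space p. \<forall>w\<in>tangent_space p. g p v w = g p w v) \<and>
        (\<forall>v\<in>tangent_space p. \<forall>w\<in>tangent_space p. \<forall>z\<in>tangent_space p. \<forall>a b.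
           g p (a *\<^sub>R v + b *\<^sub>R w) z = a * g p v z + b * g p w z) \<and>
        (\<forall>v\<in>tangent_space p. v \<noteq> 0 \<longrightarrow> g p v v > 0)) \<and>
     (\<forall>X\<in>vector_fields M. \<forall>Y\<in>vector_fields M. smooth_fun M (\<lambda>p. g p (X p) (Y p)))"

definition round_metric :: "'a::euclidean_space metric_tensor" where
  "round_metric p v w = v \<bullet> w"

definition metric_eq_on ::
    "'a::euclidean_space set \<Rightarrow> 'a metric_tensor \<Rightarrow> 'a metric_tensor \<Rightarrow> bool" where
  "metric_eq_on M g h \<longleftrightarrow>
     (\<forall>p\<in>M. \<forall>v\<in>tangent_space p. \<forall>w\<in>tangent_space p. g p v w = h p v w)"

definition conformal_to_round ::
    "nat \<Rightarrow> 'a::euclidean_space set \<Rightarrow> 'a metric_tensor \<Rightarrow> bool" where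
  "conformal_to_round n M g \<longleftrightarrow>
     (\<exists>u :: 'a \<Rightarrow> real. smooth_fun M u \<and> (\<forall>p\<in>M. u p > 0) \<and>
        metric_eq_on M g (\<lambda>p v w. u p powr (4 / (real n - 2)) * round_metric p v w))"


section \<open>Completeness\<close>

definition speed :: "'a::euclidean_space metric_tensor \<Rightarrow> (real \<Rightarrow> 'a) \<Rightarrow> real \<Rightarrow> real" where
  "speed g \<gamma> t = sqrt (g (\<gamma> t) (vector_derivative \<gamma> (at t)) (vector_derivative \<gamma> (at t)))"

text \<open>
  The library's piecewise \<open>C\<^sup>1\<close> paths may have unbounded derivative near the finitely many exceptional
  parameters.  Integrability of the speed has to be required, because the integral of a
  non-integrable function is 0 by convention.
\<close>

definition admissible_paths ::
    "'a::euclidean_space set \<Rightarrow> 'a metric_tensor \<Rightarrow> 'a \<Rightarrow> 'a \<Rightarrow> (real \<Rightarrow> 'a) set" where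
  "admissible_paths M g x y =
     {\<gamma>. valid_path \<gamma> \<and> path_image \<gamma> \<subseteq> M \<and> pathstart \<gamma> = x \<and> pathfinish \<gamma> = y \<and>
         speed g \<gamma> integrable_on {0..1}}"

text \<open>
  The infimum below is the Riemannian distance for connected \<open>M\<close>.  The value 0 off \<open>M\<close> only ensures
  that the function is a distance function on \<open>M\<close> in the sense of the locale \<open>Metric_space\<close>, which
  requires nonnegativity and symmetry for all arguments.
\<close>

definition riemannian_dist ::
    "'a::euclidean_space set \<Rightarrow> 'a metric_tensor \<Rightarrow> 'a \<Rightarrow> 'a \<Rightarrow> real" where
  "riemannian_dist M g x y =
     (if x \<in> M \<and> y \<in> M
      then INF \<gamma>\<in>admissible_paths M g x y. integral {0..1} (speed g \<gamma>) else 0)"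

definition complete_metric :: "'a::euclidean_space set \<Rightarrow> 'a metric_tensor \<Rightarrow> bool" where
  "complete_metric M g \<longleftrightarrow> Metric_space.mcomplete M (riemannian_dist M g)"


section \<open>The Levi-Civita connection\<close>

definition is_levi_civita ::
    "'a::euclidean_space set \<Rightarrow> 'a metric_tensor \<Rightarrow>
     (('a \<Rightarrow> 'a) \<Rightarrow> ('a \<Rightarrow> 'a) \<Rightarrow> ('a \<Rightarrow> 'a)) \<Rightarrow> bool" where
  "is_levi_civita M g D \<longleftrightarrow>
     (\<forall>X\<in>vector_fields M. \<forall>Y\<in>vector_fields M. D X Y \<in> vector_fields M) \<and>
     (\<forall>X\<in>vector_fields M. \<forall>Y\<in>vector_fields M. \<forall>Z\<in>vector_fields M. \<forall>p\<in>M.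
        D (\<lambda>q. X q + Y q) Z p = D X Z p + D Y Z p \<and>
        D X (\<lambda>q. Y q + Z q) p = D X Y p + D X Z p) \<and>
     (\<forall>f :: 'a \<Rightarrow> real. smooth_fun M f \<longrightarrow>
        (\<forall>X\<in>vector_fields M. \<forall>Y\<in>vector_fields M. \<forall>p\<in>M.
           D (\<lambda>q. f q *\<^sub>R X q) Y p = f p *\<^sub>R D X Y p \<and>
           D X (\<lambda>q. f q *\<^sub>R Y q) p = deriv_along X f p *\<^sub>R Y p + f p *\<^sub>R D X Y p)) \<and>
     (\<forall>X\<in>vector_fields M. \<forall>Y\<in>vector_fields M. \<forall>p\<in>M.
        D X Y p - D Y X p = lie_bracket X Y p) \<and>
     (\<forall>X\<in>vector_fields M. \<forall>Y\<in>vector_fields M. \<forall>Z\<in>vector_fields M. \<forall>p\<in>M.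
        deriv_along X (\<lambda>q. g q (Y q) (Z q)) p = g p (D X Y p) (Z p) + g p (Y p) (D X Z p))"

text \<open>
  By the fundamental theorem of Riemannian geometry such a \<open>D\<close> exists, and \<open>D X Y\<close> is uniquely
  determined on \<open>M\<close> for vector fields \<open>X\<close> and \<open>Y\<close> on \<open>M\<close>; the remaining values are arbitrary.
\<close>

definition levi_civita ::
    "'a::euclidean_space set \<Rightarrow> 'a metric_tensor \<Rightarrow> ('a \<Rightarrow> 'a) \<Rightarrow> ('a \<Rightarrow> 'a) \<Rightarrow> 'a \<Rightarrow> 'a" where
  "levi_civita M g = (SOME D. is_levi_civita M g D)"


section \<open>Curvature\<close>

definition curvature_op ::
    "'a::euclidean_space set \<Rightarrow> 'a metric_tensor \<Rightarrow>
     ('a \<Rightarrow> 'a) \<Rightarrow> ('a \<Rightarrow> 'a) \<Rightarrow> ('a \<Rightarrow> 'a) \<Rightarrow> 'a \<Rightarrow> 'a" where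
  "curvature_op M g X Y Z p =
     (let D = levi_civita M g
      in D X (D Y Z) p - D Y (D X Z) p - D (lie_bracket X Y) Z p)"

definition riem ::
    "'a::euclidean_space set \<Rightarrow> 'a metric_tensor \<Rightarrow>
     ('a \<Rightarrow> 'a) \<Rightarrow> ('a \<Rightarrow> 'a) \<Rightarrow> ('a \<Rightarrow> 'a) \<Rightarrow> ('a \<Rightarrow> 'a) \<Rightarrow> 'a \<Rightarrow> real" where
  "riem M g X Y Z W p = g p (curvature_op M g X Y Z p) (W p)"

definition orthonormal_basis :: "'a::euclidean_space metric_tensor \<Rightarrow> 'a \<Rightarrow> 'a set \<Rightarrow> bool" where
  "orthonormal_basis g p E \<longleftrightarrow>
     E \<subseteq> tangent_space p \<and> span E = tangent_space p \<and>
     (\<forall>v\<in>E. \<forall>w\<in>E. g p v w = (if v = w then 1 else 0))"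

text \<open>
  The trace with respect to \<open>g\<close> of a bilinear form on the tangent space at \<open>p\<close>; it does not depend on
  the choice of the orthonormal basis.
\<close>

definition metric_trace ::
    "'a::euclidean_space metric_tensor \<Rightarrow> 'a \<Rightarrow> ('a \<Rightarrow> 'a \<Rightarrow> real) \<Rightarrow> real" where
  "metric_trace g p B = (\<Sum>e\<in>(SOME E. orthonormal_basis g p E). B e e)"

text \<open>With these signs the unit sphere of dimension \<open>n\<close> has \<open>Ric = (n - 1) g\<close>.\<close>

definition ricci ::
    "'a::euclidean_space set \<Rightarrow> 'a metric_tensor \<Rightarrow> ('a \<Rightarrow> 'a) \<Rightarrow> ('a \<Rightarrow> 'a) \<Rightarrow> 'a \<Rightarrow> real" where
  "ricci M g Y Z p = metric_trace g p (\<lambda>v w. riem M g (extend v) Y Z (extend w) p)"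

definition scalar_curvature :: "'a::euclidean_space set \<Rightarrow> 'a metric_tensor \<Rightarrow> 'a \<Rightarrow> real" where
  "scalar_curvature M g p = metric_trace g p (\<lambda>v w. ricci M g (extend v) (extend w) p)"

definition positive_constant_scalar_curvature ::
    "'a::euclidean_space set \<Rightarrow> 'a metric_tensor \<Rightarrow> bool" where
  "positive_constant_scalar_curvature M g \<longleftrightarrow> (\<exists>c>0. \<forall>p\<in>M. scalar_curvature M g p = c)"

definition cov_deriv_riem ::
    "'a::euclidean_space set \<Rightarrow> 'a metric_tensor \<Rightarrow> ('a \<Rightarrow> 'a) \<Rightarrow>
     ('a \<Rightarrow> 'a) \<Rightarrow> ('a \<Rightarrow> 'a) \<Rightarrow> ('a \<Rightarrow> 'a) \<Rightarrow> ('a \<Rightarrow> 'a) \<Rightarrow> 'a \<Rightarrow> real" where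
  "cov_deriv_riem M g V X Y Z W p =
     (let D = levi_civita M g
      in deriv_along V (riem M g X Y Z W) p
         - riem M g (D V X) Y Z W p - riem M g X (D V Y) Z W p
         - riem M g X Y (D V Z) W p - riem M g X Y Z (D V W) p)"

definition cov_deriv_ricci ::
    "'a::euclidean_space set \<Rightarrow> 'a metric_tensor \<Rightarrow>
     ('a \<Rightarrow> 'a) \<Rightarrow> ('a \<Rightarrow> 'a) \<Rightarrow> ('a \<Rightarrow> 'a) \<Rightarrow> 'a \<Rightarrow> real" where
  "cov_deriv_ricci M g V Y Z p =
     (let D = levi_civita M g
      in deriv_along V (ricci M g Y Z) p - ricci M g (D V Y) Z p - ricci M g Y (D V Z) p)"

definition divergence_riem ::
    "'a::euclidean_space set \<Rightarrow> 'a metric_tensor \<Rightarrow>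
     ('a \<Rightarrow> 'a) \<Rightarrow> ('a \<Rightarrow> 'a) \<Rightarrow> ('a \<Rightarrow> 'a) \<Rightarrow> 'a \<Rightarrow> real" where
  "divergence_riem M g Y Z W p =
     - metric_trace g p (\<lambda>v w. cov_deriv_riem M g (extend v) (extend w) Y Z W p)"

definition harmonic_curvature :: "'a::euclidean_space set \<Rightarrow> 'a metric_tensor \<Rightarrow> bool" where
  "harmonic_curvature M g \<longleftrightarrow>
     (\<forall>Y\<in>vector_fields M. \<forall>Z\<in>vector_fields M. \<forall>W\<in>vector_fields M. \<forall>p\<in>M.
        divergence_riem M g Y Z W p = 0)"

definition parallel_ricci :: "'a::euclidean_space set \<Rightarrow> 'a metric_tensor \<Rightarrow> bool" where
  "parallel_ricci M g \<longleftrightarrow>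
     (\<forall>V\<in>vector_fields M. \<forall>Y\<in>vector_fields M. \<forall>Z\<in>vector_fields M. \<forall>p\<in>M.
        cov_deriv_ricci M g V Y Z p = 0)"

end

theory Submission
  imports Defs
begin

text \<open>
  Write the metric as \<open>g = W\<^sup>-\<^sup>2 g\<^sub>0\<close>, with \<open>W\<close> extended to the cone over the punctured sphere as a
  function homogeneous of degree 1.  Then \<open>g\<close> is conformally flat, so its Schouten tensor is a Codazzi
  tensor; if the scalar curvature is constant, so is the Ricci tensor, and the divergence of the
  curvature tensor vanishes.

  If the Ricci tensor is parallel, so is the Schouten tensor.  In stereographic coordinates \<open>y\<close>
  with \<open>g = w\<^sup>-\<^sup>2 |dy|\<^sup>2\<close>, this gives \<open>\<partial>\<^sub>e\<^sup>3 (w\<^sup>2) = 3 \<partial>\<^sub>e |\<nabla>w|\<^sup>2\<close> for every unit vector \<open>e\<close>,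
  whence \<open>w\<^sup>2\<close> is a polynomial of degree at most 4 on every line.  By completeness \<open>w\<close> vanishes at
  the punctures.  Place one puncture at infinity and consider the line through two others: the
  nonnegative polynomial \<open>w\<^sup>2\<close> has two double zeros there, but a degree less than 4 since the
  puncture at infinity is at infinite distance.  Hence it vanishes, which is absurd.
\<close>

section \<open>Directional derivatives and smooth functions\<close>

text \<open>Degree 1 is the degree for which the Euclidean metric times \<open>W\<close> to the
  power -2 is invariant under dilations and under inversion in the unit sphere. The sphere, fixed by
  an isometry, is then totally geodesic, and curvature can be read off from flat derivatives in a
  vector space. The bound 4 on the degree is a compatibility condition. Along a single line the
  differential equation does not close up. It is therefore posed in a plane, where equality of mixed
  fourth derivatives of w^2 forces the third derivative of the squared gradient of w along lines to
  vanish, and this is a third of the fifth derivative of w^2. Completeness alone does not say that w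
  has a limit at a puncture; it only excludes that w stays bounded away from 0 on a curve running
  into it. Hence the polynomial is found first. It extends w^2 continuously to the puncture, and
  then its value there must be 0. At infinity the substitution of 1/t for the parameter multiplies
  w^2 by t^4, so that the coefficient of degree 4 takes the role of the value at the
  puncture.\<close>

definition dd :: "'a::real_normed_vector \<Rightarrow> ('a \<Rightarrow> 'b::real_normed_vector) \<Rightarrow> 'a \<Rightarrow> 'b" where
  "dd v f x = frechet_derivative f (at x) v"

lemma has_derivative_dd:
  "f differentiable (at x) \<Longrightarrow> (f has_derivative (\<lambda>v. dd v f x)) (at x)"
  by (simp add: dd_def[abs_def] frechet_derivative_works)

lemma dd_eqI: "(f has_derivative f') (at x) \<Longrightarrow> dd v f x = f' v"
  by (simp add: dd_def frechet_derivative_at[symmetric])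

lemma linear_dd: "f differentiable (at x) \<Longrightarrow> linear (\<lambda>v. dd v f x)"
  by (simp add: dd_def linear_frechet_derivative)

text \<open>No differentiability is required: \<open>frechet_derivative\<close> is a choice from the
  set of all derivatives at \<open>x\<close>, and that set depends only on the values near
  \<open>x\<close>. Iterated derivatives can therefore be rewritten before their regularity is
  known.\<close>

lemma dd_cong:
  assumes "open S" "x \<in> S" "\<And>y. y \<in> S \<Longrightarrow> f y = h y"
  shows "dd v f x = dd v h x"
proof -
  have "(f has_derivative f') (at x) \<longleftrightarrow> (h has_derivative f') (at x)" for f'
    using has_derivative_transform_within_open[OF _ assms(1,2), of f f' UNIV h]
      has_derivative_transform_within_open[OF _ assms(1,2), of h f' UNIV f] assms(3) by auto
  then show ?thesis
    by (simp add: dd_def frechet_derivative_def)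
qed

lemma differentiable_cong_open:
  assumes "f differentiable (at x)" "open S" "x \<in> S" "\<And>y. y \<in> S \<Longrightarrow> f y = h y"
  shows "h differentiable (at x)"
  using assms has_derivative_transform_within_open unfolding differentiable_def by blast

lemma dd_const [simp]: "dd v (\<lambda>x. c) x = 0"
  by (rule dd_eqI) (auto intro!: derivative_eq_intros)

lemma dd_bounded_linear: "bounded_linear f \<Longrightarrow> dd v f x = f v"
  by (rule dd_eqI) (rule bounded_linear_imp_has_derivative)

lemma dd_add:
  "f differentiable (at x) \<Longrightarrow> h differentiable (at x) \<Longrightarrow>
    dd v (\<lambda>x. f x + h x) x = dd v f x + dd v h x"
  by (rule dd_eqI) (intro derivative_intros has_derivative_dd)

lemma dd_diff:
  "f differentiable (at x) \<Longrightarrow> h differentiable (at x) \<Longrightarrow>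
    dd v (\<lambda>x. f x - h x) x = dd v f x - dd v h x"
  by (rule dd_eqI) (intro derivative_intros has_derivative_dd)

lemma dd_sum:
  "(\<And>i. i \<in> I \<Longrightarrow> f i differentiable (at x)) \<Longrightarrow>
    dd v (\<lambda>x. \<Sum>i\<in>I. f i x) x = (\<Sum>i\<in>I. dd v (f i) x)"
  by (rule dd_eqI) (intro derivative_intros has_derivative_dd)

lemma (in bounded_bilinear) dd_prod:
  assumes "f differentiable (at x)" "h differentiable (at x)"
  shows "dd v (\<lambda>x. prod (f x) (h x)) x = prod (f x) (dd v h x) + prod (dd v f x) (h x)"
  by (rule dd_eqI[OF FDERIV[OF has_derivative_dd has_derivative_dd]]) (use assms in auto)

lemma (in bounded_bilinear) differentiable_prod:
  assumes "f differentiable (at x)" "h differentiable (at x)"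
  shows "(\<lambda>x. prod (f x) (h x)) differentiable (at x)"
  using FDERIV[OF has_derivative_dd[OF assms(1)] has_derivative_dd[OF assms(2)]]
  by (auto simp: differentiable_def)

lemmas dd_mult = bounded_bilinear.dd_prod[OF bounded_bilinear_mult]
lemmas dd_scaleR = bounded_bilinear.dd_prod[OF bounded_bilinear_scaleR]
lemmas dd_inner = bounded_bilinear.dd_prod[OF bounded_bilinear_inner]
lemmas differentiable_inner' = bounded_bilinear.differentiable_prod[OF bounded_bilinear_inner]

lemma dd_bounded_linear_comp:
  assumes "bounded_linear l" "f differentiable (at x)"
  shows "dd v (\<lambda>x. l (f x)) x = l (dd v f x)"
  by (rule dd_eqI[OF bounded_linear.has_derivative[OF assms(1) has_derivative_dd[OF assms(2)]]])

lemma dd_compose: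
  assumes "h differentiable (at x)" "f differentiable (at (h x))"
  shows "dd v (\<lambda>x. f (h x)) x = dd (dd v h x) f (h x)"
  using dd_eqI[OF diff_chain_at[OF has_derivative_dd[OF assms(1)] has_derivative_dd[OF assms(2)]]]
  by (simp add: o_def)

lemma differentiable_compose':
  assumes "h differentiable (at x)" "f differentiable (at (h x))"
  shows "(\<lambda>x. f (h x)) differentiable (at x)"
  using diff_chain_at[OF has_derivative_dd[OF assms(1)] has_derivative_dd[OF assms(2)]]
  by (auto simp: differentiable_def o_def)

lemma dd_basis:
  fixes f :: "'a::euclidean_space \<Rightarrow> 'b::real_normed_vector"
  assumes "f differentiable (at x)"
  shows "dd v f x = (\<Sum>b\<in>Basis. (v \<bullet> b) *\<^sub>R dd b f x)"
proof -
  have "dd v f x = dd (\<Sum>b\<in>Basis. (v \<bullet> b) *\<^sub>R b) f x"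
    by (simp add: euclidean_representation)
  also have "\<dots> = (\<Sum>b\<in>Basis. (v \<bullet> b) *\<^sub>R dd b f x)"
    by (simp add: linear_sum[OF linear_dd[OF assms]] linear_cmul[OF linear_dd[OF assms]])
  finally show ?thesis .
qed

section \<open>Closure properties of the classes C^k and of smooth functions\<close>

lemma C_k_on_Suc:
  "C_k_on (Suc k) S f \<longleftrightarrow> (\<forall>x\<in>S. f differentiable (at x)) \<and> (\<forall>v. C_k_on k S (dd v f))"
  by (simp add: dd_def[abs_def])

declare C_k_on.simps(2) [simp del]

lemma C_k_on_cong:
  assumes "open S" "\<And>x. x \<in> S \<Longrightarrow> f x = h x"
  shows "C_k_on k S f \<longleftrightarrow> C_k_on k S h"
  using assms(2)
proof (induction k arbitrary: f h)
  case 0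
  then show ?case by (auto cong: continuous_on_cong)
next
  case (Suc k)
  have "(\<forall>x\<in>S. f differentiable (at x)) \<longleftrightarrow> (\<forall>x\<in>S. h differentiable (at x))"
    using differentiable_cong_open[OF _ assms(1), of f _ h] differentiable_cong_open[OF _ assms(1), of h _ f]
      Suc.prems by (auto simp: eq_commute)
  moreover have "C_k_on k S (dd v f) \<longleftrightarrow> C_k_on k S (dd v h)" for v
    by (rule Suc.IH) (use dd_cong[OF assms(1)] Suc.prems in blast)
  ultimately show ?case
    by (simp add: C_k_on_Suc)
qed

lemma C_k_on_mono: "C_k_on (Suc k) S f \<Longrightarrow> C_k_on k S f"
proof (induction k arbitrary: f)
  case 0
  then show ?case
    by (auto simp: C_k_on_Suc intro!: differentiable_imp_continuous_on differentiable_at_imp_differentiable_on)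
next
  case (Suc k)
  from Suc.prems show ?case
    by (auto simp: C_k_on_Suc[of "Suc k"] C_k_on_Suc[of k S f] intro: Suc.IH)
qed

lemma C_k_on_subset: "C_k_on k T f \<Longrightarrow> S \<subseteq> T \<Longrightarrow> C_k_on k S f"
  by (induction k arbitrary: f) (auto simp: C_k_on_Suc intro: continuous_on_subset)

lemma C_k_on_const: "C_k_on k S (\<lambda>x. c)"
proof (induction k arbitrary: c)
  case (Suc k)
  have "dd v (\<lambda>x::'a. c) = (\<lambda>x. 0)" for v by (rule ext) simp
  then show ?case using Suc by (simp add: C_k_on_Suc)
qed simp

lemma C_k_on_bounded_linear: "bounded_linear f \<Longrightarrow> C_k_on k S f"
proof (cases k)
  case (Suc j)
  assume f: "bounded_linear f"
  have "dd v f = (\<lambda>x. f v)" for v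
    by (rule ext) (rule dd_bounded_linear[OF f])
  then show ?thesis
    using f by (auto simp: Suc C_k_on_Suc C_k_on_const intro: bounded_linear_imp_differentiable)
qed (auto intro: linear_continuous_on)

lemma C_k_on_add:
  assumes "open S" "C_k_on k S f" "C_k_on k S h"
  shows "C_k_on k S (\<lambda>x. f x + h x)"
  using assms(2,3)
proof (induction k arbitrary: f h)
  case (Suc k)
  have "C_k_on k S (dd v (\<lambda>x. f x + h x)) \<longleftrightarrow> C_k_on k S (\<lambda>x. dd v f x + dd v h x)" for v
    by (rule C_k_on_cong[OF assms(1)]) (use Suc.prems in \<open>auto simp: C_k_on_Suc dd_add\<close>)
  then show ?case
    using Suc by (auto simp: C_k_on_Suc)
qed (auto intro: continuous_on_add)

lemma (in bounded_bilinear) C_k_on_prod: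
  assumes "open S" "C_k_on k S f" "C_k_on k S h"
  shows "C_k_on k S (\<lambda>x. prod (f x) (h x))"
  using assms(2,3)
proof (induction k arbitrary: f h)
  case (Suc k)
  have "C_k_on k S (dd v (\<lambda>x. prod (f x) (h x))) \<longleftrightarrow>
      C_k_on k S (\<lambda>x. prod (f x) (dd v h x) + prod (dd v f x) (h x))" for v
    by (rule C_k_on_cong[OF assms(1)]) (use Suc.prems in \<open>auto simp: C_k_on_Suc dd_prod\<close>)
  moreover have "C_k_on k S (\<lambda>x. prod (f x) (dd v h x) + prod (dd v f x) (h x))" for v
    by (intro C_k_on_add assms(1) Suc.IH C_k_on_mono[OF Suc.prems(1)]
        C_k_on_mono[OF Suc.prems(2)])
       (use Suc.prems in \<open>auto simp: C_k_on_Suc\<close>)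
  ultimately show ?case
    using Suc.prems by (auto simp: C_k_on_Suc differentiable_prod)
qed (simp add: continuous_on)

lemma C_k_on_sum:
  assumes "open S" "\<And>i. i \<in> I \<Longrightarrow> C_k_on k S (f i)"
  shows "C_k_on k S (\<lambda>x. \<Sum>i\<in>I. f i x)"
  using assms(2) by (induction I rule: infinite_finite_induct) (auto intro: C_k_on_const C_k_on_add[OF assms(1)])

text \<open>Induction over all outer functions with \<open>h\<close> fixed: expanded in a basis, the
  chain rule produces composites of the partial derivatives of \<open>f\<close> with the same
  \<open>h\<close>, multiplied by components of a derivative of \<open>h\<close>.\<close>

lemma C_k_on_compose:
  fixes f :: "'c::euclidean_space \<Rightarrow> 'b::real_normed_vector"
    and h :: "'a::real_normed_vector \<Rightarrow> 'c"
  assumes "open S" "C_k_on k S h" "C_k_on k T f" "h ` S \<subseteq> T"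
  shows "C_k_on k S (\<lambda>x. f (h x))"
  using assms(2,3)
proof (induction k arbitrary: f)
  case 0
  then show ?case
    using continuous_on_compose2[of T f S h] assms(4) by simp
next
  case (Suc k)
  have d: "h differentiable (at x)" "f differentiable (at (h x))" if "x \<in> S" for x
    using Suc.prems that assms(4) by (auto simp: C_k_on_Suc)
  have "C_k_on k S (dd v (\<lambda>x. f (h x))) \<longleftrightarrow>
      C_k_on k S (\<lambda>x. \<Sum>b\<in>Basis. (dd v h x \<bullet> b) *\<^sub>R dd b f (h x))" for v
    by (rule C_k_on_cong[OF assms(1)]) (simp add: dd_compose[OF d] dd_basis[OF d(2), symmetric])
  moreover have "C_k_on k S (\<lambda>x. \<Sum>b\<in>Basis. (dd v h x \<bullet> b) *\<^sub>R dd b f (h x))" for v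
  proof (intro C_k_on_sum assms(1) bounded_bilinear.C_k_on_prod[OF bounded_bilinear_scaleR]
      bounded_bilinear.C_k_on_prod[OF bounded_bilinear_inner] C_k_on_const)
    show "C_k_on k S (dd v h)"
      using Suc.prems by (auto simp: C_k_on_Suc)
    show "C_k_on k S (\<lambda>x. dd b f (h x))" for b
      by (rule Suc.IH[OF C_k_on_mono[OF Suc.prems(1)]]) (use Suc.prems in \<open>auto simp: C_k_on_Suc\<close>)
  qed
  ultimately show ?case
    using differentiable_compose'[OF d] by (simp add: C_k_on_Suc)
qed

lemma C_k_on_inverse:
  fixes f :: "'a::real_normed_vector \<Rightarrow> real"
  assumes "open S" "C_k_on k S f" "\<And>x. x \<in> S \<Longrightarrow> f x \<noteq> 0"
  shows "C_k_on k S (\<lambda>x. inverse (f x))"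
  using assms(2)
proof (induction k)
  case 0
  then show ?case using assms(3) by (simp add: continuous_on_inverse)
next
  case (Suc k)
  have hd: "((\<lambda>x. inverse (f x)) has_derivative
      (\<lambda>v. - (inverse (f x) * dd v f x * inverse (f x)))) (at x)" if "x \<in> S" for x
    by (rule Deriv.has_derivative_inverse[OF _ has_derivative_dd])
       (use that Suc.prems assms(3) in \<open>auto simp: C_k_on_Suc\<close>)
  have "C_k_on k S (dd v (\<lambda>x. inverse (f x))) \<longleftrightarrow>
      C_k_on k S (\<lambda>x. (- 1) * (inverse (f x) * dd v f x * inverse (f x)))" for v
    by (rule C_k_on_cong[OF assms(1)]) (use dd_eqI[OF hd] in auto)
  moreover have "C_k_on k S (\<lambda>x. (- 1) * (inverse (f x) * dd v f x * inverse (f x)))" for v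
    by (intro bounded_bilinear.C_k_on_prod[OF bounded_bilinear_mult] assms(1) C_k_on_const
        Suc.IH[OF C_k_on_mono[OF Suc.prems]])
       (use Suc.prems in \<open>auto simp: C_k_on_Suc\<close>)
  ultimately show ?case
    using hd by (auto simp: C_k_on_Suc differentiable_def)
qed

lemma C_k_on_exp:
  fixes f :: "'a::real_normed_vector \<Rightarrow> real"
  assumes "open S" "C_k_on k S f"
  shows "C_k_on k S (\<lambda>x. exp (f x))"
  using assms(2)
proof (induction k)
  case 0
  then show ?case by (simp add: continuous_on_exp)
next
  case (Suc k)
  have hd: "((\<lambda>x. exp (f x)) has_derivative (\<lambda>v. exp (f x) * dd v f x)) (at x)" if "x \<in> S" for x
    using that Suc.prems by (auto intro!: derivative_eq_intros has_derivative_dd simp: C_k_on_Suc)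
  have "C_k_on k S (dd v (\<lambda>x. exp (f x))) \<longleftrightarrow> C_k_on k S (\<lambda>x. exp (f x) * dd v f x)" for v
    by (rule C_k_on_cong[OF assms(1)]) (use dd_eqI[OF hd] in auto)
  moreover have "C_k_on k S (\<lambda>x. exp (f x) * dd v f x)" for v
  proof (intro bounded_bilinear.C_k_on_prod[OF bounded_bilinear_mult] assms(1))
    show "C_k_on k S (dd v f)"
      using Suc.prems by (auto simp: C_k_on_Suc)
    show "C_k_on k S (\<lambda>x. exp (f x))"
      by (rule Suc.IH[OF C_k_on_mono[OF Suc.prems]])
  qed
  ultimately show ?case
    using hd by (auto simp: C_k_on_Suc differentiable_def)
qed

lemma C_k_on_ln:
  fixes f :: "'a::real_normed_vector \<Rightarrow> real"
  assumes "open S" "C_k_on k S f" "\<And>x. x \<in> S \<Longrightarrow> f x > 0"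
  shows "C_k_on k S (\<lambda>x. ln (f x))"
proof (cases k)
  case 0
  then show ?thesis using assms by (fastforce intro: continuous_on_ln)
next
  case (Suc j)
  have hd: "((\<lambda>x. ln (f x)) has_derivative (\<lambda>v. inverse (f x) * dd v f x)) (at x)" if "x \<in> S" for x
    using that assms Suc
    by (auto intro!: derivative_eq_intros has_derivative_dd simp: C_k_on_Suc field_simps)
  have "C_k_on j S (dd v (\<lambda>x. ln (f x))) \<longleftrightarrow> C_k_on j S (\<lambda>x. inverse (f x) * dd v f x)" for v
    by (rule C_k_on_cong[OF assms(1)]) (use dd_eqI[OF hd] in auto)
  moreover have "C_k_on j S (\<lambda>x. inverse (f x) * dd v f x)" for v
  proof (intro bounded_bilinear.C_k_on_prod[OF bounded_bilinear_mult] assms(1))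
    show "C_k_on j S (dd v f)" using Suc assms by (auto simp: C_k_on_Suc)
    show "C_k_on j S (\<lambda>x. inverse (f x))"
      by (rule C_k_on_inverse[OF assms(1) C_k_on_mono[OF assms(2)[unfolded Suc]]])
         (use assms(3) in force)
  qed
  ultimately show ?thesis
    using hd by (auto simp: Suc C_k_on_Suc differentiable_def)
qed

definition smooth_on :: "'a::real_normed_vector set \<Rightarrow> ('a \<Rightarrow> 'b::real_normed_vector) \<Rightarrow> bool" where
  "smooth_on S f \<longleftrightarrow> (\<forall>k. C_k_on k S f)"

named_theorems smooth_intros

lemma smooth_on_differentiable: "smooth_on S f \<Longrightarrow> x \<in> S \<Longrightarrow> f differentiable (at x)"
  unfolding smooth_on_def using C_k_on_Suc by blast

lemma smooth_on_dd [smooth_intros]: "smooth_on S f \<Longrightarrow> smooth_on S (dd v f)"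
  unfolding smooth_on_def using C_k_on_Suc by blast

lemma smooth_on_cong:
  "open S \<Longrightarrow> (\<And>x. x \<in> S \<Longrightarrow> f x = h x) \<Longrightarrow> smooth_on S f \<longleftrightarrow> smooth_on S h"
  unfolding smooth_on_def using C_k_on_cong by blast

lemma smooth_on_subset: "smooth_on T f \<Longrightarrow> S \<subseteq> T \<Longrightarrow> smooth_on S f"
  unfolding smooth_on_def using C_k_on_subset by blast

lemma smooth_on_continuous: "smooth_on S f \<Longrightarrow> continuous_on S f"
  unfolding smooth_on_def by (metis C_k_on.simps(1))

lemma smooth_on_const [smooth_intros]: "smooth_on S (\<lambda>x. c)"
  by (simp add: smooth_on_def C_k_on_const)

lemma smooth_on_bounded_linear: "bounded_linear f \<Longrightarrow> smooth_on S f"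
  by (simp add: smooth_on_def C_k_on_bounded_linear)

lemma smooth_on_id [smooth_intros]: "smooth_on S (\<lambda>x. x)"
  by (rule smooth_on_bounded_linear) (rule bounded_linear_ident)

lemma smooth_on_add [smooth_intros]:
  "open S \<Longrightarrow> smooth_on S f \<Longrightarrow> smooth_on S h \<Longrightarrow> smooth_on S (\<lambda>x. f x + h x)"
  by (simp add: smooth_on_def C_k_on_add)

lemma smooth_on_sum [smooth_intros]:
  "open S \<Longrightarrow> (\<And>i. i \<in> I \<Longrightarrow> smooth_on S (f i)) \<Longrightarrow> smooth_on S (\<lambda>x. \<Sum>i\<in>I. f i x)"
  by (simp add: smooth_on_def C_k_on_sum)

lemma (in bounded_bilinear) smooth_on_prod:
  "open S \<Longrightarrow> smooth_on S f \<Longrightarrow> smooth_on S h \<Longrightarrow> smooth_on S (\<lambda>x. prod (f x) (h x))"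
  by (simp add: smooth_on_def C_k_on_prod)

lemmas smooth_on_mult [smooth_intros] = bounded_bilinear.smooth_on_prod[OF bounded_bilinear_mult]
lemmas smooth_on_scaleR [smooth_intros] = bounded_bilinear.smooth_on_prod[OF bounded_bilinear_scaleR]
lemmas smooth_on_inner [smooth_intros] = bounded_bilinear.smooth_on_prod[OF bounded_bilinear_inner]

lemma smooth_on_diff [smooth_intros]:
  "open S \<Longrightarrow> smooth_on S f \<Longrightarrow> smooth_on S h \<Longrightarrow> smooth_on S (\<lambda>x. f x - h x)"
  using smooth_on_add[of S f "\<lambda>x. (- 1) *\<^sub>R h x"] smooth_on_scaleR[of S "\<lambda>x. - 1" h]
  by (simp add: smooth_on_const)

lemma smooth_on_compose:
  fixes f :: "'c::euclidean_space \<Rightarrow> 'b::real_normed_vector"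
  assumes "open S" "smooth_on S h" "smooth_on T f" "h ` S \<subseteq> T"
  shows "smooth_on S (\<lambda>x. f (h x))"
  unfolding smooth_on_def
proof
  show "C_k_on k S (\<lambda>x. f (h x))" for k
    by (rule C_k_on_compose[OF assms(1) _ _ assms(4)]) (use assms(2,3) in \<open>simp_all add: smooth_on_def\<close>)
qed

lemma smooth_on_inverse [smooth_intros]:
  "open S \<Longrightarrow> smooth_on S f \<Longrightarrow> (\<And>x. x \<in> S \<Longrightarrow> f x \<noteq> 0) \<Longrightarrow> smooth_on S (\<lambda>x. inverse (f x :: real))"
  by (simp add: smooth_on_def C_k_on_inverse)

lemma smooth_on_exp [smooth_intros]:
  "open S \<Longrightarrow> smooth_on S f \<Longrightarrow> smooth_on S (\<lambda>x. exp (f x :: real))"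
  by (simp add: smooth_on_def C_k_on_exp)

lemma smooth_on_ln [smooth_intros]:
  "open S \<Longrightarrow> smooth_on S f \<Longrightarrow> (\<And>x. x \<in> S \<Longrightarrow> f x > 0) \<Longrightarrow> smooth_on S (\<lambda>x. ln (f x :: real))"
  by (simp add: smooth_on_def C_k_on_ln)

lemma smooth_on_norm [smooth_intros]:
  fixes S :: "'a::real_inner set"
  assumes "open S" "0 \<notin> S"
  shows "smooth_on S norm"
proof -
  have "smooth_on S (\<lambda>x. exp (inverse 2 * ln (x \<bullet> x)))"
    by (intro smooth_intros assms) (use assms in auto)
  moreover have "exp (inverse 2 * ln (x \<bullet> x)) = norm x" if "x \<in> S" for x
  proof -
    have x: "x \<noteq> 0" using that assms by auto
    then have "ln (x \<bullet> x) = 2 * ln (norm x)"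
      by (simp add: dot_square_norm ln_realpow)
    then show ?thesis using x by simp
  qed
  ultimately show ?thesis
    using smooth_on_cong[OF assms(1), of "\<lambda>x. exp (inverse 2 * ln (x \<bullet> x))" norm] by simp
qed

lemma smooth_on_sgn [smooth_intros]:
  fixes S :: "'a::real_inner set"
  assumes "open S" "0 \<notin> S"
  shows "smooth_on S sgn"
proof -
  have "smooth_on S (\<lambda>x::'a. inverse (norm x) *\<^sub>R x)"
    by (intro smooth_intros assms) (use assms in auto)
  then show ?thesis
    by (simp add: sgn_div_norm[abs_def])
qed

section \<open>Symmetry of second derivatives\<close>

lemma dd_swap_real:
  fixes f :: "'a::real_normed_vector \<Rightarrow> real"
  assumes S: "open S" "x \<in> S" and f: "smooth_on S f"
  shows "dd v (dd w f) x = dd w (dd v f) x"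
proof -
  text \<open>Both sides are limits of the same second difference quotient.\<close>
  have mvt: "\<exists>\<xi>\<in>ball x d. k (x + h *\<^sub>R v + h *\<^sub>R w) - k (x + h *\<^sub>R v) - k (x + h *\<^sub>R w) + k x
      = h^2 * dd w (dd v k) \<xi>"
    if d: "ball x d \<subseteq> S" and k: "smooth_on S k" and h: "0 < h" "h * (norm v + norm w) < d"
    for k :: "'a \<Rightarrow> real" and v w d h
  proof -
    have inb: "x + s *\<^sub>R v + t *\<^sub>R w \<in> ball x d" if "0 \<le> s" "s \<le> h" "0 \<le> t" "t \<le> h" for s t
    proof -
      have "norm (s *\<^sub>R v + t *\<^sub>R w) \<le> s * norm v + t * norm w"
        using that norm_triangle_ineq[of "s *\<^sub>R v" "t *\<^sub>R w"] by simp
      also have "\<dots> \<le> h * norm v + h * norm w"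
        using that by (intro add_mono mult_right_mono) auto
      finally have "norm (s *\<^sub>R v + t *\<^sub>R w) < d"
        using h by (simp add: algebra_simps)
      moreover have "dist x (x + s *\<^sub>R v + t *\<^sub>R w) = norm (s *\<^sub>R v + t *\<^sub>R w)"
        by (metis add.assoc add_diff_cancel_left' dist_commute dist_norm)
      ultimately show ?thesis by simp
    qed
    have der: "((\<lambda>s. q (y + s *\<^sub>R u)) has_real_derivative dd u q (y + s *\<^sub>R u)) (at s)"
      if "y + s *\<^sub>R u \<in> ball x d" "smooth_on S q" for q :: "'a \<Rightarrow> real" and y u s
    proof -
      have *: "(q has_derivative (\<lambda>z. dd z q (y + s *\<^sub>R u))) (at (y + s *\<^sub>R u))"
        using that d by (intro has_derivative_dd smooth_on_differentiable[of S]) auto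
      have "((\<lambda>s. y + s *\<^sub>R u) has_derivative (\<lambda>h. h *\<^sub>R u)) (at s)"
        by (auto intro!: derivative_eq_intros)
      from has_derivative_compose[OF this *]
      have "((\<lambda>s. q (y + s *\<^sub>R u)) has_derivative (\<lambda>h. dd (h *\<^sub>R u) q (y + s *\<^sub>R u))) (at s)" .
      moreover have "dd (h *\<^sub>R u) q (y + s *\<^sub>R u) = dd u q (y + s *\<^sub>R u) * h" for h
        using linear_cmul[OF linear_dd, of q] smooth_on_differentiable[of S q] that d by auto
      ultimately show ?thesis
        by (simp add: has_field_derivative_def)
    qed
    \<comment> \<open>The mean value theorem is used twice: in direction \<open>v\<close> for the
      difference of two parallel edges of a parallelogram, then in direction \<open>w\<close> for
      the derivative \<open>dd v k\<close>.\<close>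
    let ?p = "\<lambda>s. k (x + h *\<^sub>R w + s *\<^sub>R v) - k (x + s *\<^sub>R v)"
    have "\<exists>s. 0 < s \<and> s < h \<and> ?p h - ?p 0 = (h - 0) *
        (dd v k (x + h *\<^sub>R w + s *\<^sub>R v) - dd v k (x + s *\<^sub>R v))"
    proof (rule MVT2[OF h(1)])
      fix s assume s: "0 \<le> s" "s \<le> h"
      have "x + h *\<^sub>R w + s *\<^sub>R v \<in> ball x d" "x + s *\<^sub>R v \<in> ball x d"
        using inb[OF s, of h] inb[OF s, of 0] h by (simp_all add: add.commute add.left_commute)
      then show "(?p has_real_derivative (dd v k (x + h *\<^sub>R w + s *\<^sub>R v) - dd v k (x + s *\<^sub>R v))) (at s)"
        by (intro DERIV_diff der k)
    qed
    then obtain s where s: "0 < s" "s < h"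
      and eq1: "?p h - ?p 0 = h * (dd v k (x + h *\<^sub>R w + s *\<^sub>R v) - dd v k (x + s *\<^sub>R v))" by auto
    let ?q = "\<lambda>t. dd v k ((x + s *\<^sub>R v) + t *\<^sub>R w)"
    have "\<exists>t. 0 < t \<and> t < h \<and> ?q h - ?q 0 = (h - 0) * dd w (dd v k) ((x + s *\<^sub>R v) + t *\<^sub>R w)"
    proof (rule MVT2[OF h(1)])
      fix t assume t: "0 \<le> t" "t \<le> h"
      show "(?q has_real_derivative dd w (dd v k) ((x + s *\<^sub>R v) + t *\<^sub>R w)) (at t)"
        using inb[of s t] s t by (intro der smooth_intros k) auto
    qed
    then obtain t where t: "0 < t" "t < h"
      and eq2: "?q h - ?q 0 = h * dd w (dd v k) (x + s *\<^sub>R v + t *\<^sub>R w)" by auto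
    have "k (x + h *\<^sub>R v + h *\<^sub>R w) - k (x + h *\<^sub>R v) - k (x + h *\<^sub>R w) + k x = ?p h - ?p 0"
      by (simp add: algebra_simps)
    also have "\<dots> = h * (?q h - ?q 0)"
      by (subst eq1) (simp add: add.commute add.left_commute)
    also have "\<dots> = h^2 * dd w (dd v k) (x + s *\<^sub>R v + t *\<^sub>R w)"
      by (subst eq2) (simp add: power2_eq_square)
    finally show ?thesis
      using inb[of s t] s t by auto
  qed
  have cont: "isCont (dd w (dd v f)) x" for v w
    using smooth_on_continuous[OF smooth_on_dd[OF smooth_on_dd[OF f]]] S continuous_on_eq_continuous_at
    by blast
  show ?thesis
  proof (rule ccontr)
    assume ne: "dd v (dd w f) x \<noteq> dd w (dd v f) x"
    define e where "e = \<bar>dd v (dd w f) x - dd w (dd v f) x\<bar> / 2"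
    have e: "e > 0" using ne by (simp add: e_def)
    obtain d1 where d1: "d1 > 0" "\<And>y. dist y x < d1 \<Longrightarrow> \<bar>dd w (dd v f) y - dd w (dd v f) x\<bar> < e"
      using cont[of w v] e unfolding continuous_at_eps_delta dist_real_def by metis
    obtain d2 where d2: "d2 > 0" "\<And>y. dist y x < d2 \<Longrightarrow> \<bar>dd v (dd w f) y - dd v (dd w f) x\<bar> < e"
      using cont[of v w] e unfolding continuous_at_eps_delta dist_real_def by metis
    obtain d3 where d3: "d3 > 0" "ball x d3 \<subseteq> S"
      using S open_contains_ball by blast
    define d where "d = min d1 (min d2 d3)"
    \<comment> \<open>The summand 1 makes the denominator positive and the bound on the
      parallelogram strict, even for \<open>v = w = 0\<close>.\<close>
    define h where "h = d / (norm v + norm w + 1)"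
    have d: "d > 0" "d \<le> d1" "d \<le> d2" "ball x d \<subseteq> S"
      using d1 d2 d3 by (auto simp: d_def)
    have n: "norm v + norm w + 1 > 0" by (simp add: add_nonneg_pos)
    have h: "h > 0" using n d by (simp add: h_def)
    have hd: "h * (norm v + norm w) < d"
    proof -
      have "h * (norm v + norm w) < h * (norm v + norm w + 1)" using h by simp
      also have "\<dots> = d" using n by (simp add: h_def)
      finally show ?thesis .
    qed
    obtain \<xi> where \<xi>: "\<xi> \<in> ball x d" "f (x + h *\<^sub>R v + h *\<^sub>R w) - f (x + h *\<^sub>R v) - f (x + h *\<^sub>R w) + f x
      = h^2 * dd w (dd v f) \<xi>"
      using mvt[OF d(4) f h hd] by blast
    obtain \<eta> where \<eta>: "\<eta> \<in> ball x d" "f (x + h *\<^sub>R w + h *\<^sub>R v) - f (x + h *\<^sub>R w) - f (x + h *\<^sub>R v) + f x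
      = h^2 * dd v (dd w f) \<eta>"
      using mvt[OF d(4) f h, of w v] hd by (auto simp: add.commute)
    have "h^2 * dd w (dd v f) \<xi> = h^2 * dd v (dd w f) \<eta>"
      using \<xi>(2) \<eta>(2) by (simp add: algebra_simps)
    then have "dd w (dd v f) \<xi> = dd v (dd w f) \<eta>" using h by simp
    moreover have "\<bar>dd w (dd v f) \<xi> - dd w (dd v f) x\<bar> < e"
      using d1(2)[of \<xi>] \<xi>(1) d by (auto simp: dist_commute)
    moreover have "\<bar>dd v (dd w f) \<eta> - dd v (dd w f) x\<bar> < e"
      using d2(2)[of \<eta>] \<eta>(1) d by (auto simp: dist_commute)
    ultimately have "\<bar>dd v (dd w f) x - dd w (dd v f) x\<bar> < 2 * e"
      unfolding abs_less_iff by auto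
    then show False
      by (simp add: e_def)
  qed
qed

lemma dd_swap:
  fixes f :: "'a::real_normed_vector \<Rightarrow> 'b::euclidean_space"
  assumes S: "open S" "x \<in> S" and f: "smooth_on S f"
  shows "dd v (dd w f) x = dd w (dd v f) x"
proof (rule euclidean_eqI)
  fix b :: 'b assume "b \<in> Basis"
  have comp: "dd u (\<lambda>y. q y \<bullet> b) y = dd u q y \<bullet> b" if "smooth_on S q" "y \<in> S"
    for u y and q :: "'a \<Rightarrow> 'b"
    using dd_bounded_linear_comp[OF bounded_linear_inner_left smooth_on_differentiable[OF that]] .
  have "dd v (dd w f) x \<bullet> b = dd v (dd w (\<lambda>y. f y \<bullet> b)) x" for v w
    using comp[OF smooth_on_dd[OF f] S(2)] dd_cong[OF S, of "dd w (\<lambda>y. f y \<bullet> b)" "\<lambda>y. dd w f y \<bullet> b" v]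
      comp[OF f] by simp
  then show "dd v (dd w f) x \<bullet> b = dd w (dd v f) x \<bullet> b"
    using dd_swap_real[OF S smooth_on_inner[OF S(1) f smooth_on_const]] by metis
qed

text \<open>Product rule for a linear map and an argument that both move with the point. Only the
  functions \<open>Q y c\<close> for fixed \<open>c\<close> are known to be differentiable, so the
  argument is expanded in a basis. The rule governs terms such as \<open>dd (Y y) f y\<close>, whose
  direction depends on the point.\<close>

lemma dd_linear_family:
  fixes Q :: "'a::real_normed_vector \<Rightarrow> 'c::euclidean_space \<Rightarrow> 'b::real_normed_vector"
  assumes S: "open S" "x \<in> S" and lin: "\<And>y. y \<in> S \<Longrightarrow> linear (Q y)"
    and dQ: "\<And>c. (\<lambda>y. Q y c) differentiable (at x)" and dY: "Y differentiable (at x)"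
  shows "dd u (\<lambda>y. Q y (Y y)) x = dd u (\<lambda>y. Q y (Y x)) x + Q x (dd u Y x)"
    and "(\<lambda>y. Q y (Y y)) differentiable (at x)"
proof -
  have expand: "Q y v = (\<Sum>b\<in>Basis. (v \<bullet> b) *\<^sub>R Q y b)" if "y \<in> S" for y v
  proof -
    have "Q y v = Q y (\<Sum>b\<in>Basis. (v \<bullet> b) *\<^sub>R b)" by (simp add: euclidean_representation)
    then show ?thesis using lin[OF that] by (simp add: linear_sum linear_cmul)
  qed
  have dYb: "(\<lambda>y. Y y \<bullet> b) differentiable (at x)" for b
    by (intro differentiable_inner' dY) simp
  have d: "(\<lambda>y. (Y y \<bullet> b) *\<^sub>R Q y b) differentiable (at x)" for b
    by (intro bounded_bilinear.differentiable_prod[OF bounded_bilinear_scaleR] dYb dQ)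
  have d': "(\<lambda>y. (Y x \<bullet> b) *\<^sub>R Q y b) differentiable (at x)" for b
    by (intro bounded_bilinear.differentiable_prod[OF bounded_bilinear_scaleR] dQ) simp
  have sum1: "dd u (\<lambda>y. \<Sum>b\<in>Basis. (Y y \<bullet> b) *\<^sub>R Q y b) x
      = (\<Sum>b\<in>Basis. dd u (\<lambda>y. (Y y \<bullet> b) *\<^sub>R Q y b) x)"
    by (rule dd_sum) (rule d)
  have sum2: "dd u (\<lambda>y. \<Sum>b\<in>Basis. (Y x \<bullet> b) *\<^sub>R Q y b) x
      = (\<Sum>b\<in>Basis. dd u (\<lambda>y. (Y x \<bullet> b) *\<^sub>R Q y b) x)"
    by (rule dd_sum) (rule d')
  have term1: "dd u (\<lambda>y. (Y y \<bullet> b) *\<^sub>R Q y b) x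
      = (Y x \<bullet> b) *\<^sub>R dd u (\<lambda>y. Q y b) x + (dd u Y x \<bullet> b) *\<^sub>R Q x b" for b
    unfolding dd_scaleR[OF dYb dQ] dd_inner[OF dY differentiable_const] by simp
  have term2: "dd u (\<lambda>y. (Y x \<bullet> b) *\<^sub>R Q y b) x = (Y x \<bullet> b) *\<^sub>R dd u (\<lambda>y. Q y b) x" for b
    unfolding dd_scaleR[OF differentiable_const dQ] by simp
  have "dd u (\<lambda>y. Q y (Y y)) x = dd u (\<lambda>y. \<Sum>b\<in>Basis. (Y y \<bullet> b) *\<^sub>R Q y b) x"
    by (rule dd_cong[OF S]) (rule expand)
  moreover have "dd u (\<lambda>y. Q y (Y x)) x = dd u (\<lambda>y. \<Sum>b\<in>Basis. (Y x \<bullet> b) *\<^sub>R Q y b) x"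
    by (rule dd_cong[OF S]) (rule expand)
  moreover have "Q x (dd u Y x) = (\<Sum>b\<in>Basis. (dd u Y x \<bullet> b) *\<^sub>R Q x b)"
    by (rule expand[OF S(2)])
  ultimately show "dd u (\<lambda>y. Q y (Y y)) x = dd u (\<lambda>y. Q y (Y x)) x + Q x (dd u Y x)"
    unfolding sum1 sum2 term1 term2 by (simp only: sum.distrib)
  have "(\<lambda>y. \<Sum>b\<in>Basis. (Y y \<bullet> b) *\<^sub>R Q y b) differentiable (at x)"
    by (intro differentiable_sum) (use d in auto)
  then show "(\<lambda>y. Q y (Y y)) differentiable (at x)"
    by (rule differentiable_cong_open[OF _ S]) (rule expand[symmetric])
qed

lemma dd_bilinear_family:
  fixes Q :: "'a::real_normed_vector \<Rightarrow> 'c::euclidean_space \<Rightarrow> 'd::euclidean_space \<Rightarrow> 'b::real_normed_vector"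
  assumes S: "open S" "x \<in> S" and lin: "\<And>y c. y \<in> S \<Longrightarrow> linear (Q y c)" "\<And>y c. y \<in> S \<Longrightarrow> linear (\<lambda>b. Q y b c)"
    and dQ: "\<And>b c. (\<lambda>y. Q y b c) differentiable (at x)"
    and dY: "Y differentiable (at x)" and dZ: "Z differentiable (at x)"
  shows "dd u (\<lambda>y. Q y (Y y) (Z y)) x
    = dd u (\<lambda>y. Q y (Y x) (Z x)) x + Q x (dd u Y x) (Z x) + Q x (Y x) (dd u Z x)"
    and "(\<lambda>y. Q y (Y y) (Z y)) differentiable (at x)"
proof -
  have inner: "dd u (\<lambda>y. Q y (Y y) c) x = dd u (\<lambda>y. Q y (Y x) c) x + Q x (dd u Y x) c"
    "(\<lambda>y. Q y (Y y) c) differentiable (at x)" for c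
    using dd_linear_family[where Q = "\<lambda>y b. Q y b c", OF S lin(2) dQ dY] by auto
  note outer = dd_linear_family[where Q = "\<lambda>y. Q y (Y y)" and Y = Z, OF S lin(1) inner(2) dZ]
  show "(\<lambda>y. Q y (Y y) (Z y)) differentiable (at x)"
    by (rule outer(2))
  show "dd u (\<lambda>y. Q y (Y y) (Z y)) x
    = dd u (\<lambda>y. Q y (Y x) (Z x)) x + Q x (dd u Y x) (Z x) + Q x (Y x) (dd u Z x)"
    using outer(1)[of u] inner(1)[of "Z x"] by simp
qed

section \<open>Metrics on the sphere that are conformal to the round metric\<close>

text \<open>
  The conformal factor is encoded by a function \<open>L\<close> on the cone over \<open>M\<close> with
  \<open>L (c x) = L x + ln c\<close>.  The metric \<open>g\<close> is then the restriction to the sphere of the conformally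
  flat metric \<open>exp (- 2 L) \<langle>\<cdot>, \<cdot>\<rangle>\<close> of the cone, for which the sphere is totally geodesic, so that
  connection and curvature can be computed with the flat derivatives of the ambient space.
\<close>

locale conformal_metric =
  fixes M :: "'a::euclidean_space set" and L :: "'a \<Rightarrow> real" and g :: "'a metric_tensor"
  assumes M_sphere: "M \<subseteq> sphere 0 1"
    and open_cone': "open {x. sgn x \<in> M}"
    and smooth_L': "smooth_on {x. sgn x \<in> M} L"
    and L_scaleR: "\<And>c x. c > 0 \<Longrightarrow> sgn x \<in> M \<Longrightarrow> L (c *\<^sub>R x) = L x + ln c"
    and g_eq: "\<And>p v w. p \<in> M \<Longrightarrow> v \<bullet> p = 0 \<Longrightarrow> w \<bullet> p = 0 \<Longrightarrow> g p v w = exp (- 2 * L p) * (v \<bullet> w)"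
begin

section \<open>The cone over M, tangential derivatives and vector fields\<close>

definition Mcone :: "'a set" where "Mcone = {x. sgn x \<in> M}"

lemma open_cone: "open Mcone" and smooth_L: "smooth_on Mcone L"
  using open_cone' smooth_L' by (simp_all add: Mcone_def)

lemma norm_M: "p \<in> M \<Longrightarrow> norm p = 1"
  using M_sphere by auto

lemma sgn_M: "p \<in> M \<Longrightarrow> sgn p = p"
  by (simp add: sgn_div_norm norm_M)

lemma inner_M: "p \<in> M \<Longrightarrow> p \<bullet> p = 1"
  using norm_M by (simp add: dot_square_norm)

lemma M_cone: "p \<in> M \<Longrightarrow> p \<in> Mcone"
  by (simp add: Mcone_def sgn_M)

lemma sgn_cone: "x \<in> Mcone \<Longrightarrow> sgn x \<in> M"
  by (simp add: Mcone_def)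

lemma zero_notin_cone: "0 \<notin> Mcone"
  using M_sphere by (auto simp: Mcone_def)

lemma scaleR_cone: "x \<in> Mcone \<Longrightarrow> c > 0 \<Longrightarrow> c *\<^sub>R x \<in> Mcone"
  by (simp add: Mcone_def sgn_scaleR)

lemma smooth_sgn: "smooth_on Mcone sgn"
  by (rule smooth_on_sgn[OF open_cone zero_notin_cone])

lemma smooth_fun_iff: "smooth_fun M f \<longleftrightarrow> smooth_on Mcone (\<lambda>x. f (sgn x))"
  by (simp add: smooth_fun_def smooth_on_def Mcone_def)

text \<open>Smoothness is defined by the extension that is constant on rays. Any smooth function on
  the cone with the right values on \<open>M\<close> may take its place, in particular expressions
  in \<open>L\<close>, which is not constant on rays.\<close>

lemma smooth_fun_ambient:
  assumes "smooth_on Mcone h" "\<And>q. q \<in> M \<Longrightarrow> f q = h q"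
  shows "smooth_fun M f"
proof -
  have "smooth_on Mcone (\<lambda>x. h (sgn x))"
    by (rule smooth_on_compose[OF open_cone smooth_sgn assms(1)]) (auto intro: M_cone sgn_cone)
  then show ?thesis
    unfolding smooth_fun_iff
    by (subst smooth_on_cong[OF open_cone, of _ "\<lambda>x. h (sgn x)"]) (auto intro: assms(2) sgn_cone)
qed

text \<open>The derivative of \<open>sgn\<close> at \<open>p\<close> is the orthogonal projection to
  the tangent space. It fixes \<open>X p\<close>, so the choice of the extension does not influence
  derivatives in this direction.\<close>

lemma deriv_along_ambient:
  assumes p: "p \<in> M" and t: "X p \<bullet> p = 0" and h: "h differentiable (at p)"
    and eq: "\<And>q. q \<in> M \<Longrightarrow> f q = h q"
  shows "deriv_along X f p = dd (X p) h p"
proof -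
  have p0: "p \<noteq> 0" using norm_M[OF p] by auto
  have "(norm has_derivative (\<lambda>v. p \<bullet> v)) (at p)"
    using has_derivative_norm[OF p0] by (simp add: sgn_M[OF p] inner_commute)
  from has_derivative_scaleR[OF Deriv.has_derivative_inverse[OF _ this] has_derivative_ident]
  have "((\<lambda>x. inverse (norm x) *\<^sub>R x) has_derivative (\<lambda>v. v - (p \<bullet> v) *\<^sub>R p)) (at p)"
    by (simp add: norm_M[OF p])
  then have "(sgn has_derivative (\<lambda>v. v - (p \<bullet> v) *\<^sub>R p)) (at p)"
    by (simp add: sgn_div_norm[abs_def])
  from dd_eqI[OF this] have s: "dd (X p) sgn p = X p"
    using t by (simp add: inner_commute)
  have "deriv_along X f p = dd (X p) (\<lambda>x. f (sgn x)) p"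
    by (simp add: deriv_along_def dd_def)
  also have "\<dots> = dd (X p) (\<lambda>x. h (sgn x)) p"
    by (rule dd_cong[OF open_cone M_cone[OF p]]) (rule eq[OF sgn_cone])
  also have "\<dots> = dd (dd (X p) sgn p) h (sgn p)"
    by (rule dd_compose) (use smooth_on_differentiable[OF smooth_sgn M_cone[OF p]] h in \<open>simp_all add: sgn_M[OF p]\<close>)
  finally show ?thesis
    by (simp add: s sgn_M[OF p])
qed

lemma deriv_along_eq: "deriv_along X f p = dd (X p) (\<lambda>x. f (sgn x)) p"
  by (simp add: deriv_along_def dd_def)

lemma deriv_along_cong:
  assumes "p \<in> M" "\<And>q. q \<in> M \<Longrightarrow> f q = h q"
  shows "deriv_along X f p = deriv_along X h p"
  unfolding deriv_along_eq by (rule dd_cong[OF open_cone M_cone[OF assms(1)]]) (rule assms(2)[OF sgn_cone])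

lemma smooth_fun_differentiable:
  "smooth_fun M f \<Longrightarrow> p \<in> M \<Longrightarrow> (\<lambda>x. f (sgn x)) differentiable (at p)"
  unfolding smooth_fun_iff using smooth_on_differentiable M_cone by blast

abbreviation VF :: "('a \<Rightarrow> 'a) set" where "VF \<equiv> vector_fields M"

lemma vector_fieldI:
  "smooth_fun M X \<Longrightarrow> (\<And>p. p \<in> M \<Longrightarrow> X p \<bullet> p = 0) \<Longrightarrow> X \<in> VF"
  by (simp add: vector_fields_def tangent_space_def)

lemma vector_field_tangent: "X \<in> VF \<Longrightarrow> p \<in> M \<Longrightarrow> X p \<bullet> p = 0"
  by (simp add: vector_fields_def tangent_space_def)

lemma vector_field_smooth: "X \<in> VF \<Longrightarrow> smooth_on Mcone (\<lambda>x. X (sgn x))"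
  by (simp add: vector_fields_def smooth_fun_iff)

lemma vector_field_smooth_fun: "X \<in> VF \<Longrightarrow> smooth_fun M X"
  by (simp add: vector_fields_def)

lemma vector_field_differentiable:
  "X \<in> VF \<Longrightarrow> p \<in> M \<Longrightarrow> (\<lambda>x. X (sgn x)) differentiable (at p)"
  by (simp add: vector_field_smooth_fun smooth_fun_differentiable)

lemma extend_vector_field: "extend v \<in> VF"
proof (rule vector_fieldI)
  have "smooth_on Mcone (\<lambda>x. v - (v \<bullet> x) *\<^sub>R x)"
    by (intro smooth_intros open_cone)
  then show "smooth_fun M (extend v)"
    by (rule smooth_fun_ambient) (simp add: extend_def)
  show "extend v p \<bullet> p = 0" if "p \<in> M" for p
    by (simp add: extend_def inner_diff_left inner_M[OF that])
qed

lemma extend_tangent: "v \<bullet> p = 0 \<Longrightarrow> extend v p = v"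
  by (simp add: extend_def)

subsection \<open>Derivatives of the conformal factor\<close>

text \<open>The Euclidean gradient of \<open>L\<close>.\<close>

definition B :: "'a \<Rightarrow> 'a" where
  "B x = (\<Sum>e\<in>Basis. dd e L x *\<^sub>R e)"

lemma L_differentiable: "x \<in> Mcone \<Longrightarrow> L differentiable (at x)"
  using smooth_L smooth_on_differentiable by blast

lemma dd_L_differentiable: "x \<in> Mcone \<Longrightarrow> dd v L differentiable (at x)"
  using smooth_on_dd[OF smooth_L] smooth_on_differentiable by blast

lemma linear_dL: "x \<in> Mcone \<Longrightarrow> linear (\<lambda>v. dd v L x)"
  by (rule linear_dd[OF L_differentiable])

lemma B_inner: "x \<in> Mcone \<Longrightarrow> B x \<bullet> v = dd v L x"
  unfolding B_def dd_basis[OF L_differentiable, of x v]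
  unfolding inner_sum_left inner_scaleR_left by (simp add: inner_commute mult.commute)

lemma smooth_B: "smooth_on Mcone B"
  unfolding B_def[abs_def] by (intro smooth_intros open_cone smooth_L)

lemma hess_L_sym: "x \<in> Mcone \<Longrightarrow> dd v (dd w L) x = dd w (dd v L) x"
  by (rule dd_swap[OF open_cone _ smooth_L])

lemma linear_hess1: "x \<in> Mcone \<Longrightarrow> linear (\<lambda>v. dd v (dd w L) x)"
  by (rule linear_dd[OF dd_L_differentiable])

lemma linear_hess2: "x \<in> Mcone \<Longrightarrow> linear (\<lambda>w. dd v (dd w L) x)"
  using linear_hess1[of x v] by (simp add: hess_L_sym)

lemma dd_B_inner: "x \<in> Mcone \<Longrightarrow> dd v B x \<bullet> w = dd v (dd w L) x"
proof -
  assume x: "x \<in> Mcone"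
  have "dd v B x \<bullet> w = dd v (\<lambda>y. B y \<bullet> w) x"
    by (rule dd_bounded_linear_comp[OF bounded_linear_inner_left, symmetric])
       (rule smooth_on_differentiable[OF smooth_B x])
  also have "\<dots> = dd v (dd w L) x"
    by (rule dd_cong[OF open_cone x]) (rule B_inner)
  finally show ?thesis .
qed

text \<open>Euler's relation for \<open>exp (L x)\<close>, which is homogeneous of degree 1: the
  scaling law \<open>L_scaleR\<close> is differentiated at \<open>c = 1\<close>.\<close>

lemma dd_L_radial: assumes x: "x \<in> Mcone" shows "dd x L x = 1"
proof -
  have "((\<lambda>t. t *\<^sub>R x) has_derivative (\<lambda>h. h *\<^sub>R x)) (at 1)"
    by (auto intro!: derivative_eq_intros)
  moreover have "(L has_derivative (\<lambda>v. dd v L x)) (at (1 *\<^sub>R x))"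
    using has_derivative_dd[OF L_differentiable[OF x]] by simp
  ultimately have "((\<lambda>t. L (t *\<^sub>R x)) has_derivative (\<lambda>h. dd (h *\<^sub>R x) L x)) (at 1)"
    by (rule has_derivative_compose)
  then have 1: "((\<lambda>t. L (t *\<^sub>R x)) has_derivative (\<lambda>h. h * dd x L x)) (at 1)"
    by (simp add: linear_cmul[OF linear_dL[OF x]])
  have "((\<lambda>t. L x + ln t) has_derivative (\<lambda>h. h)) (at (1::real))"
    by (auto intro!: derivative_eq_intros)
  then have 2: "((\<lambda>t. L (t *\<^sub>R x)) has_derivative (\<lambda>h. h)) (at 1)"
    by (rule has_derivative_transform_within_open[of _ _ _ _ "{0<..}"])
       (use L_scaleR x in \<open>auto simp: Mcone_def\<close>)
  from has_derivative_unique[OF 1 2] show ?thesis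
    by (metis mult.left_neutral)
qed

text \<open>Differentiating Euler's relation: the point \<open>x\<close> also serves as a direction,
  and moving that direction contributes \<open>dd v L x\<close>.\<close>

lemma hess_L_radial: assumes x: "x \<in> Mcone" shows "dd v (dd x L) x = - dd v L x"
proof -
  have "dd v (\<lambda>y. dd y L y) x = dd v (dd x L) x + dd (dd v (\<lambda>y. y) x) L x"
    by (rule dd_linear_family(1)[OF open_cone x linear_dL])
       (use dd_L_differentiable[OF x] in auto)
  moreover have "dd v (\<lambda>y. y) x = v"
    by (rule dd_bounded_linear[OF bounded_linear_ident])
  moreover have "dd v (\<lambda>y. dd y L y) x = dd v (\<lambda>y. 1) x"
    by (rule dd_cong[OF open_cone x]) (rule dd_L_radial)
  ultimately show ?thesis by simp
qed

text \<open>On tangent vectors, \<open>P\<close> is the Schouten tensor of \<open>g\<close>.\<close>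

definition P :: "'a \<Rightarrow> 'a \<Rightarrow> 'a \<Rightarrow> real" where
  "P x v w = dd v (dd w L) x + dd v L x * dd w L x - (B x \<bullet> B x) / 2 * (v \<bullet> w)"

text \<open>The difference of the Levi-Civita connections of
  \<open>exp (- 2 * L x) * (v \<bullet> w)\<close> and of the flat metric.\<close>

definition S :: "'a \<Rightarrow> 'a \<Rightarrow> 'a \<Rightarrow> 'a" where
  "S x v w = (v \<bullet> w) *\<^sub>R B x - (B x \<bullet> v) *\<^sub>R w - (B x \<bullet> w) *\<^sub>R v"

lemma P_sym: "x \<in> Mcone \<Longrightarrow> P x v w = P x w v"
  unfolding P_def by (subst hess_L_sym) (simp_all add: inner_commute mult.commute)

lemma linear_P1: "x \<in> Mcone \<Longrightarrow> linear (\<lambda>v. P x v w)"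
  unfolding P_def
  by (rule linearI)
     (simp_all add: linear_add[OF linear_hess1] linear_add[OF linear_dL] linear_cmul[OF linear_hess1]
       linear_cmul[OF linear_dL] inner_add_left algebra_simps)

lemma linear_P2: "x \<in> Mcone \<Longrightarrow> linear (\<lambda>w. P x v w)"
  using linear_P1[of x v] by (simp add: P_sym)

lemma smooth_P: "smooth_on Mcone (\<lambda>x. P x v w)"
  unfolding P_def divide_inverse by (intro smooth_intros open_cone smooth_L smooth_B)

text \<open>The two Euler relations cancel. Tangential and radial directions thus do not mix in
  \<open>P\<close>, which makes ambient traces usable for traces over the sphere.\<close>

lemma P_radial: "x \<in> Mcone \<Longrightarrow> v \<bullet> x = 0 \<Longrightarrow> P x v x = 0"
  by (simp add: P_def hess_L_radial dd_L_radial)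

lemma linear_S1: "linear (\<lambda>v. S x v w)"
  unfolding S_def by (rule linearI) (simp_all add: inner_add_left inner_add_right algebra_simps)

lemma S_sym: "S x v w = S x w v"
  by (simp add: S_def inner_commute)

lemma linear_S2: "linear (\<lambda>w. S x v w)"
  using linear_S1[of x v] by (simp add: S_sym)

lemma smooth_S: "smooth_on Mcone (\<lambda>x. S x v w)"
  unfolding S_def by (intro smooth_intros open_cone smooth_B)

subsection \<open>The Levi-Civita connection\<close>

definition conn :: "('a \<Rightarrow> 'a) \<Rightarrow> ('a \<Rightarrow> 'a) \<Rightarrow> 'a \<Rightarrow> 'a" where
  "conn X Y p = deriv_along X Y p + S p (X p) (Y p)"

lemma conn_cong:
  assumes "p \<in> M" "\<And>q. q \<in> M \<Longrightarrow> Y q = Y' q"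
  shows "conn X Y p = conn X Y' p"
  using deriv_along_cong[OF assms] assms by (simp add: conn_def)

text \<open>The second fundamental form of the sphere in flat space. The extension
  \<open>Y (sgn x)\<close> is orthogonal to \<open>x\<close> on the whole cone, and this relation is
  differentiated.\<close>

lemma deriv_along_normal:
  assumes "X \<in> VF" "Y \<in> VF" "p \<in> M"
  shows "deriv_along X Y p \<bullet> p = - (X p \<bullet> Y p)"
proof -
  let ?Y = "\<lambda>x. Y (sgn x)"
  have "dd (X p) (\<lambda>x. ?Y x \<bullet> x) p = ?Y p \<bullet> dd (X p) (\<lambda>x. x) p + dd (X p) ?Y p \<bullet> p"
    by (rule dd_inner) (use vector_field_differentiable[OF assms(2,3)] in auto)
  moreover have "dd (X p) (\<lambda>x. ?Y x \<bullet> x) p = dd (X p) (\<lambda>x. 0) p"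
  proof (rule dd_cong[OF open_cone M_cone[OF assms(3)]])
    fix x assume x: "x \<in> Mcone"
    have "Y (sgn x) \<bullet> sgn x = 0"
      by (rule vector_field_tangent[OF assms(2) sgn_cone[OF x]])
    moreover have "x = norm x *\<^sub>R sgn x"
      using zero_notin_cone x by (cases "x = 0") (simp_all add: sgn_div_norm)
    ultimately show "?Y x \<bullet> x = 0"
      by (metis inner_scaleR_right mult_zero_right)
  qed
  moreover have "dd (X p) (\<lambda>x. x) p = X p"
    by (rule dd_bounded_linear[OF bounded_linear_ident])
  ultimately show ?thesis
    by (simp add: deriv_along_eq sgn_M[OF assms(3)] inner_commute)
qed

lemma conn_vector_field:
  assumes X: "X \<in> VF" and Y: "Y \<in> VF"
  shows "conn X Y \<in> VF"
proof (rule vector_fieldI)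
  let ?X = "\<lambda>x. X (sgn x)" and ?Y = "\<lambda>x. Y (sgn x)"
  \<comment> \<open>The derivative along the moving direction \<open>X\<close> is expanded in a
    basis, because the smoothness rules treat only fixed directions.\<close>
  have "smooth_on Mcone (\<lambda>x. (\<Sum>b\<in>Basis. (?X x \<bullet> b) *\<^sub>R dd b ?Y x)
      + ((?X x \<bullet> ?Y x) *\<^sub>R B x - (B x \<bullet> ?X x) *\<^sub>R ?Y x - (B x \<bullet> ?Y x) *\<^sub>R ?X x))"
    by (intro smooth_intros open_cone vector_field_smooth X Y smooth_B)
  then show "smooth_fun M (conn X Y)"
  proof (rule smooth_fun_ambient)
    fix q assume q: "q \<in> M"
    show "conn X Y q = (\<Sum>b\<in>Basis. (?X q \<bullet> b) *\<^sub>R dd b ?Y q)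
      + ((?X q \<bullet> ?Y q) *\<^sub>R B q - (B q \<bullet> ?X q) *\<^sub>R ?Y q - (B q \<bullet> ?Y q) *\<^sub>R ?X q)"
      unfolding conn_def deriv_along_eq S_def dd_basis[OF vector_field_differentiable[OF Y q], of "X q"]
      by (simp add: sgn_M[OF q])
  qed
  fix p assume p: "p \<in> M"
  \<comment> \<open>By Euler's relation the normal part of \<open>S\<close> is
    \<open>X p \<bullet> Y p\<close>, which cancels that of the flat derivative: the sphere is
    totally geodesic.\<close>
  have "B p \<bullet> p = 1" using B_inner dd_L_radial M_cone[OF p] by simp
  then show "conn X Y p \<bullet> p = 0"
    using deriv_along_normal[OF X Y p] vector_field_tangent[OF X p] vector_field_tangent[OF Y p]
    by (simp add: conn_def S_def inner_add_left inner_diff_left)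
qed

lemma diff_vector_field:
  assumes "X \<in> VF" "Y \<in> VF"
  shows "(\<lambda>p. X p - Y p) \<in> VF"
  by (rule vector_fieldI)
     (simp_all add: smooth_fun_iff smooth_on_diff[OF open_cone] vector_field_smooth vector_field_tangent
       inner_diff_left assms)

lemma vector_field_cong:
  assumes "X \<in> VF" "\<And>p. p \<in> M \<Longrightarrow> Y p = X p"
  shows "Y \<in> VF"
proof (rule vector_fieldI)
  show "smooth_fun M Y"
    by (rule smooth_fun_ambient[OF vector_field_smooth[OF assms(1)]]) (simp add: sgn_M assms(2))
  show "Y p \<bullet> p = 0" if "p \<in> M" for p
    using vector_field_tangent[OF assms(1) that] assms(2)[OF that] by simp
qed

text \<open>As \<open>S\<close> is symmetric, the bracket is \<open>conn X Y - conn Y X\<close> on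
  \<open>M\<close>, and tangency is inherited from \<open>conn\<close>.\<close>

lemma lie_bracket_vector_field:
  assumes "X \<in> VF" "Y \<in> VF"
  shows "lie_bracket X Y \<in> VF"
  by (rule vector_field_cong[OF diff_vector_field[OF conn_vector_field[OF assms] conn_vector_field[OF assms(2,1)]]])
     (simp add: lie_bracket_def conn_def S_sym)

lemma g_vector_fields:
  assumes "Y \<in> VF" "Z \<in> VF" "p \<in> M"
  shows "g p (Y p) (Z p) = exp (- 2 * L p) * (Y p \<bullet> Z p)"
  using assms by (intro g_eq) (auto intro: vector_field_tangent)

lemma smooth_fun_g:
  assumes "Y \<in> VF" "Z \<in> VF"
  shows "smooth_fun M (\<lambda>p. g p (Y p) (Z p))"
proof -
  have "smooth_on Mcone (\<lambda>x. exp (- 2 * L x) * (Y (sgn x) \<bullet> Z (sgn x)))"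
    by (intro smooth_intros open_cone vector_field_smooth assms smooth_L)
  then show ?thesis
    by (rule smooth_fun_ambient) (simp add: g_vector_fields assms sgn_M)
qed

lemma conn_metric:
  assumes X: "X \<in> VF" and Y: "Y \<in> VF" and Z: "Z \<in> VF"
    and p: "p \<in> M"
  shows "deriv_along X (\<lambda>q. g q (Y q) (Z q)) p = g p (conn X Y p) (Z p) + g p (Y p) (conn X Z p)"
proof -
  let ?Y = "\<lambda>x. Y (sgn x)" and ?Z = "\<lambda>x. Z (sgn x)"
  note pc = M_cone[OF p]
  note Yd = vector_field_differentiable[OF Y p] and Zd = vector_field_differentiable[OF Z p]
  have e: "((\<lambda>x. exp (- 2 * L x)) has_derivative (\<lambda>v. - 2 * dd v L p * exp (- 2 * L p))) (at p)"
    by (auto intro!: derivative_eq_intros has_derivative_dd[OF L_differentiable[OF pc]])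
  have ed: "(\<lambda>x. exp (- 2 * L x)) differentiable (at p)"
    using e by (auto simp: differentiable_def)
  have yz: "(\<lambda>x. ?Y x \<bullet> ?Z x) differentiable (at p)"
    by (rule differentiable_inner'[OF Yd Zd])
  have "deriv_along X (\<lambda>q. g q (Y q) (Z q)) p = dd (X p) (\<lambda>x. exp (- 2 * L x) * (?Y x \<bullet> ?Z x)) p"
    by (rule deriv_along_ambient[where X = X and f = "\<lambda>q. g q (Y q) (Z q)" and h = "\<lambda>x. exp (- 2 * L x) * (?Y x \<bullet> ?Z x)",
          OF p vector_field_tangent[OF X p] differentiable_mult[OF ed yz]])
       (simp add: g_vector_fields Y Z sgn_M)
  also have "\<dots> = exp (- 2 * L p) * (Y p \<bullet> deriv_along X Z p + deriv_along X Y p \<bullet> Z p)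
      - 2 * dd (X p) L p * exp (- 2 * L p) * (Y p \<bullet> Z p)"
    unfolding dd_mult[OF ed yz] dd_inner[OF Yd Zd] dd_eqI[OF e]
    by (simp add: sgn_M[OF p] deriv_along_eq)
  also have "\<dots> = exp (- 2 * L p) * (conn X Y p \<bullet> Z p) + exp (- 2 * L p) * (Y p \<bullet> conn X Z p)"
    by (simp add: conn_def S_def B_inner[OF pc, symmetric] inner_add_left inner_add_right inner_diff_left
        inner_diff_right algebra_simps inner_commute)
  finally show ?thesis
    by (simp add: g_vector_fields conn_vector_field X Y Z p)
qed

lemma is_levi_civita_conn: "is_levi_civita M g conn"
  unfolding is_levi_civita_def
proof (intro conjI ballI allI impI)
  fix X Y Z p assume XYZ: "X \<in> VF" "Y \<in> VF" "Z \<in> VF" and p: "p \<in> M"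
  note d = vector_field_differentiable[OF _ p]
  show "conn (\<lambda>q. X q + Y q) Z p = conn X Z p + conn Y Z p"
    unfolding conn_def deriv_along_eq
    by (simp add: linear_add[OF linear_dd[OF d]] XYZ linear_add[OF linear_S1])
  show "conn X (\<lambda>q. Y q + Z q) p = conn X Y p + conn X Z p"
    unfolding conn_def deriv_along_eq dd_add[OF d[OF XYZ(2)] d[OF XYZ(3)]]
    by (simp add: linear_add[OF linear_S2])
  show "deriv_along X (\<lambda>q. g q (Y q) (Z q)) p = g p (conn X Y p) (Z p) + g p (Y p) (conn X Z p)"
    by (rule conn_metric[OF XYZ p])
next
  fix f :: "'a \<Rightarrow> real" and X Y p
  assume f: "smooth_fun M f" and XY: "X \<in> VF" "Y \<in> VF" and p: "p \<in> M"
  note d = vector_field_differentiable[OF _ p]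
  show "conn (\<lambda>q. f q *\<^sub>R X q) Y p = f p *\<^sub>R conn X Y p"
    unfolding conn_def deriv_along_eq
    by (simp add: linear_cmul[OF linear_dd[OF d]] XY linear_cmul[OF linear_S1] scaleR_add_right)
  show "conn X (\<lambda>q. f q *\<^sub>R Y q) p = deriv_along X f p *\<^sub>R Y p + f p *\<^sub>R conn X Y p"
    unfolding conn_def deriv_along_eq dd_scaleR[OF smooth_fun_differentiable[OF f p] d[OF XY(2)]]
    by (simp add: linear_cmul[OF linear_S2] scaleR_add_right sgn_M[OF p])
qed (auto simp: conn_vector_field lie_bracket_def conn_def S_sym)

text \<open>\<open>levi_civita\<close> is an arbitrary choice among the connections satisfying the
  axioms, so uniqueness is what transfers computations to \<open>conn\<close>. The difference of two
  solutions is symmetric because both have the same torsion, and skew because both preserve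
  \<open>g\<close>; together these force it to vanish.\<close>

lemma levi_civita_unique:
  assumes D: "is_levi_civita M g D" and X: "X \<in> VF" and Y: "Y \<in> VF"
    and p: "p \<in> M"
  shows "D X Y p = conn X Y p"
proof -
  have torsion: "E X Y p - E Y X p = lie_bracket X Y p"
    if "is_levi_civita M g E" "X \<in> VF" "Y \<in> VF" for E X Y
    using that p unfolding is_levi_civita_def by blast
  have metric: "deriv_along X (\<lambda>q. g q (Y q) (Z q)) p = g p (E X Y p) (Z p) + g p (Y p) (E X Z p)"
    if "is_levi_civita M g E" "X \<in> VF" "Y \<in> VF" "Z \<in> VF"
    for E X Y Z
    using that p unfolding is_levi_civita_def by blast
  note c = is_levi_civita_conn
  have vf: "D X Y \<in> VF" if "X \<in> VF" "Y \<in> VF" for X Y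
    using D that unfolding is_levi_civita_def by blast
  have tor: "D X Y p - D Y X p = conn X Y p - conn Y X p"
    if "X \<in> VF" "Y \<in> VF" for X Y
    using torsion[OF D that] torsion[OF c that] by simp
  have met: "g p (D X Y p) (Z p) + g p (Y p) (D X Z p) = g p (conn X Y p) (Z p) + g p (Y p) (conn X Z p)"
    if "X \<in> VF" "Y \<in> VF" "Z \<in> VF" for X Y Z
    using metric[OF D that] metric[OF c that] by simp
  define T where "T X Y = D X Y p - conn X Y p" for X Y
  have sym: "T X Y = T Y X" if "X \<in> VF" "Y \<in> VF" for X Y
    using tor[OF that] unfolding T_def by (simp add: algebra_simps)
  have anti: "T X Y \<bullet> Z p + Y p \<bullet> T X Z = 0"
    if "X \<in> VF" "Y \<in> VF" "Z \<in> VF" for X Y Z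
  proof -
    have "exp (- 2 * L p) * (D X Y p \<bullet> Z p + Y p \<bullet> D X Z p)
        = exp (- 2 * L p) * (conn X Y p \<bullet> Z p + Y p \<bullet> conn X Z p)"
      using met[OF that] by (simp add: g_vector_fields vf conn_vector_field that p distrib_left)
    then have "D X Y p \<bullet> Z p + Y p \<bullet> D X Z p = conn X Y p \<bullet> Z p + Y p \<bullet> conn X Z p"
      by simp
    then show ?thesis
      by (simp add: T_def inner_diff_left inner_diff_right)
  qed
  \<comment> \<open>The difference itself is the test field, so that orthogonality to it means that
    it has norm 0 at \<open>p\<close>.\<close>
  define Z where "Z q = D X Y q - conn X Y q" for q
  have Z: "Z \<in> VF"
    unfolding Z_def[abs_def] by (intro diff_vector_field vf conn_vector_field X Y)
  have "T X Y \<bullet> Z p = 0"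
    using anti[OF X Y Z] anti[OF Y X Z, folded sym[OF X Y]]
      anti[OF Z X Y, folded sym[OF X Z] sym[OF Y Z]] inner_commute[of "T X Z" "Y p"] by linarith
  then show ?thesis
    by (simp add: T_def Z_def)
qed

lemma levi_civita_is: "is_levi_civita M g (levi_civita M g)"
  unfolding levi_civita_def by (rule someI[of "is_levi_civita M g", OF is_levi_civita_conn])

lemma levi_civita_eq:
  "X \<in> VF \<Longrightarrow> Y \<in> VF \<Longrightarrow> p \<in> M \<Longrightarrow> levi_civita M g X Y p = conn X Y p"
  by (rule levi_civita_unique[OF levi_civita_is])

lemma levi_civita_vector_field:
  "X \<in> VF \<Longrightarrow> Y \<in> VF \<Longrightarrow> levi_civita M g X Y \<in> VF"
  using levi_civita_is unfolding is_levi_civita_def by blast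


subsection \<open>Curvature\<close>

lemma B_differentiable: "x \<in> Mcone \<Longrightarrow> B differentiable (at x)"
  using smooth_B smooth_on_differentiable by blast

lemma dd_S:
  assumes x: "x \<in> Mcone"
  shows "dd u (\<lambda>y. S y v w) x = (v \<bullet> w) *\<^sub>R dd u B x - (dd u B x \<bullet> v) *\<^sub>R w - (dd u B x \<bullet> w) *\<^sub>R v"
proof (rule dd_eqI)
  show "((\<lambda>y. S y v w) has_derivative
      (\<lambda>u. (v \<bullet> w) *\<^sub>R dd u B x - (dd u B x \<bullet> v) *\<^sub>R w - (dd u B x \<bullet> w) *\<^sub>R v)) (at x)"
    unfolding S_def
    by (auto intro!: derivative_eq_intros has_derivative_dd[OF B_differentiable[OF x]])
qed

lemma deriv_along_conn:
  assumes X: "X \<in> VF" and Y: "Y \<in> VF" and Z: "Z \<in> VF"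
    and p: "p \<in> M"
  shows "deriv_along X (conn Y Z) p
    = dd (X p) (dd (Y p) (\<lambda>x. Z (sgn x))) p + dd (deriv_along X Y p) (\<lambda>x. Z (sgn x)) p
      + dd (X p) (\<lambda>x. S x (Y p) (Z p)) p + S p (deriv_along X Y p) (Z p) + S p (Y p) (deriv_along X Z p)"
proof -
  let ?Y = "\<lambda>x. Y (sgn x)" and ?Z = "\<lambda>x. Z (sgn x)"
  note pc = M_cone[OF p]
  have lin: "linear (\<lambda>c. dd c ?Z y)" if "y \<in> Mcone" for y
    by (rule linear_dd[OF smooth_on_differentiable[OF vector_field_smooth[OF Z] that]])
  have dif: "dd c ?Z differentiable (at p)" for c
    by (rule smooth_on_differentiable[OF smooth_on_dd[OF vector_field_smooth[OF Z]] pc])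
  have 1: "\<And>u. dd u (\<lambda>x. dd (?Y x) ?Z x) p = dd u (dd (Y p) ?Z) p + dd (dd u ?Y p) ?Z p"
    "(\<lambda>x. dd (?Y x) ?Z x) differentiable (at p)"
    using dd_linear_family[where Q = "\<lambda>y c. dd c ?Z y" and Y = ?Y,
      OF open_cone pc lin dif vector_field_differentiable[OF Y p]] by (simp_all add: sgn_M[OF p])
  have 2: "\<And>u. dd u (\<lambda>x. S x (?Y x) (?Z x)) p
        = dd u (\<lambda>x. S x (Y p) (Z p)) p + S p (dd u ?Y p) (Z p) + S p (Y p) (dd u ?Z p)"
    "(\<lambda>x. S x (?Y x) (?Z x)) differentiable (at p)"
    using dd_bilinear_family[where Q = S and Y = ?Y and Z = ?Z,
      OF open_cone pc linear_S2 linear_S1 smooth_on_differentiable[OF smooth_S pc]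
        vector_field_differentiable[OF Y p] vector_field_differentiable[OF Z p]]
    by (simp_all add: sgn_M[OF p])
  have "deriv_along X (conn Y Z) p = dd (X p) (\<lambda>x. dd (?Y x) ?Z x + S x (?Y x) (?Z x)) p"
  proof (rule deriv_along_ambient[where X = X, OF p vector_field_tangent[OF X p]])
    show "(\<lambda>x. dd (?Y x) ?Z x + S x (?Y x) (?Z x)) differentiable (at p)"
      by (intro differentiable_add 1(2) 2(2))
  qed (simp add: conn_def deriv_along_eq sgn_M)
  also have "\<dots> = dd (X p) (\<lambda>x. dd (?Y x) ?Z x) p + dd (X p) (\<lambda>x. S x (?Y x) (?Z x)) p"
    by (rule dd_add[OF 1(2) 2(2)])
  finally show ?thesis
    unfolding 1(1) 2(1) by (simp add: deriv_along_eq[of X Y] deriv_along_eq[of X Z])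
qed

text \<open>The second derivatives of \<open>Z\<close> cancel by symmetry and its first derivatives
  cancel against the bracket term. The derivatives of \<open>S\<close> and its quadratic terms
  remain, as for any perturbation of a flat connection.\<close>

lemma curvature_op_eq:
  assumes X: "X \<in> VF" and Y: "Y \<in> VF" and Z: "Z \<in> VF"
    and p: "p \<in> M"
  shows "curvature_op M g X Y Z p
      = dd (X p) (\<lambda>x. S x (Y p) (Z p)) p - dd (Y p) (\<lambda>x. S x (X p) (Z p)) p
        + S p (X p) (S p (Y p) (Z p)) - S p (Y p) (S p (X p) (Z p))"
    and "curvature_op M g X Y Z p \<bullet> p = 0"
proof -
  note pc = M_cone[OF p]
  \<comment> \<open>\<open>levi_civita M g Y Z\<close> and \<open>conn Y Z\<close> are known to
    agree only on \<open>M\<close>; this suffices since \<open>conn X\<close> uses only values on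
    \<open>M\<close>.\<close>
  have it: "levi_civita M g X (levi_civita M g Y Z) p = conn X (conn Y Z) p"
    if "X \<in> VF" "Y \<in> VF" for X Y
    using levi_civita_eq[OF that(1) levi_civita_vector_field[OF that(2) Z] p]
      conn_cong[OF p levi_civita_eq[OF that(2) Z]] by simp
  have R: "curvature_op M g X Y Z p
      = conn X (conn Y Z) p - conn Y (conn X Z) p - conn (lie_bracket X Y) Z p"
    using it X Y levi_civita_eq[OF lie_bracket_vector_field[OF X Y] Z p]
    by (simp add: curvature_op_def)
  have swap: "dd (X p) (dd (Y p) (\<lambda>x. Z (sgn x))) p = dd (Y p) (dd (X p) (\<lambda>x. Z (sgn x))) p"
    by (rule dd_swap[OF open_cone pc vector_field_smooth[OF Z]])
  have lie: "deriv_along (lie_bracket X Y) Z p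
      = dd (deriv_along X Y p) (\<lambda>x. Z (sgn x)) p - dd (deriv_along Y X p) (\<lambda>x. Z (sgn x)) p"
    using linear_diff[OF linear_dd[OF vector_field_differentiable[OF Z p]]]
    by (simp add: deriv_along_eq[of "lie_bracket X Y"] lie_bracket_def)
  have XX: "conn X (conn Y Z) p = deriv_along X (conn Y Z) p + S p (X p) (deriv_along Y Z p) + S p (X p) (S p (Y p) (Z p))"
    for X Y
    by (simp add: conn_def[of X] conn_def[of Y Z p] linear_add[OF linear_S2] add.assoc)
  show "curvature_op M g X Y Z p
      = dd (X p) (\<lambda>x. S x (Y p) (Z p)) p - dd (Y p) (\<lambda>x. S x (X p) (Z p)) p
        + S p (X p) (S p (Y p) (Z p)) - S p (Y p) (S p (X p) (Z p))"
    unfolding R XX deriv_along_conn[OF X Y Z p] deriv_along_conn[OF Y X Z p]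
      conn_def[of "lie_bracket X Y"] lie swap
    by (simp add: lie_bracket_def linear_diff[OF linear_S1])
  show "curvature_op M g X Y Z p \<bullet> p = 0"
    unfolding R using X Y Z p
    by (simp add: inner_diff_left vector_field_tangent conn_vector_field lie_bracket_vector_field)
qed

text \<open>The curvature is the Kulkarni-Nomizu product of \<open>P\<close> and the metric, so it
  has no Weyl part. Given the symmetry of the Hessian, this is algebra in \<open>H\<close> and the
  gradient \<open>b\<close>.\<close>

lemma riem_eq:
  assumes X: "X \<in> VF" and Y: "Y \<in> VF" and Z: "Z \<in> VF"
    and W: "W \<in> VF" and p: "p \<in> M"
  shows "riem M g X Y Z W p = exp (- 2 * L p) *
    (P p (Y p) (Z p) * (X p \<bullet> W p) + P p (X p) (W p) * (Y p \<bullet> Z p)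
     - P p (X p) (Z p) * (Y p \<bullet> W p) - P p (Y p) (W p) * (X p \<bullet> Z p))"
proof -
  note pc = M_cone[OF p]
  define H where "H v w = dd v (dd w L) p" for v w
  have H: "dd v B p \<bullet> w = H v w" for v w
    by (simp add: H_def dd_B_inner[OF pc])
  have Hs: "H v w = H w v" for v w
    by (simp add: H_def hess_L_sym[OF pc])
  have Pd: "P p v w = H v w + (B p \<bullet> v) * (B p \<bullet> w) - (B p \<bullet> B p) / 2 * (v \<bullet> w)" for v w
    by (simp add: P_def H_def B_inner[OF pc])
  define x y z w b where "x = X p" and "y = Y p" and "z = Z p" and "w = W p" and "b = B p"
  have Hyx: "H y x = H x y" by (rule Hs)
  have "curvature_op M g X Y Z p \<bullet> w
      = P p y z * (x \<bullet> w) + P p x w * (y \<bullet> z) - P p x z * (y \<bullet> w) - P p y w * (x \<bullet> z)"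
    unfolding curvature_op_eq(1)[OF X Y Z p] dd_S[OF pc] Pd
    unfolding x_def[symmetric] y_def[symmetric] z_def[symmetric] w_def[symmetric]
    unfolding H S_def b_def[symmetric]
    by (simp add: H Hyx inner_add_left inner_add_right inner_diff_left inner_diff_right
        inner_commute[of y x] inner_commute[of z x] inner_commute[of z y]
        inner_commute[of x b] inner_commute[of y b] inner_commute[of z b] inner_commute[of w b] field_simps)
  then show ?thesis
    using curvature_op_eq(2)[OF X Y Z p] vector_field_tangent[OF W p] p
    by (simp add: riem_def g_eq w_def x_def y_def z_def)
qed

text \<open>On tangent vectors, \<open>T\<close> is the covariant derivative of \<open>P\<close>.\<close>

definition T :: "'a \<Rightarrow> 'a \<Rightarrow> 'a \<Rightarrow> 'a \<Rightarrow> real" where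
  "T x u v w = dd u (\<lambda>y. P y v w) x - P x (S x u v) w - P x v (S x u w)"

lemma P_differentiable: "x \<in> Mcone \<Longrightarrow> (\<lambda>y. P y v w) differentiable (at x)"
  using smooth_P smooth_on_differentiable by blast

lemma linear_T1: "x \<in> Mcone \<Longrightarrow> linear (\<lambda>u. T x u v w)"
  unfolding T_def
  by (rule linearI)
     (simp_all add: linear_add[OF linear_dd[OF P_differentiable]] linear_cmul[OF linear_dd[OF P_differentiable]]
      linear_add[OF linear_S1] linear_cmul[OF linear_S1] linear_add[OF linear_P1] linear_cmul[OF linear_P1]
      linear_add[OF linear_P2] linear_cmul[OF linear_P2] algebra_simps)

lemma T_sym: "x \<in> Mcone \<Longrightarrow> T x u v w = T x u w v"
proof -
  assume x: "x \<in> Mcone"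
  have "dd u (\<lambda>y. P y v w) x = dd u (\<lambda>y. P y w v) x"
    by (rule dd_cong[OF open_cone x]) (rule P_sym)
  then show ?thesis
    by (simp add: T_def P_sym[OF x, of "S x u v"] P_sym[OF x, of v])
qed

lemma linear_T2: "x \<in> Mcone \<Longrightarrow> linear (\<lambda>v. T x u v w)"
proof -
  assume x: "x \<in> Mcone"
  have a: "dd u (\<lambda>y. P y (v + v') w) x = dd u (\<lambda>y. P y v w) x + dd u (\<lambda>y. P y v' w) x" for v v'
    unfolding dd_add[OF P_differentiable[OF x] P_differentiable[OF x], symmetric]
    by (rule dd_cong[OF open_cone x]) (rule linear_add[OF linear_P1])
  have c: "dd u (\<lambda>y. P y (c *\<^sub>R v) w) x = c * dd u (\<lambda>y. P y v w) x" for c v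
  proof -
    have "dd u (\<lambda>y. P y (c *\<^sub>R v) w) x = dd u (\<lambda>y. c *\<^sub>R P y v w) x"
      by (rule dd_cong[OF open_cone x]) (rule linear_cmul[OF linear_P1])
    also have "\<dots> = c * dd u (\<lambda>y. P y v w) x"
      using dd_bounded_linear_comp[OF bounded_linear_scaleR_right P_differentiable[OF x]] by simp
    finally show ?thesis .
  qed
  show ?thesis
    unfolding T_def
    by (rule linearI)
       (simp_all add: a c linear_add[OF linear_S2] linear_cmul[OF linear_S2] x linear_add[OF linear_P1]
        linear_cmul[OF linear_P1] algebra_simps)
qed

lemma linear_T3: "x \<in> Mcone \<Longrightarrow> linear (\<lambda>w. T x u v w)"
  using linear_T2[of x u v] by (simp add: T_sym)

lemma dd_P:
  assumes x: "x \<in> Mcone"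
  shows "dd u (\<lambda>y. P y v w) x = dd u (dd v (dd w L)) x + dd u (dd v L) x * dd w L x
    + dd v L x * dd u (dd w L) x - dd u (dd (B x) L) x * (v \<bullet> w)"
proof (rule dd_eqI)
  have h: "dd v (dd w L) differentiable (at x)"
    by (rule smooth_on_differentiable[OF smooth_on_dd[OF smooth_on_dd[OF smooth_L]] x])
  note hB = has_derivative_dd[OF B_differentiable[OF x]]
    and hL = has_derivative_dd[OF dd_L_differentiable[OF x]]
  have "((\<lambda>y. dd v (dd w L) y + dd v L y * dd w L y - B y \<bullet> B y * (v \<bullet> w / 2)) has_derivative
     (\<lambda>u. dd u (dd v (dd w L)) x + (dd v L x * dd u (dd w L) x + dd u (dd v L) x * dd w L x)
       - (B x \<bullet> dd u B x + dd u B x \<bullet> B x) * (v \<bullet> w / 2))) (at x)"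
    by (intro has_derivative_diff has_derivative_add has_derivative_dd[OF h]
        has_derivative_mult[OF hL hL] has_derivative_mult_left has_derivative_inner[OF hB hB])
  then show "((\<lambda>y. P y v w) has_derivative (\<lambda>u. dd u (dd v (dd w L)) x + dd u (dd v L) x * dd w L x
    + dd v L x * dd u (dd w L) x - dd u (dd (B x) L) x * (v \<bullet> w))) (at x)"
    unfolding inner_commute[of "B x" "dd _ B x"] dd_B_inner[OF x] by (simp add: P_def[abs_def] algebra_simps)
qed

text \<open>This is the vanishing of the Cotton tensor of a conformally flat metric.\<close>

lemma T_codazzi:
  assumes x: "x \<in> Mcone"
  shows "T x u v w = T x v u w"
proof -
  \<comment> \<open>The third derivatives of \<open>L\<close> cancel by symmetry. What is left is
    polynomial in the Hessian \<open>H\<close> and the gradient \<open>B x\<close>, and cancels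
    algebraically.\<close>
  have 3: "dd u (dd v (dd w L)) x = dd v (dd u (dd w L)) x"
    by (rule dd_swap[OF open_cone x smooth_on_dd[OF smooth_L]])
  define H where "H v w = dd v (dd w L) x" for v w
  have Hs: "H v w = H w v" for v w
    by (simp add: H_def hess_L_sym[OF x])
  have Pd: "P x v w = H v w + (B x \<bullet> v) * (B x \<bullet> w) - (B x \<bullet> B x) / 2 * (v \<bullet> w)" for v w
    by (simp add: P_def H_def B_inner[OF x])
  have PS: "P x v (S x u w) = (u \<bullet> w) * P x v (B x) - (B x \<bullet> u) * P x v w - (B x \<bullet> w) * P x v u" for u v w
    unfolding S_def
    by (simp add: linear_diff[OF linear_P2[OF x]] linear_cmul[OF linear_P2[OF x]])
  show ?thesis
    unfolding T_def dd_P[OF x] PS B_inner[OF x, symmetric] S_sym[of x v u]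
    unfolding Pd H_def[symmetric] 3
    by (simp add: Hs[of v u] Hs[of w] Hs[of "B x"] inner_commute[of v u] inner_commute[of u "B x"] inner_commute[of v "B x"] algebra_simps)
qed

lemma deriv_along_P:
  assumes V: "V \<in> VF" and Y: "Y \<in> VF" and Z: "Z \<in> VF"
    and p: "p \<in> M"
  shows "deriv_along V (\<lambda>q. P q (Y q) (Z q)) p
      = T p (V p) (Y p) (Z p) + P p (conn V Y p) (Z p) + P p (Y p) (conn V Z p)"
    and "smooth_fun M (\<lambda>q. P q (Y q) (Z q))"
proof -
  let ?Y = "\<lambda>x. Y (sgn x)" and ?Z = "\<lambda>x. Z (sgn x)"
  note pc = M_cone[OF p]
  have 2: "\<And>u. dd u (\<lambda>x. P x (?Y x) (?Z x)) p
        = dd u (\<lambda>x. P x (Y p) (Z p)) p + P p (dd u ?Y p) (Z p) + P p (Y p) (dd u ?Z p)"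
    "(\<lambda>x. P x (?Y x) (?Z x)) differentiable (at p)"
    using dd_bilinear_family[where Q = P and Y = ?Y and Z = ?Z,
      OF open_cone pc linear_P2 linear_P1 P_differentiable[OF pc]
        vector_field_differentiable[OF Y p] vector_field_differentiable[OF Z p]]
    by (simp_all add: sgn_M[OF p])
  have "deriv_along V (\<lambda>q. P q (Y q) (Z q)) p = dd (V p) (\<lambda>x. P x (?Y x) (?Z x)) p"
    by (rule deriv_along_ambient[where X = V and f = "\<lambda>q. P q (Y q) (Z q)", OF p vector_field_tangent[OF V p] 2(2)])
       (simp_all add: sgn_M)
  then show "deriv_along V (\<lambda>q. P q (Y q) (Z q)) p
      = T p (V p) (Y p) (Z p) + P p (conn V Y p) (Z p) + P p (Y p) (conn V Z p)"
    unfolding 2(1) conn_def T_def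
    by (simp add: linear_add[OF linear_P1[OF pc]] linear_add[OF linear_P2[OF pc]]
        deriv_along_eq[of V Y] deriv_along_eq[of V Z])
  have "smooth_on Mcone (\<lambda>x. \<Sum>b\<in>Basis. \<Sum>c\<in>Basis. (?Z x \<bullet> b) * ((?Y x \<bullet> c) * P x c b))"
    by (intro smooth_intros open_cone vector_field_smooth Y Z smooth_P)
  then show "smooth_fun M (\<lambda>q. P q (Y q) (Z q))"
  proof (rule smooth_fun_ambient)
    fix q assume q: "q \<in> M"
    note qc = M_cone[OF q]
    have "P q (Y q) (Z q) = P q (\<Sum>b\<in>Basis. (Y q \<bullet> b) *\<^sub>R b) (\<Sum>b\<in>Basis. (Z q \<bullet> b) *\<^sub>R b)"
      by (simp add: euclidean_representation)
    then show "P q (Y q) (Z q) = (\<Sum>b\<in>Basis. \<Sum>c\<in>Basis. (?Z q \<bullet> b) * ((?Y q \<bullet> c) * P q c b))"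
      by (simp add: linear_sum[OF linear_P1[OF qc]] linear_sum[OF linear_P2[OF qc]]
          linear_cmul[OF linear_P1[OF qc]] linear_cmul[OF linear_P2[OF qc]] sgn_M[OF q] sum_distrib_left)
  qed
qed


subsection \<open>Traces\<close>

text \<open>This is the very set chosen by \<open>metric_trace\<close>, so that all traces at
  \<open>p\<close> are sums over one basis.\<close>

definition frame :: "'a \<Rightarrow> 'a set" where "frame p = (SOME E. orthonormal_basis g p E)"

lemma metric_trace_frame: "metric_trace g p Q = (\<Sum>e\<in>frame p. Q e e)"
  by (simp add: metric_trace_def frame_def)

lemma frame: assumes p: "p \<in> M" shows "orthonormal_basis g p (frame p)"
proof -
  have "subspace (tangent_space p)"
    by (auto simp: subspace_def tangent_space_def inner_add_left)
  then obtain E where E: "E \<subseteq> tangent_space p" "pairwise orthogonal E" "\<And>x. x \<in> E \<Longrightarrow> norm x = 1"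
    "independent E" "span E = tangent_space p"
    by (rule orthonormal_basis_subspace) blast
  let ?F = "(\<lambda>e. exp (L p) *\<^sub>R e) ` E"
  have "orthonormal_basis g p ?F"
    unfolding orthonormal_basis_def
  proof (intro conjI ballI)
    show "?F \<subseteq> tangent_space p"
      using E(1) by (auto simp: tangent_space_def)
    have "E \<subseteq> span ?F"
    proof
      fix e assume "e \<in> E"
      then have "exp (- L p) *\<^sub>R (exp (L p) *\<^sub>R e) \<in> span ?F"
        by (intro span_scale span_base) auto
      then show "e \<in> span ?F"
        by (simp flip: exp_add)
    qed
    moreover have "?F \<subseteq> span E"
      by (auto intro: span_scale span_base)
    ultimately show "span ?F = tangent_space p"
      unfolding E(5)[symmetric] by (meson span_eq)
    fix v w assume "v \<in> ?F" "w \<in> ?F"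
    then obtain e f where ef: "e \<in> E" "f \<in> E" "v = exp (L p) *\<^sub>R e" "w = exp (L p) *\<^sub>R f"
      by auto
    have "g p v w = exp (- 2 * L p) * (exp (L p) * (exp (L p) * (e \<bullet> f)))"
      using E(1) ef p by (subst g_eq) (auto simp: tangent_space_def)
    also have "\<dots> = e \<bullet> f"
      by (simp flip: mult.assoc exp_add)
    also have "\<dots> = (if v = w then 1 else 0)"
      using E(2,3) ef by (auto simp: pairwise_def orthogonal_def dot_square_norm)
    finally show "g p v w = (if v = w then 1 else 0)" .
  qed
  then show ?thesis
    unfolding frame_def by (rule someI)
qed

lemma frame_tangent: "p \<in> M \<Longrightarrow> e \<in> frame p \<Longrightarrow> e \<bullet> p = 0"
  using frame[of p] unfolding orthonormal_basis_def tangent_space_def by blast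

lemma frame_inner:
  assumes "p \<in> M" "e \<in> frame p" "f \<in> frame p"
  shows "e \<bullet> f = (if e = f then exp (2 * L p) else 0)"
proof -
  have "exp (- 2 * L p) * (e \<bullet> f) = (if e = f then 1 else 0)"
    using frame[OF assms(1)] assms g_eq[OF assms(1)] frame_tangent[OF assms(1)]
    by (simp add: orthonormal_basis_def)
  then have "exp (2 * L p) * (exp (- 2 * L p) * (e \<bullet> f)) = exp (2 * L p) * (if e = f then 1 else 0)"
    by simp
  then show ?thesis
    by (simp flip: mult.assoc exp_add split: if_splits)
qed

lemma independent_frame: "p \<in> M \<Longrightarrow> independent (frame p)"
proof (rule pairwise_orthogonal_independent)
  assume p: "p \<in> M"
  show "pairwise orthogonal (frame p)"
    by (simp add: pairwise_def orthogonal_def frame_inner[OF p])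
  show "0 \<notin> frame p"
    using frame_inner[OF p, of 0 0] by auto
qed

lemma finite_frame: "p \<in> M \<Longrightarrow> finite (frame p)"
  using independent_frame by (rule independent_imp_finite)

lemma card_frame: assumes p: "p \<in> M" shows "card (frame p) = DIM('a) - 1"
proof -
  have "card (frame p) = dim (span (frame p))"
    by (simp add: dim_eq_card_independent independent_frame[OF p])
  also have "span (frame p) = {v. p \<bullet> v = 0}"
    using frame[OF p] by (simp add: orthonormal_basis_def tangent_space_def inner_commute)
  also have "dim \<dots> = DIM('a) - 1"
    by (rule dim_hyperplane) (use norm_M[OF p] in auto)
  finally show ?thesis .
qed

text \<open>Parseval's identity for a basis whose vectors are orthonormal for \<open>g\<close> and
  therefore have Euclidean length \<open>exp (L p)\<close>.\<close>

lemma frame_expand: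
  fixes f :: "'a \<Rightarrow> real"
  assumes p: "p \<in> M" and f: "linear f" and y: "y \<bullet> p = 0"
  shows "(\<Sum>e\<in>frame p. (y \<bullet> e) * f e) = exp (2 * L p) * f y"
proof -
  have "y \<in> span (frame p)"
    using frame[OF p] y by (simp add: orthonormal_basis_def tangent_space_def)
  then obtain r where r: "y = (\<Sum>e\<in>frame p. r e *\<^sub>R e)"
    using finite_frame[OF p] by (auto simp: span_finite)
  have "y \<bullet> e = exp (2 * L p) * r e" if e: "e \<in> frame p" for e
  proof -
    have "y \<bullet> e = (\<Sum>d\<in>frame p. if d = e then r d * exp (2 * L p) else 0)"
      unfolding r inner_sum_left by (intro sum.cong) (auto simp: frame_inner[OF p _ e])
    then show ?thesis
      using e finite_frame[OF p] by simp
  qed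
  then have "(\<Sum>e\<in>frame p. (y \<bullet> e) * f e) = (\<Sum>e\<in>frame p. exp (2 * L p) * (r e * f e))"
    by (intro sum.cong) auto
  also have "\<dots> = exp (2 * L p) * f y"
    by (subst r) (simp add: linear_sum[OF f] linear_cmul[OF f] sum_distrib_left)
  finally show ?thesis .
qed

lemma sum_Basis_linear:
  fixes f :: "'a \<Rightarrow> real"
  assumes "linear f"
  shows "(\<Sum>b\<in>Basis. (y \<bullet> b) * f b) = f y"
proof -
  have "f y = f (\<Sum>b\<in>Basis. (y \<bullet> b) *\<^sub>R b)"
    by (simp add: euclidean_representation)
  then show ?thesis
    by (simp add: linear_sum[OF assms] linear_cmul[OF assms])
qed

text \<open>The choice of \<open>frame p\<close> varies uncontrollably with \<open>p\<close>. The
  right-hand side no longer mentions it and can be differentiated.\<close>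

lemma frame_trace:
  fixes Q :: "'a \<Rightarrow> 'a \<Rightarrow> real"
  assumes p: "p \<in> M" and Q: "\<And>w. linear (\<lambda>v. Q v w)" "\<And>v. linear (\<lambda>w. Q v w)"
  shows "(\<Sum>e\<in>frame p. Q e e) = exp (2 * L p) * ((\<Sum>b\<in>Basis. Q b b) - Q p p)"
proof -
  \<comment> \<open>\<open>frame_expand\<close> is applied to the tangential parts of the ambient
    basis vectors.\<close>
  have "exp (2 * L p) * Q (b - (b \<bullet> p) *\<^sub>R p) b = (\<Sum>e\<in>frame p. (e \<bullet> b) * Q e b)" for b
  proof -
    have "(b - (b \<bullet> p) *\<^sub>R p) \<bullet> p = 0"
      using inner_M[OF p] by (simp add: inner_diff_left)
    from frame_expand[OF p Q(1) this, of b]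
    have "exp (2 * L p) * Q (b - (b \<bullet> p) *\<^sub>R p) b
        = (\<Sum>e\<in>frame p. ((b - (b \<bullet> p) *\<^sub>R p) \<bullet> e) * Q e b)" by (rule sym)
    also have "\<dots> = (\<Sum>e\<in>frame p. (e \<bullet> b) * Q e b)"
    proof (rule sum.cong[OF refl])
      fix e assume "e \<in> frame p"
      then have "p \<bullet> e = 0"
        using frame_tangent[OF p] by (simp add: inner_commute)
      then show "((b - (b \<bullet> p) *\<^sub>R p) \<bullet> e) * Q e b = (e \<bullet> b) * Q e b"
        by (simp add: inner_diff_left inner_commute[of b e])
    qed
    finally show ?thesis .
  qed
  then have "exp (2 * L p) * (\<Sum>b\<in>Basis. Q (b - (b \<bullet> p) *\<^sub>R p) b)
      = (\<Sum>b\<in>Basis. \<Sum>e\<in>frame p. (e \<bullet> b) * Q e b)"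
    by (simp add: sum_distrib_left)
  also have "\<dots> = (\<Sum>e\<in>frame p. Q e e)"
    by (subst sum.swap) (simp add: sum_Basis_linear[OF Q(2)])
  also have "(\<Sum>b\<in>Basis. Q (b - (b \<bullet> p) *\<^sub>R p) b) = (\<Sum>b\<in>Basis. Q b b) - Q p p"
    using sum_Basis_linear[OF Q(2)[of p], of p]
    by (simp add: linear_diff[OF Q(1)] linear_cmul[OF Q(1)] sum_subtractf inner_commute)
  finally show ?thesis by simp
qed

definition tau :: "'a \<Rightarrow> real" where "tau p = (\<Sum>e\<in>frame p. P p e e)"

lemma exp_cancel: "exp (- 2 * L p) * (exp (2 * L p) * a) = a"
  by (simp flip: mult.assoc exp_add)

text \<open>With \<open>n = DIM('a) - 1\<close> this is Ric = (n - 2) P + tau g, the contraction of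
  the Kulkarni-Nomizu product: the trace counts \<open>P\<close> n times, and the two mixed terms
  each take away one copy.\<close>

lemma ricci_eq:
  assumes Y: "Y \<in> VF" and Z: "Z \<in> VF" and p: "p \<in> M"
  shows "ricci M g Y Z p
    = (real DIM('a) - 3) * P p (Y p) (Z p) + tau p * (exp (- 2 * L p) * (Y p \<bullet> Z p))"
proof -
  note pc = M_cone[OF p]
  let ?E = "frame p" and ?y = "Y p" and ?z = "Z p"
  have "riem M g (extend e) Y Z (extend e) p = exp (- 2 * L p) *
     (P p ?y ?z * exp (2 * L p) + P p e e * (?y \<bullet> ?z) - (?y \<bullet> e) * P p e ?z - (?z \<bullet> e) * P p e ?y)"
    if "e \<in> ?E" for e
    using frame_tangent[OF p that] frame_inner[OF p that that]
    by (simp add: riem_eq extend_vector_field Y Z p extend_tangent P_sym[OF pc, of ?y] inner_commute[of e ?z])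
  then have "ricci M g Y Z p = (\<Sum>e\<in>?E. exp (- 2 * L p) *
     (P p ?y ?z * exp (2 * L p) + P p e e * (?y \<bullet> ?z) - (?y \<bullet> e) * P p e ?z - (?z \<bullet> e) * P p e ?y))"
    by (simp add: ricci_def metric_trace_frame)
  also have "\<dots> = exp (- 2 * L p) * (real (card ?E) * (P p ?y ?z * exp (2 * L p)) + tau p * (?y \<bullet> ?z)
      - exp (2 * L p) * P p ?y ?z - exp (2 * L p) * P p ?z ?y)"
    unfolding sum_distrib_left[symmetric] sum.distrib sum_subtractf
      frame_expand[OF p linear_P1[OF pc] vector_field_tangent[OF Y p]]
      frame_expand[OF p linear_P1[OF pc] vector_field_tangent[OF Z p]]
    by (simp add: tau_def sum_distrib_right)
  also have "\<dots> = exp (- 2 * L p) * (exp (2 * L p) * ((real DIM('a) - 3) * P p ?y ?z))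
      + tau p * (exp (- 2 * L p) * (?y \<bullet> ?z))"
    unfolding card_frame[OF p] P_sym[OF pc, of ?z ?y] of_nat_diff[OF DIM_positive[unfolded Suc_le_eq[symmetric] One_nat_def[symmetric]]]
    by (simp add: algebra_simps)
  finally show ?thesis
    unfolding exp_cancel .
qed

text \<open>Tracing \<open>ricci_eq\<close> gives (n - 2) tau + n tau. Constant scalar curvature is
  used below through the constancy of \<open>tau\<close>.\<close>

lemma scalar_curvature_eq:
  assumes p: "p \<in> M"
  shows "scalar_curvature M g p = 2 * (real DIM('a) - 2) * tau p"
proof -
  have "ricci M g (extend e) (extend e) p = (real DIM('a) - 3) * P p e e + tau p" if "e \<in> frame p" for e
    using frame_tangent[OF p that] frame_inner[OF p that that] exp_cancel[of p 1]
    by (simp add: ricci_eq extend_vector_field p extend_tangent)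
  then have "scalar_curvature M g p = (\<Sum>e\<in>frame p. (real DIM('a) - 3) * P p e e + tau p)"
    by (simp add: scalar_curvature_def metric_trace_frame)
  also have "\<dots> = (real DIM('a) - 3) * tau p + real (DIM('a) - 1) * tau p"
    by (simp add: sum.distrib sum_distrib_left[symmetric] tau_def card_frame[OF p])
  also have "real (DIM('a) - 1) = real DIM('a) - 1"
    using DIM_positive[where 'a = 'a] by (simp add: of_nat_diff Suc_le_eq)
  finally show ?thesis
    by (simp add: algebra_simps)
qed

lemma tau_eq:
  assumes p: "p \<in> M"
  shows "tau p = exp (2 * L p) * ((\<Sum>b\<in>Basis. P p b b) - P p p p)"
  unfolding tau_def using p by (intro frame_trace linear_P1 linear_P2 M_cone)

text \<open>The trace commutes with covariant differentiation, so this is the derivative of the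
  constant \<open>tau\<close> in direction \<open>w\<close>, up to a factor. Since the chosen frames
  cannot be differentiated, both sides are compared in the ambient form given by
  \<open>tau_eq\<close>.\<close>

lemma T_trace:
  assumes const: "\<And>q. q \<in> M \<Longrightarrow> tau q = c" and p: "p \<in> M" and w: "w \<bullet> p = 0"
  shows "(\<Sum>e\<in>frame p. T p w e e) = 0"
proof -
  note pc = M_cone[OF p]
  define tr where "tr x = (\<Sum>b\<in>Basis. P x b b) - P x x x" for x
  define dtr where "dtr = (\<Sum>b\<in>Basis. dd w (\<lambda>x. P x b b) p) - dd w (\<lambda>x. P x p p) p"
  have id: "dd u (\<lambda>x. x) p = u" for u
    by (rule dd_bounded_linear[OF bounded_linear_ident])
  \<comment> \<open>All three occurrences of \<open>x\<close> move, but moving either argument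
    contributes \<open>P p w p\<close>, which is 0 for tangent \<open>w\<close>.\<close>
  have 1: "dd w (\<lambda>x. P x x x) p = dd w (\<lambda>x. P x p p) p" "(\<lambda>x. P x x x) differentiable (at p)"
    using dd_bilinear_family[where Q = P and Y = "\<lambda>x. x" and Z = "\<lambda>x. x",
      OF open_cone pc linear_P2 linear_P1 P_differentiable[OF pc]]
    by (simp_all add: id P_radial[OF pc w] P_sym[OF pc, of p w])
  have 2: "(\<lambda>x. \<Sum>b\<in>Basis. P x b b) differentiable (at p)"
    by (intro differentiable_sum) (auto intro: P_differentiable[OF pc])
  have "dd w (\<lambda>x. \<Sum>b\<in>Basis. P x b b) p = (\<Sum>b\<in>Basis. dd w (\<lambda>x. P x b b) p)"
    by (rule dd_sum) (rule P_differentiable[OF pc])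
  then have tr: "dd w tr p = dtr" "tr differentiable (at p)"
    unfolding tr_def[abs_def] dd_diff[OF 2 1(2)] 1(1) dtr_def by (simp_all add: 1 2)
  have e: "((\<lambda>x. exp (2 * L x)) has_derivative (\<lambda>v. 2 * dd v L p * exp (2 * L p))) (at p)"
    by (auto intro!: derivative_eq_intros has_derivative_dd[OF L_differentiable[OF pc]])
  then have ed: "(\<lambda>x. exp (2 * L x)) differentiable (at p)"
    by (auto simp: differentiable_def)
  have "dd w (\<lambda>x. exp (2 * L x) * tr x) p = deriv_along (extend w) tau p"
    using deriv_along_ambient[where X = "extend w" and f = tau and h = "\<lambda>x. exp (2 * L x) * tr x",
        OF p _ differentiable_mult[OF ed tr(2)]] w
    by (simp add: extend_tangent tau_eq tr_def)
  also have "\<dots> = deriv_along (extend w) (\<lambda>q. c) p"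
    by (rule deriv_along_cong[OF p const])
  also have "\<dots> = 0"
    by (simp add: deriv_along_eq)
  finally have "exp (2 * L p) * (dtr + 2 * dd w L p * tr p) = 0"
    unfolding dd_mult[OF ed tr(2)] tr(1) dd_eqI[OF e] by (simp add: algebra_simps)
  then have vanish: "dtr + 2 * dd w L p * tr p = 0"
    by simp
  \<comment> \<open>Summed over a basis, the terms with \<open>P p (B p) v\<close> and
    \<open>P p w v\<close> cancel each other. What remains of the connection is
    \<open>2 * dd w L p\<close> times the trace, which is also what the derivative of the factor
    \<open>exp (2 * L x)\<close> produces.\<close>
  have PS: "P p (S p w v) v = (w \<bullet> v) * P p (B p) v - dd w L p * P p v v - (B p \<bullet> v) * P p w v" for v
    by (simp add: S_def linear_diff[OF linear_P1[OF pc]] linear_cmul[OF linear_P1[OF pc]] B_inner[OF pc])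
  have Tv: "T p w v v = dd w (\<lambda>x. P x v v) p + 2 * dd w L p * P p v v
      - 2 * ((w \<bullet> v) * P p (B p) v) + 2 * ((B p \<bullet> v) * P p w v)" for v
    unfolding T_def P_sym[OF pc, of v "S p w v"] PS by simp
  have "(\<Sum>b\<in>Basis. T p w b b) = (\<Sum>b\<in>Basis. dd w (\<lambda>x. P x b b) p)
      + 2 * dd w L p * (\<Sum>b\<in>Basis. P p b b) - 2 * P p (B p) w + 2 * P p w (B p)"
    unfolding Tv sum.distrib sum_subtractf sum_distrib_left[symmetric] sum_Basis_linear[OF linear_P2[OF pc]] ..
  moreover have "T p w p p = dd w (\<lambda>x. P x p p) p + 2 * dd w L p * P p p p"
    unfolding Tv using w by (simp add: P_radial[OF pc w])
  ultimately have "(\<Sum>b\<in>Basis. T p w b b) - T p w p p = dtr + 2 * dd w L p * tr p"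
    by (simp add: P_sym[OF pc, of w] dtr_def tr_def algebra_simps)
  with vanish have "(\<Sum>b\<in>Basis. T p w b b) - T p w p p = 0"
    by simp
  then show ?thesis
    unfolding frame_trace[OF p linear_T2[OF pc] linear_T3[OF pc]] by simp
qed

subsection \<open>Covariant derivatives of the curvature\<close>

lemma deriv_along_add:
  "smooth_fun M f \<Longrightarrow> smooth_fun M h \<Longrightarrow> p \<in> M \<Longrightarrow>
    deriv_along X (\<lambda>q. f q + h q) p = deriv_along X f p + deriv_along X h p"
  unfolding deriv_along_eq by (intro dd_add smooth_fun_differentiable)

lemma deriv_along_diff:
  "smooth_fun M f \<Longrightarrow> smooth_fun M h \<Longrightarrow> p \<in> M \<Longrightarrow>
    deriv_along X (\<lambda>q. f q - h q) p = deriv_along X f p - deriv_along X h p"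
  unfolding deriv_along_eq by (intro dd_diff smooth_fun_differentiable)

lemma deriv_along_mult:
  "smooth_fun M f \<Longrightarrow> smooth_fun M h \<Longrightarrow> p \<in> M \<Longrightarrow>
    deriv_along X (\<lambda>q. f q * h q :: real) p = f p * deriv_along X h p + deriv_along X f p * h p"
  unfolding deriv_along_eq
  by (subst dd_mult) (auto intro: smooth_fun_differentiable simp: sgn_M)

lemma smooth_fun_mult: "smooth_fun M f \<Longrightarrow> smooth_fun M h \<Longrightarrow> smooth_fun M (\<lambda>q. f q * h q :: real)"
  unfolding smooth_fun_iff by (rule smooth_on_mult[OF open_cone])

lemma smooth_fun_add: "smooth_fun M f \<Longrightarrow> smooth_fun M h \<Longrightarrow> smooth_fun M (\<lambda>q. f q + h q)"
  unfolding smooth_fun_iff by (rule smooth_on_add[OF open_cone])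

lemma smooth_fun_diff: "smooth_fun M f \<Longrightarrow> smooth_fun M h \<Longrightarrow> smooth_fun M (\<lambda>q. f q - h q)"
  unfolding smooth_fun_iff by (rule smooth_on_diff[OF open_cone])

lemma smooth_fun_const: "smooth_fun M (\<lambda>q. c)"
  unfolding smooth_fun_iff by (rule smooth_on_const)

lemma smooth_fun_P:
  assumes "Y \<in> VF" "Z \<in> VF"
  shows "smooth_fun M (\<lambda>q. P q (Y q) (Z q))"
\<comment> \<open>\<open>deriv_along_P\<close> presupposes a point of \<open>M\<close>, hence the
  separate case.\<close>
proof (cases "M = {}")
  case True
  then show ?thesis
    using smooth_fun_ambient[OF smooth_on_const] by blast
next
  case False
  then show ?thesis
    using deriv_along_P(2)[OF assms(1) assms] by blast
qed

lemma riem_eq_g: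
  assumes "X \<in> VF" "Y \<in> VF" "Z \<in> VF" "W \<in> VF" "p \<in> M"
  shows "riem M g X Y Z W p = P p (Y p) (Z p) * g p (X p) (W p) + P p (X p) (W p) * g p (Y p) (Z p)
    - P p (X p) (Z p) * g p (Y p) (W p) - P p (Y p) (W p) * g p (X p) (Z p)"
  using assms by (simp add: riem_eq g_vector_fields algebra_simps)

lemma deriv_along_P_g:
  assumes V: "V \<in> VF" and X: "X \<in> VF" and Y: "Y \<in> VF"
    and Z: "Z \<in> VF" and W: "W \<in> VF" and p: "p \<in> M"
  shows "deriv_along V (\<lambda>q. P q (X q) (Y q) * g q (Z q) (W q)) p
    = T p (V p) (X p) (Y p) * g p (Z p) (W p)
      + (P p (conn V X p) (Y p) + P p (X p) (conn V Y p)) * g p (Z p) (W p)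
      + P p (X p) (Y p) * (g p (conn V Z p) (W p) + g p (Z p) (conn V W p))"
  unfolding deriv_along_mult[OF smooth_fun_P[OF X Y] smooth_fun_g[OF Z W] p]
    deriv_along_P(1)[OF V X Y p] conn_metric[OF V Z W p]
  by (simp add: algebra_simps)

text \<open>The metric is parallel, so each summand of \<open>riem_eq_g\<close> contributes only the
  covariant derivative \<open>T\<close> of its factor \<open>P\<close>.\<close>

lemma cov_deriv_riem_eq:
  assumes V: "V \<in> VF" and X: "X \<in> VF" and Y: "Y \<in> VF"
    and Z: "Z \<in> VF" and W: "W \<in> VF" and p: "p \<in> M"
  shows "cov_deriv_riem M g V X Y Z W p
    = T p (V p) (Y p) (Z p) * g p (X p) (W p) + T p (V p) (X p) (W p) * g p (Y p) (Z p)
      - T p (V p) (X p) (Z p) * g p (Y p) (W p) - T p (V p) (Y p) (W p) * g p (X p) (Z p)"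
proof -
  have "deriv_along V (riem M g X Y Z W) p
      = deriv_along V (\<lambda>p. P p (Y p) (Z p) * g p (X p) (W p) + P p (X p) (W p) * g p (Y p) (Z p)
          - P p (X p) (Z p) * g p (Y p) (W p) - P p (Y p) (W p) * g p (X p) (Z p)) p"
    by (rule deriv_along_cong[OF p riem_eq_g[OF X Y Z W]])
  also have "\<dots> = deriv_along V (\<lambda>p. P p (Y p) (Z p) * g p (X p) (W p)) p
      + deriv_along V (\<lambda>p. P p (X p) (W p) * g p (Y p) (Z p)) p
      - deriv_along V (\<lambda>p. P p (X p) (Z p) * g p (Y p) (W p)) p
      - deriv_along V (\<lambda>p. P p (Y p) (W p) * g p (X p) (Z p)) p"
    by (simp add: deriv_along_diff deriv_along_add smooth_fun_diff smooth_fun_add smooth_fun_mult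
        smooth_fun_P smooth_fun_g X Y Z W p)
  finally have D: "deriv_along V (riem M g X Y Z W) p = \<dots>" .
  show ?thesis
    unfolding cov_deriv_riem_def Let_def D deriv_along_P_g[OF V Y Z X W p] deriv_along_P_g[OF V X W Y Z p]
      deriv_along_P_g[OF V X Z Y W p] deriv_along_P_g[OF V Y W X Z p]
    by (simp add: riem_eq_g levi_civita_vector_field levi_civita_eq V X Y Z W p algebra_simps)
qed

text \<open>The divergence is a combination of traces of \<open>T\<close> and of a difference of the
  form \<open>T p w y z - T p z y w\<close>. The difference vanishes by the Codazzi property, the
  traces since \<open>tau\<close> is constant.\<close>

lemma harmonic:
  assumes const: "\<And>q. q \<in> M \<Longrightarrow> tau q = c"
  shows "harmonic_curvature M g"
  unfolding harmonic_curvature_def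
proof (intro ballI)
  fix Y Z W p
  assume Y: "Y \<in> VF" and Z: "Z \<in> VF" and W: "W \<in> VF" and p: "p \<in> M"
  note pc = M_cone[OF p]
  let ?y = "Y p" and ?z = "Z p" and ?w = "W p"
  note t = frame_tangent[OF p] vector_field_tangent[OF Y p] vector_field_tangent[OF Z p] vector_field_tangent[OF W p]
  \<comment> \<open>The Codazzi property exchanges the differentiating slot with an argument, which
    turns the divergence of \<open>P\<close> into the derivative of its trace.\<close>
  have trace: "(\<Sum>e\<in>frame p. T p e e v) = 0" if "v \<bullet> p = 0" for v
    using T_trace[OF const p that]
    by (simp add: T_sym[OF pc, of _ _ v] T_codazzi[OF pc, of _ v])
  have "cov_deriv_riem M g (extend e) (extend e) Y Z W p = exp (- 2 * L p) *
      ((?w \<bullet> e) * T p e ?y ?z + T p e e ?w * (?y \<bullet> ?z) - T p e e ?z * (?y \<bullet> ?w) - (?z \<bullet> e) * T p e ?y ?w)"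
    if "e \<in> frame p" for e
    using that
    by (simp add: cov_deriv_riem_eq extend_vector_field Y Z W p extend_tangent t g_eq inner_commute[of e ?z] inner_commute[of e ?w]
        algebra_simps)
  then have "divergence_riem M g Y Z W p = - (\<Sum>e\<in>frame p. exp (- 2 * L p) *
      ((?w \<bullet> e) * T p e ?y ?z + T p e e ?w * (?y \<bullet> ?z) - T p e e ?z * (?y \<bullet> ?w) - (?z \<bullet> e) * T p e ?y ?w))"
    by (simp add: divergence_riem_def metric_trace_frame)
  also have "\<dots> = - (exp (- 2 * L p) * (exp (2 * L p) * T p ?w ?y ?z - exp (2 * L p) * T p ?z ?y ?w))"
    unfolding sum_distrib_left[symmetric] sum.distrib sum_subtractf sum_distrib_right[symmetric]
      frame_expand[OF p linear_T1[OF pc] t(3)] frame_expand[OF p linear_T1[OF pc] t(4)]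
      trace[OF t(3)] trace[OF t(4)] by simp
  also have "T p ?z ?y ?w = T p ?w ?y ?z"
    using T_sym[OF pc] T_codazzi[OF pc] by metis
  finally show "divergence_riem M g Y Z W p = 0"
    by simp
qed

text \<open>For constant \<open>tau\<close> the Ricci tensor is a constant multiple of
  \<open>P\<close> plus a constant multiple of the parallel tensor \<open>g\<close>.\<close>

lemma cov_deriv_ricci_eq:
  assumes const: "\<And>q. q \<in> M \<Longrightarrow> tau q = c"
    and V: "V \<in> VF" and Y: "Y \<in> VF" and Z: "Z \<in> VF" and p: "p \<in> M"
  shows "cov_deriv_ricci M g V Y Z p = (real DIM('a) - 3) * T p (V p) (Y p) (Z p)"
proof -
  let ?n = "real DIM('a) - 3"
  have ric: "ricci M g Y Z q = ?n * P q (Y q) (Z q) + c * g q (Y q) (Z q)"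
    if "Y \<in> VF" "Z \<in> VF" "q \<in> M" for Y Z q
    using that by (simp add: ricci_eq const g_vector_fields)
  have "deriv_along V (ricci M g Y Z) p
      = deriv_along V (\<lambda>q. ?n * P q (Y q) (Z q) + c * g q (Y q) (Z q)) p"
    by (rule deriv_along_cong[OF p ric[OF Y Z]])
  also have "\<dots> = ?n * deriv_along V (\<lambda>q. P q (Y q) (Z q)) p + c * deriv_along V (\<lambda>q. g q (Y q) (Z q)) p"
    by (simp add: deriv_along_add deriv_along_mult smooth_fun_mult smooth_fun_const smooth_fun_P smooth_fun_g
        Y Z p) (simp add: deriv_along_eq)
  finally show ?thesis
    unfolding cov_deriv_ricci_def Let_def
    by (simp add: ric levi_civita_vector_field levi_civita_eq V Y Z p deriv_along_P conn_metric algebra_simps)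
qed

text \<open>\<open>T\<close> is symmetric in all three arguments, so its diagonal determines it. The
  condition on the dimension makes the factor \<open>real DIM('a) - 3\<close> nonzero.\<close>

lemma parallel_imp_T:
  assumes const: "\<And>q. q \<in> M \<Longrightarrow> tau q = c" and n: "DIM('a) \<noteq> 3"
    and par: "parallel_ricci M g" and p: "p \<in> M" and v: "v \<bullet> p = 0"
  shows "T p v v v = 0"
proof -
  have "cov_deriv_ricci M g (extend v) (extend v) (extend v) p = 0"
    using par p extend_vector_field unfolding parallel_ricci_def by blast
  then show ?thesis
    using n v by (simp add: cov_deriv_ricci_eq[OF const] extend_vector_field p extend_tangent)
qed


subsection \<open>Parallel Ricci tensor\<close>

text \<open>Homogeneity drops by one degree with every derivative. The constant \<open>b\<close> is
  there for \<open>L\<close> itself, whose scaling law is additive.\<close>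

lemma dd_scale:
  fixes F :: "'a \<Rightarrow> real"
  assumes F: "\<And>y. y \<in> Mcone \<Longrightarrow> F differentiable (at y)" and c: "c > 0" and x: "x \<in> Mcone"
    and scale: "\<And>y. y \<in> Mcone \<Longrightarrow> F (c *\<^sub>R y) = a * F y + b"
  shows "dd v F (c *\<^sub>R x) = a / c * dd v F x"
proof -
  note cx = scaleR_cone[OF x c]
  have d: "(\<lambda>y. c *\<^sub>R y) differentiable (at x)"
    by (rule bounded_linear_imp_differentiable[OF bounded_linear_scaleR_right])
  have "dd v (\<lambda>y. F (c *\<^sub>R y)) x = dd (c *\<^sub>R v) F (c *\<^sub>R x)"
    using dd_compose[OF d F[OF cx], of v] by (simp add: dd_bounded_linear[OF bounded_linear_scaleR_right])
  also have "\<dots> = c * dd v F (c *\<^sub>R x)"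
    by (simp add: linear_cmul[OF linear_dd[OF F[OF cx]]])
  also have "dd v (\<lambda>y. F (c *\<^sub>R y)) x = dd v (\<lambda>y. a * F y + b) x"
    by (rule dd_cong[OF open_cone x scale])
  also have "\<dots> = a * dd v F x"
  proof (rule dd_eqI)
    show "((\<lambda>y. a * F y + b) has_derivative (\<lambda>v. a * dd v F x)) (at x)"
      by (intro has_derivative_add_const has_derivative_mult_right has_derivative_dd F x)
  qed
  finally show ?thesis
    using c by (simp add: field_simps)
qed

lemma smooth_differentiable:
  "x \<in> Mcone \<Longrightarrow> dd v L differentiable (at x)"
  "x \<in> Mcone \<Longrightarrow> dd u (dd v L) differentiable (at x)"
  using smooth_on_differentiable smooth_on_dd smooth_L by blast+

lemma dd_L_scale: assumes c: "c > 0" and x: "x \<in> Mcone" shows "dd v L (c *\<^sub>R x) = dd v L x / c"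
  using dd_scale[OF L_differentiable c x, of 1 "ln c" v] L_scaleR[OF c] by (simp add: Mcone_def)

lemma hess_L_scale:
  assumes c: "c > 0" and x: "x \<in> Mcone" shows "dd u (dd v L) (c *\<^sub>R x) = dd u (dd v L) x / c^2"
  using dd_scale[OF smooth_differentiable(1) c x, of v "1 / c" 0 u] dd_L_scale[OF c]
  by (simp add: power2_eq_square)

lemma third_L_scale:
  assumes c: "c > 0" and x: "x \<in> Mcone"
  shows "dd u (dd v (dd w L)) (c *\<^sub>R x) = dd u (dd v (dd w L)) x / c^3"
  using dd_scale[OF smooth_differentiable(2) c x, of v w "1 / c^2" 0 u] hess_L_scale[OF c]
  by (simp add: power2_eq_square power3_eq_cube)

lemma B_scale: assumes c: "c > 0" and x: "x \<in> Mcone" shows "B (c *\<^sub>R x) = B x /\<^sub>R c"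
  by (simp add: B_def dd_L_scale[OF c x] scaleR_sum_right divide_inverse mult.commute)

lemma third_L_radial:
  assumes x: "x \<in> Mcone"
  shows "dd w (dd x (dd v L)) x = - 2 * dd w (dd v L) x"
proof -
  have "dd w (\<lambda>y. dd y (dd v L) y) x = dd w (dd x (dd v L)) x + dd (dd w (\<lambda>y. y) x) (dd v L) x"
    by (rule dd_linear_family(1)[OF open_cone x linear_hess1])
       (use smooth_differentiable(2)[OF x] in auto)
  moreover have "dd w (\<lambda>y. y) x = w"
    by (rule dd_bounded_linear[OF bounded_linear_ident])
  moreover have "dd w (\<lambda>y. dd y (dd v L) y) x = dd w (\<lambda>y. - dd v L y) x"
    by (rule dd_cong[OF open_cone x]) (metis hess_L_sym hess_L_radial)
  moreover have "dd w (\<lambda>y. - dd v L y) x = - dd w (dd v L) x"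
    by (rule dd_bounded_linear_comp[OF bounded_linear_minus[OF bounded_linear_ident] smooth_differentiable(1)[OF x]])
  ultimately show ?thesis by simp
qed

lemma third_L_swap:
  assumes x: "x \<in> Mcone"
  shows "dd u (dd v (dd w L)) x = dd v (dd u (dd w L)) x"
    and "dd u (dd v (dd w L)) x = dd u (dd w (dd v L)) x"
proof -
  show "dd u (dd v (dd w L)) x = dd v (dd u (dd w L)) x"
    by (rule dd_swap[OF open_cone x smooth_on_dd[OF smooth_L]])
  show "dd u (dd v (dd w L)) x = dd u (dd w (dd v L)) x"
    by (rule dd_cong[OF open_cone x hess_L_sym])
qed

lemma linear_third: "x \<in> Mcone \<Longrightarrow> linear (\<lambda>u. dd u (dd v (dd w L)) x)"
  by (rule linear_dd[OF smooth_differentiable(2)])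

text \<open>
  The condition \<open>T(v,v,v) = 0\<close> for tangent vectors in terms of \<open>L\<close>.  It is stated for all ambient
  vectors, of which only the tangential component matters on the right-hand side.
\<close>

lemma cubic_identity:
  assumes T0: "\<And>p v. p \<in> M \<Longrightarrow> v \<bullet> p = 0 \<Longrightarrow> T p v v v = 0" and x: "x \<in> Mcone"
  shows "dd v (dd v (dd v L)) x + 6 * dd v L x * dd v (dd v L) x + 4 * dd v L x ^ 3
    = 3 * (v \<bullet> v - (v \<bullet> x)\<^sup>2 / (x \<bullet> x)) * (dd v L x * (B x \<bullet> B x) + dd v (dd (B x) L) x)"
proof -
  define K R where "K x v = dd v (dd v (dd v L)) x + 6 * dd v L x * dd v (dd v L) x + 4 * dd v L x ^ 3"
    and "R x v = dd v L x * (B x \<bullet> B x) + dd v (dd (B x) L) x" for x v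
  have tangent: "K p v = 3 * (v \<bullet> v) * R p v" if p: "p \<in> M" and v: "v \<bullet> p = 0" for p v
  proof -
    note pc = M_cone[OF p]
    have PS: "P p (S p v v) v = (v \<bullet> v) * P p v (B p) - 2 * dd v L p * P p v v"
      by (simp add: S_def linear_diff[OF linear_P1[OF pc]] linear_cmul[OF linear_P1[OF pc]] B_inner[OF pc]
          P_sym[OF pc, of "B p"])
    have Pvb: "P p v (B p) = dd v (dd (B p) L) p + dd v L p * (B p \<bullet> B p) / 2"
      using B_inner[OF pc, of "B p"] B_inner[OF pc, of v] by (simp add: P_def inner_commute[of v])
    have Pvv: "P p v v = dd v (dd v L) p + (dd v L p)\<^sup>2 - (B p \<bullet> B p) / 2 * (v \<bullet> v)"
      by (simp add: P_def power2_eq_square)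
    have "dd v (dd v (dd v L)) p + 2 * dd v L p * dd v (dd v L) p - (v \<bullet> v) * dd v (dd (B p) L) p
        - 2 * ((v \<bullet> v) * P p v (B p) - 2 * dd v L p * P p v v) = 0"
      using T0[OF p v] unfolding T_def P_sym[OF pc, of v "S p v v"] PS dd_P[OF pc]
      by (simp add: algebra_simps)
    then show ?thesis
      unfolding Pvb Pvv K_def R_def by (simp add: algebra_simps power2_eq_square power3_eq_cube)
  qed
  \<comment> \<open>A general \<open>v\<close> is split into its tangential part \<open>u\<close>
    and a radial part \<open>s *\<^sub>R p\<close>. The Euler relations up to third order make
    \<open>s\<close> drop out of both \<open>K\<close> and \<open>R\<close>.\<close>
  have sphere: "K p v = 3 * (v \<bullet> v - (v \<bullet> p)\<^sup>2) * R p v" if p: "p \<in> M" for p v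
  proof -
    note pc = M_cone[OF p]
    define s where "s = v \<bullet> p"
    define u where "u = v - s *\<^sub>R p"
    have v: "v = u + s *\<^sub>R p" and up: "u \<bullet> p = 0"
      using inner_M[OF p] by (simp_all add: u_def s_def inner_diff_left)
    have uu: "v \<bullet> v - (v \<bullet> p)\<^sup>2 = u \<bullet> u"
      using up inner_M[OF p] unfolding v
      by (simp add: inner_add_left inner_add_right inner_commute[of p u] power2_eq_square)
    have b: "dd v L p = dd u L p + s"
      by (simp add: v linear_add[OF linear_dL[OF pc]] linear_cmul[OF linear_dL[OF pc]] dd_L_radial[OF pc])
    have Hp: "dd p (dd w L) p = - dd w L p" for w
      by (simp add: hess_L_sym[OF pc, of p] hess_L_radial[OF pc])
    have H1: "dd v (dd w L) p = dd u (dd w L) p - s * dd w L p" for w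
      by (simp add: v linear_add[OF linear_hess1[OF pc]] linear_cmul[OF linear_hess1[OF pc]] Hp)
    have H: "dd v (dd v L) p = dd u (dd u L) p - 2 * s * dd u L p - s\<^sup>2"
      unfolding H1 b hess_L_sym[OF pc, of u v] by (simp add: H1 power2_eq_square algebra_simps)
    have D1: "dd v (dd w (dd w' L)) p = dd u (dd w (dd w' L)) p - 2 * s * dd w (dd w' L) p" for w w'
      unfolding v linear_add[OF linear_third[OF pc]] linear_cmul[OF linear_third[OF pc]]
      by (simp add: third_L_swap(1)[OF pc, of p] third_L_radial[OF pc])
    have "dd v (dd v (dd v L)) p = dd u (dd v (dd v L)) p - 2 * s * dd v (dd v L) p"
      by (rule D1)
    also have "dd u (dd v (dd v L)) p = dd v (dd u (dd v L)) p"
      by (rule third_L_swap(1)[OF pc])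
    also have "dd v (dd u (dd v L)) p = dd u (dd u (dd v L)) p - 2 * s * dd u (dd v L) p"
      by (rule D1)
    also have "dd u (dd u (dd v L)) p = dd v (dd u (dd u L)) p"
      using third_L_swap[OF pc] by metis
    also have "dd v (dd u (dd u L)) p = dd u (dd u (dd u L)) p - 2 * s * dd u (dd u L) p"
      by (rule D1)
    also have "dd u (dd v L) p = dd u (dd u L) p - s * dd u L p"
      unfolding hess_L_sym[OF pc, of u v] H1 ..
    finally have D: "dd v (dd v (dd v L)) p = dd u (dd u (dd u L)) p - 6 * s * dd u (dd u L) p
        + 6 * s\<^sup>2 * dd u L p + 2 * s ^ 3"
      unfolding H by (simp add: algebra_simps power2_eq_square power3_eq_cube)
    have "K p v = K p u"
      unfolding K_def D H b by (simp add: algebra_simps power2_eq_square power3_eq_cube)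
    moreover have "R p v = R p u"
      unfolding R_def H1 b by (simp add: B_inner[OF pc, symmetric] algebra_simps)
    ultimately show ?thesis
      using tangent[OF p up] by (simp add: uu)
  qed
  \<comment> \<open>Both sides are homogeneous of degree -3 in \<open>x\<close>, so the identity
    passes from the sphere to the cone.\<close>
  define c where "c = norm x"
  have c: "c > 0" using zero_notin_cone x by (auto simp: c_def)
  have xs: "x = c *\<^sub>R sgn x" using c by (simp add: c_def sgn_div_norm)
  note p = sgn_cone[OF x]
  note pc = M_cone[OF p]
  have "K x v = K (sgn x) v / c ^ 3"
    unfolding K_def using dd_L_scale[OF c pc] hess_L_scale[OF c pc] third_L_scale[OF c pc] xs
    by (simp add: add_divide_distrib power2_eq_square power3_eq_cube)
  moreover have "R x v = R (sgn x) v / c ^ 3"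
  proof -
    have "dd v (dd (B (sgn x) /\<^sub>R c) L) (sgn x) = dd v (dd (B (sgn x)) L) (sgn x) / c"
      using linear_cmul[OF linear_hess2[OF pc]] by (simp add: divide_inverse mult.commute)
    then show ?thesis
      unfolding R_def using dd_L_scale[OF c pc] hess_L_scale[OF c pc] B_scale[OF c pc] xs
      by (simp add: power2_eq_square power3_eq_cube divide_inverse algebra_simps)
  qed
  moreover have "(v \<bullet> x)\<^sup>2 / (x \<bullet> x) = (v \<bullet> sgn x)\<^sup>2"
    using c by (subst (1 2 3) xs) (simp add: power_mult_distrib inner_M[OF p] power2_eq_square)
  ultimately show ?thesis
    using sphere[OF p, of v] by (simp add: K_def R_def)
qed

end

section \<open>A differential equation in the plane\<close>

lemma third_dd_exp:
  fixes l :: "'b::real_normed_vector \<Rightarrow> real"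
  assumes V: "open V" and l: "smooth_on V l" and z: "z \<in> V"
  shows "dd d (dd d (dd d (\<lambda>z. exp (2 * l z)))) z = exp (2 * l z) *
    (2 * dd d (dd d (dd d l)) z + 12 * dd d l z * dd d (dd d l) z + 8 * dd d l z ^ 3)"
proof -
  have h: "(l has_derivative (\<lambda>u. dd u l z)) (at z)"
    "(dd d l has_derivative (\<lambda>u. dd u (dd d l) z)) (at z)"
    "(dd d (dd d l) has_derivative (\<lambda>u. dd u (dd d (dd d l)) z)) (at z)" if "z \<in> V" for z
    using that l by (intro has_derivative_dd smooth_on_differentiable[of V] smooth_on_dd; simp)+
  have E: "((\<lambda>z. exp (2 * l z)) has_derivative (\<lambda>u. exp (2 * l z) * (2 * dd u l z))) (at z)"
    if "z \<in> V" for z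
    by (auto intro!: derivative_eq_intros h that)
  have 1: "dd d (\<lambda>z. exp (2 * l z)) z = exp (2 * l z) * (2 * dd d l z)" if "z \<in> V" for z
    by (rule dd_eqI[OF E[OF that]])
  have 2: "dd d (dd d (\<lambda>z. exp (2 * l z))) z = exp (2 * l z) * (2 * dd d (dd d l) z + 4 * dd d l z * dd d l z)"
    if z: "z \<in> V" for z
  proof -
    have "dd d (dd d (\<lambda>z. exp (2 * l z))) z = dd d (\<lambda>z. exp (2 * l z) * (2 * dd d l z)) z"
      by (rule dd_cong[OF V z 1])
    also have "\<dots> = exp (2 * l z) * (2 * dd d (dd d l) z) + exp (2 * l z) * (2 * dd d l z) * (2 * dd d l z)"
      by (rule dd_eqI) (intro has_derivative_mult[OF E] has_derivative_mult_right h z)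
    finally show ?thesis by (simp add: algebra_simps)
  qed
  have "dd d (dd d (dd d (\<lambda>z. exp (2 * l z)))) z
      = dd d (\<lambda>z. exp (2 * l z) * (2 * dd d (dd d l) z + 4 * dd d l z * dd d l z)) z"
    by (rule dd_cong[OF V z 2])
  also have "\<dots> = exp (2 * l z) * (2 * dd d (dd d (dd d l)) z
        + (4 * dd d l z * dd d (dd d l) z + 4 * dd d (dd d l) z * dd d l z))
      + exp (2 * l z) * (2 * dd d l z) * (2 * dd d (dd d l) z + 4 * dd d l z * dd d l z)"
    by (rule dd_eqI)
       (intro has_derivative_mult[OF E] has_derivative_mult[OF has_derivative_mult_right]
         has_derivative_add has_derivative_mult_right h z)
  finally show ?thesis
    by (simp add: algebra_simps power3_eq_cube)
qed

lemma dd_expand3: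
  fixes F :: "'b::real_normed_vector \<Rightarrow> real"
  assumes V: "open V" and F: "smooth_on V F" and z: "z \<in> V"
  shows "dd (e + c *\<^sub>R f) (dd (e + c *\<^sub>R f) (dd (e + c *\<^sub>R f) F)) z
    = dd e (dd e (dd e F)) z + 3 * c * dd e (dd e (dd f F)) z + 3 * c^2 * dd e (dd f (dd f F)) z
      + c^3 * dd f (dd f (dd f F)) z"
proof -
  have lin: "dd (e + c *\<^sub>R f) h z = dd e h z + c * dd f h z" if "smooth_on V h" "z \<in> V" for h :: "'b \<Rightarrow> real" and z
    by (simp add: linear_add[OF linear_dd[OF smooth_on_differentiable[OF that]]]
        linear_cmul[OF linear_dd[OF smooth_on_differentiable[OF that]]])
  have add: "dd u (\<lambda>z. h z + c * k z) z = dd u h z + c * dd u k z"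
    if "smooth_on V h" "smooth_on V k" "z \<in> V" for h k :: "'b \<Rightarrow> real" and u z
    by (rule dd_eqI)
       (intro has_derivative_add has_derivative_mult_right has_derivative_dd smooth_on_differentiable[of V] that)
  have sw: "dd u (dd w h) z = dd w (dd u h) z" if "smooth_on V h" "z \<in> V" for h :: "'b \<Rightarrow> real" and u w z
    by (rule dd_swap[OF V that(2,1)])
  let ?d = "e + c *\<^sub>R f"
  note s = smooth_on_dd[OF F] and s2 = smooth_on_dd[OF smooth_on_dd[OF F]]
  have 2: "dd ?d (dd ?d F) z = dd e (dd e F) z + c * dd e (dd f F) z + c * (dd f (dd e F) z + c * dd f (dd f F) z)"
    if "z \<in> V" for z
  proof -
    have "dd ?d (dd ?d F) z = dd ?d (\<lambda>z. dd e F z + c * dd f F z) z"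
      by (rule dd_cong[OF V that lin[OF F]])
    also have "\<dots> = dd ?d (dd e F) z + c * dd ?d (dd f F) z"
      by (rule add[OF s s that])
    finally show ?thesis by (simp add: lin[OF s that] algebra_simps)
  qed
  have "dd ?d (dd ?d (dd ?d F)) z = dd ?d (\<lambda>z. (dd e (dd e F) z + c * dd e (dd f F) z)
      + c * (dd f (dd e F) z + c * dd f (dd f F) z)) z"
    by (rule dd_cong[OF V z 2])
  also have "\<dots> = dd ?d (dd e (dd e F)) z + c * dd ?d (dd e (dd f F)) z
      + c * (dd ?d (dd f (dd e F)) z + c * dd ?d (dd f (dd f F)) z)"
    by (subst add) (intro smooth_on_add smooth_on_mult smooth_on_const s2 V z | simp add: add[OF s2 s2 z])+
  also have "\<dots> = dd e (dd e (dd e F)) z + c * (dd e (dd e (dd f F)) z + dd e (dd f (dd e F)) z + dd f (dd e (dd e F)) z)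
      + c^2 * (dd e (dd f (dd f F)) z + dd f (dd e (dd f F)) z + dd f (dd f (dd e F)) z) + c^3 * dd f (dd f (dd f F)) z"
    by (simp add: lin[OF s2 z] algebra_simps power2_eq_square power3_eq_cube)
  finally have expand: "dd ?d (dd ?d (dd ?d F)) z = \<dots>" .
  have s1: "dd e (dd f (dd e F)) z = dd e (dd e (dd f F)) z" "dd f (dd f (dd e F)) z = dd f (dd e (dd f F)) z"
    by (rule dd_cong[OF V z], rule sw[OF F], assumption)+
  have s2: "dd f (dd e (dd w F)) z = dd e (dd f (dd w F)) z" for w
    by (rule sw[OF s z])
  show ?thesis
    unfolding expand s1 s2 by (simp add: algebra_simps)
qed

text \<open>With \<open>d = e + c *\<^sub>R f\<close>, comparing \<open>c = 1\<close> and
  \<open>c = - 1\<close> isolates the mixed third derivatives: F_eff = G_e and F_eef = G_f. Equality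
  of mixed fourth derivatives then yields G_ef = 3 G_ef and G_ee = G_ff. Hence G_eee = G_eff = 0,
  and the fifth derivative of \<open>F\<close> is 3 G_eee.\<close>

lemma fifth_dd_eq_0:
  fixes F G :: "'b::real_inner \<Rightarrow> real"
  assumes V: "open V" and F: "smooth_on V F" and G: "smooth_on V G" and z: "z \<in> V"
    and eq: "\<And>z d. z \<in> V \<Longrightarrow> dd d (dd d (dd d F)) z = 3 * (d \<bullet> d) * dd d G z"
    and ef: "e \<bullet> e = 1" "f \<bullet> f = 1" "e \<bullet> f = 0"
  shows "dd e (dd e (dd e (dd e (dd e F)))) z = 0"
proof -
  have sw: "dd u (dd w h) z = dd w (dd u h) z" if "smooth_on V h" "z \<in> V" for h :: "'b \<Rightarrow> real" and u w z
    by (rule dd_swap[OF V that(2,1)])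
  have mul: "dd u (\<lambda>z. c * h z) z = c * dd u h z" if "smooth_on V h" "z \<in> V" for h :: "'b \<Rightarrow> real" and u c z
    by (rule dd_eqI) (intro has_derivative_mult_right has_derivative_dd smooth_on_differentiable[of V] that)
  note s = smooth_on_dd
  have lin: "dd (e + c *\<^sub>R f) G z = dd e G z + c * dd f G z" if "z \<in> V" for c z
    by (simp add: linear_add[OF linear_dd[OF smooth_on_differentiable[OF G that]]]
        linear_cmul[OF linear_dd[OF smooth_on_differentiable[OF G that]]])
  have pol: "dd e (dd e (dd e F)) z + 3 * c * dd e (dd e (dd f F)) z + 3 * c^2 * dd e (dd f (dd f F)) z
      + c^3 * dd f (dd f (dd f F)) z = 3 * (1 + c^2) * (dd e G z + c * dd f G z)" if "z \<in> V" for c z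
    using eq[OF that, of "e + c *\<^sub>R f"] ef
    by (simp add: dd_expand3[OF V F that] lin[OF that] inner_add_left inner_add_right power2_eq_square
        inner_commute[of f e])
  have eee: "dd e (dd e (dd e F)) z = 3 * dd e G z" if "z \<in> V" for z
    using eq[OF that, of e] ef by simp
  have fff: "dd f (dd f (dd f F)) z = 3 * dd f G z" if "z \<in> V" for z
    using eq[OF that, of f] ef by simp
  have eff: "dd e (dd f (dd f F)) z = dd e G z" and eef: "dd e (dd e (dd f F)) z = dd f G z" if "z \<in> V" for z
    using pol[OF that, of 1] pol[OF that, of "- 1"] eee[OF that] fff[OF that] by (simp_all add: algebra_simps)
  text \<open>Compute two fourth derivatives of \<open>F\<close> in two ways each.\<close>
  have Gef: "dd e (dd f G) z = 0" if zV: "z \<in> V" for z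
  proof -
    have "dd e (dd f G) z = dd e (dd e (dd e (dd f F))) z"
      by (rule dd_cong[OF V zV eef[symmetric]])
    also have "\<dots> = dd e (dd e (dd f (dd e F))) z"
      by (intro dd_cong[OF V] zV sw F)
    also have "\<dots> = dd e (dd f (dd e (dd e F))) z"
      by (intro dd_cong[OF V] zV sw F s)
    also have "\<dots> = dd f (dd e (dd e (dd e F))) z"
      by (intro zV sw F s)
    also have "\<dots> = dd f (\<lambda>z. 3 * dd e G z) z"
      by (rule dd_cong[OF V zV eee])
    also have "\<dots> = 3 * dd e (dd f G) z"
      by (simp add: mul[OF s[OF G] zV] sw[OF G zV, of f e])
    finally show ?thesis by simp
  qed
  have Gee: "dd e (dd e G) z = dd f (dd f G) z" if zV: "z \<in> V" for z
  proof -
    have "dd e (dd e G) z = dd e (dd e (dd f (dd f F))) z"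
      by (rule dd_cong[OF V zV eff[symmetric]])
    also have "\<dots> = dd e (dd f (dd e (dd f F))) z"
      by (intro dd_cong[OF V] zV sw F s)
    also have "\<dots> = dd f (dd e (dd e (dd f F))) z"
      by (intro zV sw F s)
    also have "\<dots> = dd f (dd f G) z"
      by (rule dd_cong[OF V zV eef])
    finally show ?thesis .
  qed
  have "dd e (dd e (dd e G)) z = dd e (dd f (dd f G)) z"
    by (rule dd_cong[OF V z Gee])
  also have "\<dots> = dd f (dd e (dd f G)) z"
    by (intro z sw G s)
  also have "\<dots> = dd f (\<lambda>z. 0) z"
    by (rule dd_cong[OF V z Gef])
  finally have Geee: "dd e (dd e (dd e G)) z = 0" by simp
  have 4: "dd e (dd e (dd e (dd e F))) z = 3 * dd e (dd e G) z" if "z \<in> V" for z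
    by (rule trans[OF dd_cong[OF V that eee] mul[OF s[OF G] that]])
  have "dd e (dd e (dd e (dd e (dd e F)))) z = dd e (\<lambda>z. 3 * dd e (dd e G) z) z"
    by (rule dd_cong[OF V z 4])
  also have "\<dots> = 3 * dd e (dd e (dd e G)) z"
    by (rule mul[OF s[OF s[OF G]] z])
  finally show ?thesis
    by (simp add: Geee)
qed

section \<open>Stereographic coordinates\<close>

text \<open>
  Inverse stereographic projection with pole \<open>N\<close>, up to a positive factor, restricted to the
  affine plane through \<open>y\<^sub>1\<close> spanned by \<open>e\<close> and \<open>f\<close>.
\<close>

locale stereographic =
  fixes N y1 e f :: "'a::euclidean_space"
  assumes N: "N \<bullet> N = 1" "y1 \<bullet> N = 0" "e \<bullet> N = 0" "f \<bullet> N = 0"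
    and ef: "e \<bullet> e = 1" "f \<bullet> f = 1" "e \<bullet> f = 0"
begin

definition plane :: "real \<times> real \<Rightarrow> 'a" where "plane z = y1 + (fst z *\<^sub>R e + snd z *\<^sub>R f)"
definition Psi :: "real \<times> real \<Rightarrow> 'a" where
  "Psi z = plane z + ((plane z \<bullet> plane z - 1) / 2) *\<^sub>R N"
definition dirn :: "real \<times> real \<Rightarrow> 'a" where "dirn d = fst d *\<^sub>R e + snd d *\<^sub>R f"
text \<open>The derivative of \<open>Psi\<close> at \<open>z\<close> in direction \<open>d\<close>;
  \<open>dd d (vel d)\<close> is then the acceleration of \<open>Psi\<close> along a line.\<close>

definition vel :: "real \<times> real \<Rightarrow> real \<times> real \<Rightarrow> 'a" where
  "vel d z = dirn d + (plane z \<bullet> dirn d) *\<^sub>R N"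

lemma plane_has_derivative: "(plane has_derivative dirn) (at z)"
  unfolding plane_def[abs_def] dirn_def[abs_def]
  by (auto intro!: derivative_eq_intros)

lemma Psi_has_derivative: "(Psi has_derivative (\<lambda>d. vel d z)) (at z)"
proof -
  have "((\<lambda>z. plane z + (plane z \<bullet> plane z) *\<^sub>R ((1 / 2) *\<^sub>R N) - (1 / 2) *\<^sub>R N) has_derivative
      (\<lambda>d. dirn d + (plane z \<bullet> dirn d + dirn d \<bullet> plane z) *\<^sub>R ((1 / 2) *\<^sub>R N) - 0)) (at z)"
    by (rule has_derivative_diff[OF has_derivative_add[OF plane_has_derivative has_derivative_scaleR_left
          [OF has_derivative_inner[OF plane_has_derivative plane_has_derivative]]] has_derivative_const])
  moreover have "(\<lambda>z. plane z + (plane z \<bullet> plane z) *\<^sub>R ((1 / 2) *\<^sub>R N) - (1 / 2) *\<^sub>R N) = Psi"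
    by (rule ext) (simp add: Psi_def diff_divide_distrib scaleR_diff_left)
  moreover have "(\<lambda>d. dirn d + (plane z \<bullet> dirn d + dirn d \<bullet> plane z) *\<^sub>R ((1 / 2) *\<^sub>R N) - 0) = (\<lambda>d. vel d z)"
    by (rule ext) (simp add: vel_def inner_commute[of "dirn _" "plane z"])
  ultimately show ?thesis by metis
qed

lemma dirn_inner: "dirn d \<bullet> dirn d = d \<bullet> d"
  using ef by (simp add: dirn_def inner_add_left inner_add_right inner_commute[of f e] inner_prod_def)

lemma dd_vel: "dd d (vel d) z = (d \<bullet> d) *\<^sub>R N" and vel_differentiable: "vel d differentiable (at z)"
proof -
  have "(vel d has_derivative (\<lambda>c. 0 + (dirn c \<bullet> dirn d) *\<^sub>R N)) (at z)"
    unfolding vel_def[abs_def]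
    by (rule has_derivative_add[OF has_derivative_const has_derivative_scaleR_left
          [OF has_derivative_inner_left[OF plane_has_derivative]]])
  from dd_eqI[OF this] this show "dd d (vel d) z = (d \<bullet> d) *\<^sub>R N" "vel d differentiable (at z)"
    by (auto simp: dirn_inner differentiable_def)
qed

lemma smooth_Psi: "smooth_on S Psi"
proof -
  have "smooth_on UNIV fst" "smooth_on UNIV snd"
    by (intro smooth_on_bounded_linear bounded_linear_fst bounded_linear_snd)+
  then have "smooth_on UNIV Psi"
    unfolding Psi_def[abs_def] plane_def divide_inverse
    by (intro smooth_intros open_UNIV)
  then show ?thesis
    by (rule smooth_on_subset) simp
qed

lemma plane_N: "plane z \<bullet> N = 0"
  using N by (simp add: plane_def inner_add_left)

lemma dirn_N: "dirn d \<bullet> N = 0"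
  using N by (simp add: dirn_def inner_add_left)

lemma Psi_N: "Psi z \<bullet> N = (plane z \<bullet> plane z - 1) / 2"
  using N by (simp add: Psi_def inner_add_left plane_N)

lemma Psi_inner: "Psi z \<bullet> Psi z = ((plane z \<bullet> plane z + 1) / 2)\<^sup>2"
  using N by (simp add: Psi_def inner_add_left inner_add_right plane_N inner_commute[of N "plane z"] power2_eq_square field_simps)

lemma norm_Psi: "norm (Psi z) = (plane z \<bullet> plane z + 1) / 2"
  by (simp add: norm_eq_sqrt_inner Psi_inner real_sqrt_unique)

text \<open>Stereographic projection is conformal, and the scale of \<open>Psi\<close> is such that
  the component of the velocity orthogonal to the ray has the length of \<open>d\<close>. Its square
  is the factor that occurs in \<open>cubic_identity\<close>.\<close>

lemma vel_inner: "vel d z \<bullet> vel d z - (vel d z \<bullet> Psi z)\<^sup>2 / (Psi z \<bullet> Psi z) = d \<bullet> d"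
proof -
  define k where "k = (plane z \<bullet> plane z + 1) / 2"
  have k: "k \<noteq> 0" "Psi z \<bullet> Psi z = k\<^sup>2"
    unfolding k_def Psi_inner by (smt (verit) inner_ge_zero half_gt_zero) (rule refl)
  have "vel d z \<bullet> Psi z = (plane z \<bullet> dirn d) * k"
    using N plane_N[of z] dirn_N[of d]
    by (simp add: k_def vel_def Psi_def inner_add_left inner_add_right inner_commute[of N "plane z"]
        inner_commute[of N "dirn d"] inner_commute[of "dirn d" "plane z"] field_simps)
  moreover have "vel d z \<bullet> vel d z = d \<bullet> d + (plane z \<bullet> dirn d)\<^sup>2"
    using N dirn_N[of d]
    by (simp add: vel_def inner_add_left inner_add_right inner_commute[of N "dirn d"] dirn_inner power2_eq_square)
  ultimately show ?thesis
    using k by (simp add: power_mult_distrib)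
qed

lemma Psi_inj: "sgn (Psi z) = sgn (Psi z') \<Longrightarrow> z = z'"
proof -
  assume eq: "sgn (Psi z) = sgn (Psi z')"
  \<comment> \<open>The image of \<open>Psi\<close> lies on the paraboloid given by this equation,
    which meets every ray at most once.\<close>
  have 1: "norm (Psi z) - Psi z \<bullet> N = 1" for z
    by (simp add: norm_Psi Psi_N field_simps)
  have pos: "norm (Psi z) > 0" for z
    unfolding norm_Psi by (smt (verit) inner_ge_zero half_gt_zero)
  have Psi: "Psi z = norm (Psi z) *\<^sub>R sgn (Psi z)" for z
    using pos[of z] by (simp add: sgn_div_norm)
  have "norm (Psi z) * (1 - sgn (Psi z) \<bullet> N) = 1" for z
    using 1[of z] Psi[of z] by (metis inner_scaleR_left mult.right_neutral right_diff_distrib)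
  from this[of z] this[of z'] have "norm (Psi z) = norm (Psi z')"
    unfolding eq by (metis mult_cancel_right mult_zero_right zero_neq_one)
  then have "Psi z = Psi z'"
    using Psi eq by metis
  then have "plane z = plane z'"
    using Psi_N[of z] Psi_N[of z'] by (simp add: Psi_def)
  then have "dirn z = dirn z'"
    by (simp add: plane_def dirn_def)
  moreover have "dirn z \<bullet> e = fst z" "dirn z \<bullet> f = snd z" for z
    using ef by (simp_all add: dirn_def inner_add_left inner_commute[of f e])
  ultimately show "z = z'"
    by (metis prod.collapse)
qed

end

lemma eventually_notin_finite:
  fixes x :: "'a::t1_space"
  assumes "finite A"
  shows "\<forall>\<^sub>F t in at x. t \<notin> A"
proof -
  have "open (- (A - {x}))"
    using assms by (intro open_Compl finite_imp_closed) simp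
  then have "\<forall>\<^sub>F t in nhds x. t \<in> - (A - {x})"
    by (intro eventually_nhds_in_open) auto
  then show ?thesis
    by (auto simp: eventually_at_filter elim: eventually_mono)
qed

section \<open>The conformal factor in a stereographic plane\<close>

locale conformal_stereographic = conformal_metric M L g + stereographic N y1 e f
  for M :: "'a::euclidean_space set" and L :: "'a \<Rightarrow> real" and g :: "'a metric_tensor" and N y1 e f :: 'a +
  assumes T0: "\<And>p v. p \<in> M \<Longrightarrow> v \<bullet> p = 0 \<Longrightarrow> T p v v v = 0"
begin

definition V :: "(real \<times> real) set" where "V = {z. Psi z \<in> Mcone}"

lemma open_V: "open V"
  unfolding V_def using open_vimage[OF open_cone, of Psi] smooth_on_continuous[OF smooth_Psi]
  by (simp add: vimage_def)

definition l :: "real \<times> real \<Rightarrow> real" where "l z = L (Psi z)"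

lemma smooth_Psi_comp:
  fixes h :: "'a \<Rightarrow> 'b::real_normed_vector"
  shows "smooth_on Mcone h \<Longrightarrow> smooth_on V (\<lambda>z. h (Psi z))"
  by (rule smooth_on_compose[OF open_V smooth_Psi]) (auto simp: V_def)

lemma smooth_l: "smooth_on V l"
  unfolding l_def[abs_def] by (rule smooth_Psi_comp[OF smooth_L])

lemma dd_Psi:
  fixes h :: "'a \<Rightarrow> 'b::real_normed_vector"
  assumes "h differentiable (at (Psi z))"
  shows "dd d (\<lambda>z. h (Psi z)) z = dd (vel d z) h (Psi z)"
    and "(\<lambda>z. h (Psi z)) differentiable (at z)"
proof -
  have "Psi differentiable (at z)" "dd d Psi z = vel d z"
    using Psi_has_derivative[of z] by (blast intro: differentiableI, rule dd_eqI)
  then show "dd d (\<lambda>z. h (Psi z)) z = dd (vel d z) h (Psi z)" "(\<lambda>z. h (Psi z)) differentiable (at z)"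
    using dd_compose[of Psi z h d] differentiable_compose'[of Psi z h] assms by simp_all
qed

lemma dd_l: assumes z: "z \<in> V" shows "dd d l z = dd (vel d z) L (Psi z)"
  unfolding l_def[abs_def] by (rule dd_Psi(1)[OF L_differentiable]) (use z in \<open>simp add: V_def\<close>)

text \<open>Along a line \<open>Psi\<close> has the constant acceleration
  \<open>(d \<bullet> d) *\<^sub>R N\<close>, which gives the additional term.\<close>

lemma dd2_l:
  assumes z: "z \<in> V"
  shows "dd d (dd d l) z = dd (vel d z) (dd (vel d z) L) (Psi z) + (d \<bullet> d) * dd N L (Psi z)"
proof -
  have c: "Psi z \<in> Mcone" if "z \<in> V" for z
    using that by (simp add: V_def)
  have "dd d (\<lambda>z. dd (vel d z) L (Psi z)) z
      = dd d (\<lambda>w. dd (vel d z) L (Psi w)) z + dd (dd d (vel d) z) L (Psi z)"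
    by (rule dd_linear_family(1)[where Q = "\<lambda>z c. dd c L (Psi z)" and Y = "vel d", OF open_V z _ _ vel_differentiable])
       (auto intro: linear_dL c dd_Psi(2) dd_L_differentiable z)
  also have "dd d (\<lambda>w. dd (vel d z) L (Psi w)) z = dd (vel d z) (dd (vel d z) L) (Psi z)"
    by (rule dd_Psi(1)[OF dd_L_differentiable[OF c[OF z]]])
  also have "dd (dd d (vel d) z) L (Psi z) = (d \<bullet> d) * dd N L (Psi z)"
    by (simp add: dd_vel linear_cmul[OF linear_dL[OF c[OF z]]])
  also have "dd d (\<lambda>z. dd (vel d z) L (Psi z)) z = dd d (dd d l) z"
    by (rule dd_cong[OF open_V z dd_l[symmetric]])
  finally show ?thesis .
qed

text \<open>The acceleration enters three times, once for each pair of derivatives; no further term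
  arises because the third derivative of \<open>Psi\<close> is 0.\<close>

lemma dd3_l:
  assumes z: "z \<in> V"
  shows "dd d (dd d (dd d l)) z = dd (vel d z) (dd (vel d z) (dd (vel d z) L)) (Psi z)
    + 3 * (d \<bullet> d) * dd (vel d z) (dd N L) (Psi z)"
proof -
  have c: "Psi z \<in> Mcone" if "z \<in> V" for z
    using that by (simp add: V_def)
  note cz = c[OF z]
  let ?v = "vel d z"
  have q: "dd d (\<lambda>z. dd (vel d z) (dd (vel d z) L) (Psi z)) z
      = dd d (\<lambda>w. dd ?v (dd ?v L) (Psi w)) z + dd (dd d (vel d) z) (dd ?v L) (Psi z)
        + dd ?v (dd (dd d (vel d) z) L) (Psi z)"
    "(\<lambda>z. dd (vel d z) (dd (vel d z) L) (Psi z)) differentiable (at z)"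
    by (rule dd_bilinear_family[where Q = "\<lambda>z c c'. dd c (dd c' L) (Psi z)" and Y = "vel d" and Z = "vel d",
          OF open_V z _ _ _ vel_differentiable vel_differentiable];
        auto intro: linear_hess1 linear_hess2 c dd_Psi(2) smooth_differentiable z)+
  have n: "(\<lambda>z. dd N L (Psi z)) differentiable (at z)"
    by (rule dd_Psi(2)[OF smooth_differentiable(1)[OF cz]])
  have "dd d (dd d (dd d l)) z
      = dd d (\<lambda>z. dd (vel d z) (dd (vel d z) L) (Psi z) + (d \<bullet> d) * dd N L (Psi z)) z"
    by (rule dd_cong[OF open_V z dd2_l])
  also have "\<dots> = dd d (\<lambda>z. dd (vel d z) (dd (vel d z) L) (Psi z)) z + (d \<bullet> d) * dd d (\<lambda>z. dd N L (Psi z)) z"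
    by (rule dd_eqI) (intro has_derivative_add has_derivative_mult_right has_derivative_dd q n)
  finally show ?thesis
    unfolding q(1) dd_vel dd_Psi(1)[OF smooth_differentiable(1)[OF cz]] dd_Psi(1)[OF smooth_differentiable(2)[OF cz]]
    by (simp add: linear_cmul[OF linear_hess1[OF cz]] linear_cmul[OF linear_hess2[OF cz]]
        hess_L_sym[OF cz, of N])
qed

text \<open>
  In stereographic coordinates \<open>y\<close>, \<open>g = w\<^sup>-\<^sup>2 |dy|\<^sup>2\<close> with \<open>F = w\<^sup>2\<close> and \<open>Grad = |\<nabla>w|\<^sup>2\<close>.
\<close>

definition F :: "real \<times> real \<Rightarrow> real" where "F z = exp (2 * l z)"

definition Grad :: "real \<times> real \<Rightarrow> real" where
  "Grad z = exp (2 * L (Psi z)) * (B (Psi z) \<bullet> B (Psi z) + 2 * dd N L (Psi z))"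

lemma smooth_F: "smooth_on V F"
  unfolding F_def[abs_def] by (intro smooth_intros open_V smooth_l)

lemma smooth_Grad: "smooth_on V Grad"
proof -
  have "smooth_on Mcone (\<lambda>x. exp (2 * L x) * (B x \<bullet> B x + 2 * dd N L x))"
    by (intro smooth_intros open_cone smooth_L smooth_B)
  from smooth_Psi_comp[OF this] show ?thesis
    by (simp add: Grad_def[abs_def])
qed

lemma dd_Grad:
  assumes z: "z \<in> V"
  shows "dd d Grad z = exp (2 * l z) * (2 * dd d l z * (B (Psi z) \<bullet> B (Psi z) + 2 * dd N L (Psi z))
    + 2 * dd (vel d z) (dd (B (Psi z)) L) (Psi z) + 2 * dd (vel d z) (dd N L) (Psi z))"
proof -
  define x where "x = Psi z"
  have x: "x \<in> Mcone" using z by (simp add: x_def V_def)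
  have E: "((\<lambda>x. exp (2 * L x)) has_derivative (\<lambda>u. 2 * dd u L x * exp (2 * L x))) (at x)"
    by (auto intro!: derivative_eq_intros has_derivative_dd[OF L_differentiable[OF x]])
  note hB = has_derivative_dd[OF B_differentiable[OF x]]
  have h: "((\<lambda>x. exp (2 * L x) * (B x \<bullet> B x + 2 * dd N L x)) has_derivative
      (\<lambda>u. exp (2 * L x) * ((B x \<bullet> dd u B x + dd u B x \<bullet> B x) + 2 * dd u (dd N L) x)
        + 2 * dd u L x * exp (2 * L x) * (B x \<bullet> B x + 2 * dd N L x))) (at x)"
    by (intro has_derivative_mult[OF E] has_derivative_add has_derivative_inner[OF hB hB]
        has_derivative_mult_right has_derivative_dd[OF smooth_differentiable(1)[OF x]])
  have "dd d Grad z = dd (vel d z) (\<lambda>x. exp (2 * L x) * (B x \<bullet> B x + 2 * dd N L x)) (Psi z)"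
    unfolding Grad_def[abs_def] by (rule dd_Psi(1)) (use h in \<open>auto simp: differentiable_def x_def\<close>)
  also have "\<dots> = exp (2 * L x) * ((B x \<bullet> dd (vel d z) B x + dd (vel d z) B x \<bullet> B x) + 2 * dd (vel d z) (dd N L) x)
        + 2 * dd (vel d z) L x * exp (2 * L x) * (B x \<bullet> B x + 2 * dd N L x)"
    unfolding x_def[symmetric] by (rule dd_eqI[OF h])
  also have "B x \<bullet> dd (vel d z) B x = dd (vel d z) B x \<bullet> B x"
    by (rule inner_commute)
  also have "dd (vel d z) B x \<bullet> B x = dd (vel d z) (dd (B x) L) x"
    by (rule dd_B_inner[OF x])
  finally show ?thesis
    unfolding dd_l[OF z] by (simp add: x_def l_def algebra_simps)
qed

text \<open>\<open>cubic_identity\<close> removes the third derivative of \<open>L\<close>. The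
  terms left over from the acceleration of \<open>Psi\<close> match the derivative of the summand
  \<open>2 * dd N L\<close> in \<open>Grad\<close>.\<close>

lemma F_equation:
  assumes z: "z \<in> V"
  shows "dd d (dd d (dd d F)) z = 3 * (d \<bullet> d) * dd d Grad z"
proof -
  have x: "Psi z \<in> Mcone" using z by (simp add: V_def)
  let ?b = "dd (vel d z) L (Psi z)" and ?H = "dd (vel d z) (dd (vel d z) L) (Psi z)"
  let ?D = "dd (vel d z) (dd (vel d z) (dd (vel d z) L)) (Psi z)" and ?m = "d \<bullet> d"
  let ?n = "dd N L (Psi z)" and ?Hn = "dd (vel d z) (dd N L) (Psi z)"
  let ?BB = "B (Psi z) \<bullet> B (Psi z)" and ?HB = "dd (vel d z) (dd (B (Psi z)) L) (Psi z)"
  have cubic: "?D + 6 * ?b * ?H + 4 * ?b ^ 3 = 3 * ?m * (?b * ?BB + ?HB)"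
    using cubic_identity[OF T0 x, of "vel d z"] unfolding vel_inner .
  have "dd d (dd d (dd d F)) z = exp (2 * l z) * (2 * (?D + 3 * ?m * ?Hn) + 12 * ?b * (?H + ?m * ?n) + 8 * ?b ^ 3)"
    unfolding F_def[abs_def] third_dd_exp[OF open_V smooth_l z] dd3_l[OF z] dd2_l[OF z] dd_l[OF z] ..
  also have "2 * (?D + 3 * ?m * ?Hn) + 12 * ?b * (?H + ?m * ?n) + 8 * ?b ^ 3
      = 2 * (?D + 6 * ?b * ?H + 4 * ?b ^ 3) + ?m * (6 * ?Hn + 12 * ?b * ?n)"
    by (simp add: algebra_simps)
  finally show ?thesis
    unfolding cubic dd_Grad[OF z] dd_l[OF z] by (simp add: algebra_simps)
qed

lemma F_fifth: "z \<in> V \<Longrightarrow> dd (1, 0) (dd (1, 0) (dd (1, 0) (dd (1, 0) (dd (1, 0) F)))) z = 0"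
  by (rule fifth_dd_eq_0[OF open_V smooth_F smooth_Grad _ F_equation, where f = "(0, 1)"])
     (auto simp: inner_prod_def)

text \<open>
  On a line inside \<open>V\<close> the function \<open>F\<close> is its own Taylor polynomial of degree four.  Approximating
  by parallel lines extends this to lines meeting finitely many points outside \<open>V\<close>.
\<close>

lemma F_quartic:
  assumes fin: "finite (- V)"
  obtains q :: "real poly" where "degree q \<le> 4" "\<And>s. (s, 0) \<in> V \<Longrightarrow> F (s, 0) = poly q s"
proof -
  define D where "D m = ((dd (1, 0)) ^^ m) F" for m :: nat
  have smooth_D: "smooth_on V (D m)" for m
    by (induction m) (auto simp: D_def smooth_F intro: smooth_on_dd)
  have D5: "D 5 z = 0" if "z \<in> V" for z
    using F_fifth[OF that] by (simp add: D_def numeral_eq_Suc)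
  have "infinite {s. (s, 0) \<in> V}"
  proof
    assume "finite {s::real. (s, 0) \<in> V}"
    moreover have "finite (fst ` (- V))" using fin by simp
    ultimately have "finite ({s. (s, 0) \<in> V} \<union> fst ` (- V))" by simp
    moreover have "{s. (s, 0) \<in> V} \<union> fst ` (- V) = (UNIV :: real set)"
      by force
    ultimately show False
      using infinite_UNIV_char_0[where 'a = real] by simp
  qed
  \<comment> \<open>One point of \<open>V\<close> on the limiting line suffices as centre: the
    Taylor coefficients there are limits of those on the parallel lines.\<close>
  then obtain s0 where s0: "(s0, 0) \<in> V"
    using not_finite_existsD by auto
  have line: "F (s, t) = (\<Sum>m<5. D m (s0, t) / fact m * (s - s0) ^ m)" if t: "\<And>s. (s, t) \<in> V" for s t
  proof -
    have der: "((\<lambda>r. D m (s0 + r, t)) has_real_derivative D (Suc m) (s0 + r, t)) (at r)" for m r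
    proof -
      have "((\<lambda>r. (s0 + r, t)) has_derivative (\<lambda>h. (h, 0))) (at r)"
        by (auto intro!: derivative_eq_intros)
      from has_derivative_compose[OF this has_derivative_dd[OF smooth_on_differentiable[OF smooth_D t]]]
      have 1: "((\<lambda>r. D m (s0 + r, t)) has_derivative (\<lambda>h. dd (h, 0) (D m) (s0 + r, t))) (at r)" .
      have lin: "linear (\<lambda>v. dd v (D m) (s0 + r, t))"
        by (rule linear_dd[OF smooth_on_differentiable[OF smooth_D t]])
      have "dd (h, 0) (D m) (s0 + r, t) = D (Suc m) (s0 + r, t) * h" for h
        using linear_cmul[OF lin, of h "(1, 0)"]
        by (simp add: D_def mult.commute)
      with 1 show ?thesis
        by (simp add: has_field_derivative_def)
    qed
    obtain c where "D 0 (s0 + (s - s0), t)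
        = (\<Sum>m<5. D m (s0 + 0, t) / fact m * (s - s0) ^ m) + D 5 (s0 + c, t) / fact 5 * (s - s0) ^ 5"
      using Maclaurin_all_le[of "\<lambda>m r. D m (s0 + r, t)" "\<lambda>r. D 0 (s0 + r, t)" "s - s0" 5] der by auto
    then show ?thesis
      using D5[OF t] by (simp add: D_def)
  qed
  have "F (s, 0) = (\<Sum>m<5. D m (s0, 0) / fact m * (s - s0) ^ m)" if s: "(s, 0) \<in> V" for s
  proof -
    have lim: "((\<lambda>t. h (r, t)) \<longlongrightarrow> h (r, 0)) (at 0)"
      if "smooth_on V h" "(r, 0) \<in> V" for h :: "real \<times> real \<Rightarrow> real" and r
    proof -
      have "isCont h (r, 0)"
        using smooth_on_continuous[OF that(1)] open_V that(2) continuous_on_eq_continuous_at by blast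
      moreover have "((\<lambda>t. (r, t)) \<longlongrightarrow> (r, 0)) (at (0::real))"
        by (intro tendsto_intros)
      ultimately show ?thesis
        using isCont_tendsto_compose by blast
    qed
    have "\<forall>\<^sub>F t in at 0. t \<notin> snd ` (- V)"
      using fin by (intro eventually_notin_finite) simp
    then have ev: "\<forall>\<^sub>F t in at 0. F (s, t) = (\<Sum>m<5. D m (s0, t) / fact m * (s - s0) ^ m)"
    proof eventually_elim
      case (elim t)
      then have "(s, t) \<in> V" for s by force
      then show ?case by (rule line)
    qed
    have "((\<lambda>t. \<Sum>m<5. D m (s0, t) / fact m * (s - s0) ^ m) \<longlongrightarrow>
        (\<Sum>m<5. D m (s0, 0) / fact m * (s - s0) ^ m)) (at 0)"
      by (intro tendsto_sum tendsto_mult tendsto_divide lim smooth_D s0 tendsto_const) simp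
    with ev have "((\<lambda>t. F (s, t)) \<longlongrightarrow> (\<Sum>m<5. D m (s0, 0) / fact m * (s - s0) ^ m)) (at 0)"
      by (simp add: tendsto_cong)
    from tendsto_unique[OF _ lim[OF smooth_F s] this] show ?thesis by simp
  qed
  moreover define q where "q = (\<Sum>m<5. smult (D m (s0, 0) / fact m) ([:- s0, 1:] ^ m))"
  ultimately have "F (s, 0) = poly q s" if "(s, 0) \<in> V" for s
    using that by (simp add: poly_sum)
  moreover have "degree q \<le> 4"
    unfolding q_def
  proof (rule degree_sum_le)
    fix m :: nat assume "m \<in> {..<5}"
    then have "degree (smult (D m (s0, 0) / fact m) ([:- s0, 1:] ^ m)) \<le> m"
      by (metis degree_linear_power degree_smult_le)
    then show "degree (smult (D m (s0, 0) / fact m) ([:- s0, 1:] ^ m)) \<le> 4"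
      using \<open>m \<in> {..<5}\<close> by simp
  qed simp
  ultimately show ?thesis
    using that by blast
qed

end

lemma C1_differentiable_onD:
  "\<gamma> C1_differentiable_on A \<Longrightarrow> t \<in> A \<Longrightarrow> \<exists>D. (\<gamma> has_vector_derivative D) (at t)"
  unfolding C1_differentiable_on_def by blast

context conformal_metric
begin

subsection \<open>The Riemannian distance\<close>

text \<open>
  This agrees with the speed for \<open>g\<close> wherever the derivative is tangent to the sphere, that is, at
  all but finitely many parameters; unlike the latter it is nonnegative everywhere.
\<close>

definition nspeed :: "(real \<Rightarrow> 'a) \<Rightarrow> real \<Rightarrow> real" where
  "nspeed \<gamma> t = exp (- L (\<gamma> t)) * norm (vector_derivative \<gamma> (at t))"

text \<open>Lengths as a relation: reversal and concatenation become closure rules, and the distance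
  is the infimum of the related numbers.\<close>

definition rpath :: "'a \<Rightarrow> 'a \<Rightarrow> real \<Rightarrow> bool" where
  "rpath x y i \<longleftrightarrow> (\<exists>\<gamma>. valid_path \<gamma> \<and> path_image \<gamma> \<subseteq> M \<and> pathstart \<gamma> = x \<and> pathfinish \<gamma> = y \<and>
    (nspeed \<gamma> has_integral i) {0..1})"

lemma speed_eq_nspeed:
  assumes v: "valid_path \<gamma>" and im: "path_image \<gamma> \<subseteq> M"
  obtains S where "finite S" "\<And>t. t \<in> {0..1} - S \<Longrightarrow> speed g \<gamma> t = nspeed \<gamma> t"
proof -
  obtain S where S: "finite S" "\<gamma> C1_differentiable_on {0..1} - S"
    using v by (auto simp: valid_path_def piecewise_C1_differentiable_on_def)
  have in_M: "\<gamma> t \<in> M" if "t \<in> {0..1}" for t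
    using im that by (auto simp: path_image_def)
  \<comment> \<open>The endpoints are excluded because the two-sided derivative there depends on
    values of the path outside the unit interval, which may leave the sphere.\<close>
  have "speed g \<gamma> t = nspeed \<gamma> t" if t: "t \<in> {0..1} - (S \<union> {0, 1})" for t
  proof -
    obtain D where D: "(\<gamma> has_vector_derivative D) (at t)"
      using C1_differentiable_onD[OF S(2), of t] t by blast
    have "((\<lambda>s. \<gamma> s \<bullet> \<gamma> s) has_derivative (\<lambda>h. \<gamma> t \<bullet> (h *\<^sub>R D) + (h *\<^sub>R D) \<bullet> \<gamma> t)) (at t)"
      using D unfolding has_vector_derivative_def by (intro has_derivative_inner)
    moreover have "((\<lambda>s. \<gamma> s \<bullet> \<gamma> s) has_derivative (\<lambda>h. 0)) (at t)"
    proof (rule has_derivative_transform_within_open[of "\<lambda>s. 1" _ _ _ "{0<..<1}"])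
      show "1 = \<gamma> s \<bullet> \<gamma> s" if "s \<in> {0<..<1}" for s
        using inner_M[OF in_M, of s] that by simp
    qed (use t in \<open>auto simp: less_le\<close>)
    ultimately have "(\<lambda>h. \<gamma> t \<bullet> (h *\<^sub>R D) + (h *\<^sub>R D) \<bullet> \<gamma> t) = (\<lambda>h. 0)"
      by (rule has_derivative_unique)
    from fun_cong[OF this, of 1] have "D \<bullet> \<gamma> t = 0"
      by (simp add: inner_commute)
    then have "g (\<gamma> t) D D = exp (- 2 * L (\<gamma> t)) * (D \<bullet> D)"
      using t by (intro g_eq in_M) auto
    also have "\<dots> = (exp (- L (\<gamma> t)) * norm D)\<^sup>2"
      by (simp add: power_mult_distrib dot_square_norm flip: exp_double)
    finally show ?thesis
      by (simp add: speed_def nspeed_def vector_derivative_at[OF D])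
  qed
  then show ?thesis
    using S(1) that[of "S \<union> {0, 1}"] by blast
qed

lemma rpath_admissible:
  "{i. rpath x y i} = (\<lambda>\<gamma>. integral {0..1} (speed g \<gamma>)) ` admissible_paths M g x y"
proof -
  have "(speed g \<gamma> has_integral i) {0..1} \<longleftrightarrow> (nspeed \<gamma> has_integral i) {0..1}"
    if v: "valid_path \<gamma>" "path_image \<gamma> \<subseteq> M" for \<gamma> i
  proof -
    obtain S where "finite S" "\<And>t. t \<in> {0..1} - S \<Longrightarrow> speed g \<gamma> t = nspeed \<gamma> t"
      by (rule speed_eq_nspeed[OF v]) blast
    then show ?thesis
      by (intro has_integral_spike_finite_eq[of S]) auto
  qed
  then have eq: "rpath x y i \<longleftrightarrow> (\<exists>\<gamma>. valid_path \<gamma> \<and> path_image \<gamma> \<subseteq> M \<and> pathstart \<gamma> = x \<and> pathfinish \<gamma> = y \<and>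
      (speed g \<gamma> has_integral i) {0..1})" for i
    unfolding rpath_def by blast
  show ?thesis
    unfolding eq admissible_paths_def image_def
    by (auto simp: integrable_on_def integral_unique)
qed

lemma riemannian_dist_rpath:
  "x \<in> M \<Longrightarrow> y \<in> M \<Longrightarrow> riemannian_dist M g x y = Inf {i. rpath x y i}"
  by (simp add: riemannian_dist_def rpath_admissible)

lemma rpath_nonneg: "rpath x y i \<Longrightarrow> i \<ge> 0"
  unfolding rpath_def nspeed_def by (auto intro: has_integral_nonneg)

lemma rpath_refl: "x \<in> M \<Longrightarrow> rpath x x 0"
proof -
  assume x: "x \<in> M"
  have "vector_derivative (\<lambda>t::real. x) (at t) = 0" for t
    by (simp add: vector_derivative_at)
  then have "(nspeed (\<lambda>t. x) has_integral 0) {0..1}"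
    unfolding nspeed_def by simp
  moreover have "valid_path (\<lambda>t. x)"
    unfolding valid_path_def by (intro C1_differentiable_imp_piecewise) simp
  ultimately show ?thesis
    unfolding rpath_def using x
    by (intro exI[of _ "\<lambda>t. x"]) (auto simp: path_image_def pathstart_def pathfinish_def)
qed

lemma rpath_sym: assumes "rpath x y i" shows "rpath y x i"
proof -
  obtain \<gamma> where \<gamma>: "valid_path \<gamma>" "path_image \<gamma> \<subseteq> M" "pathstart \<gamma> = x" "pathfinish \<gamma> = y"
    "(nspeed \<gamma> has_integral i) {0..1}"
    using assms by (auto simp: rpath_def)
  obtain S where S: "finite S" "\<gamma> C1_differentiable_on {0..1} - S"
    using \<gamma>(1) by (auto simp: valid_path_def piecewise_C1_differentiable_on_def)
  have "((\<lambda>t. nspeed \<gamma> (1 - t)) has_integral i) {0..1}"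
    using has_integral_affinity01[OF \<gamma>(5), of "- 1" 1] by simp
  then have "(nspeed (reversepath \<gamma>) has_integral i) {0..1}"
  proof (rule has_integral_spike_finite[rotated 2])
    show "finite ((\<lambda>t. 1 - t) ` S)" using S(1) by simp
    fix t :: real assume t: "t \<in> {0..1} - (\<lambda>t. 1 - t) ` S"
    then have "1 - t \<in> {0..1} - S"
      by (auto simp: image_iff)
    then obtain D where D: "(\<gamma> has_vector_derivative D) (at (1 - t))"
      using C1_differentiable_onD[OF S(2)] by blast
    have "((\<lambda>t::real. 1 - t) has_vector_derivative - 1) (at t)"
      by (auto intro!: derivative_eq_intros)
    from vector_diff_chain_at[OF this D]
    have "(reversepath \<gamma> has_vector_derivative - D) (at t)"
      by (simp add: o_def reversepath_def)
    then show "nspeed (reversepath \<gamma>) t = nspeed \<gamma> (1 - t)"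
      using D by (simp add: nspeed_def vector_derivative_at reversepath_def)
  qed
  then show ?thesis
    unfolding rpath_def using \<gamma>
    by (intro exI[of _ "reversepath \<gamma>"]) auto
qed

lemma rpath_trans: assumes "rpath x y i" "rpath y z j" shows "rpath x z (i + j)"
proof -
  obtain g1 where g1: "valid_path g1" "path_image g1 \<subseteq> M" "pathstart g1 = x" "pathfinish g1 = y"
    "(nspeed g1 has_integral i) {0..1}"
    using assms(1) by (auto simp: rpath_def)
  obtain g2 where g2: "valid_path g2" "path_image g2 \<subseteq> M" "pathstart g2 = y" "pathfinish g2 = z"
    "(nspeed g2 has_integral j) {0..1}"
    using assms(2) by (auto simp: rpath_def)
  obtain S1 where S1: "finite S1" "g1 C1_differentiable_on {0..1} - S1"
    using g1(1) by (auto simp: valid_path_def piecewise_C1_differentiable_on_def)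
  obtain S2 where S2: "finite S2" "g2 C1_differentiable_on {0..1} - S2"
    using g2(1) by (auto simp: valid_path_def piecewise_C1_differentiable_on_def)
  have i1: "((\<lambda>t. 2 * nspeed g1 (2 * t)) has_integral i) {0..1/2}"
    and i2: "((\<lambda>t. 2 * nspeed g2 (2 * t - 1)) has_integral j) {1/2..1}"
    using has_integral_affinity01 [OF g1(5), where m = 2 and c = 0, THEN has_integral_cmul [where c = 2]]
          has_integral_affinity01 [OF g2(5), where m = 2 and c = "-1", THEN has_integral_cmul [where c = 2]]
    by (simp_all only: image_affinity_atLeastAtMost_div_diff, simp_all)
  have chain: "((\<lambda>t. h (2 * t + c)) has_vector_derivative 2 *\<^sub>R D) (at t)"
    if "(h has_vector_derivative D) (at (2 * t + c))" for h :: "real \<Rightarrow> 'a" and D t c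
  proof -
    have "((\<lambda>t. 2 * t + c) has_vector_derivative 2) (at t)"
      by (auto intro!: derivative_eq_intros)
    from vector_diff_chain_at[OF this that] show ?thesis
      by (simp add: o_def)
  qed
  have "(nspeed (g1 +++ g2) has_integral i) {0..1/2}"
  proof (rule has_integral_spike_finite[OF _ _ i1])
    show "finite (insert (1/2) ((*) 2 -` S1))"
      using S1 by (force intro: finite_vimageI [where h = "(*) 2"] inj_onI)
    fix t :: real assume t: "t \<in> {0..1/2} - insert (1/2) ((*) 2 -` S1)"
    then have "2 * t \<in> {0..1} - S1" by auto
    then obtain D where D: "(g1 has_vector_derivative D) (at (2 * t))"
      using C1_differentiable_onD[OF S1(2)] by blast
    have "((g1 +++ g2) has_vector_derivative 2 *\<^sub>R D) (at t)"
    proof (rule has_vector_derivative_transform_within_open[OF chain[of g1 D t 0]])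
      show "t \<in> {..<1/2}" using t by auto
    qed (use D in \<open>auto simp: joinpaths_def\<close>)
    then show "nspeed (g1 +++ g2) t = 2 * nspeed g1 (2 * t)"
      using D t by (simp add: nspeed_def vector_derivative_at) (simp add: joinpaths_def)
  qed
  moreover have "(nspeed (g1 +++ g2) has_integral j) {1/2..1}"
  proof (rule has_integral_spike_finite[OF _ _ i2])
    show "finite (insert (1/2) ((\<lambda>t. 2 * t - 1) -` S2))"
      using S2 by (force intro: finite_vimageI [where h = "\<lambda>t. 2 * t - 1"] inj_onI)
    fix t :: real assume t: "t \<in> {1/2..1} - insert (1/2) ((\<lambda>t. 2 * t - 1) -` S2)"
    then have "2 * t - 1 \<in> {0..1} - S2" by auto
    then obtain D where D: "(g2 has_vector_derivative D) (at (2 * t - 1))"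
      using C1_differentiable_onD[OF S2(2)] by blast
    have "((g1 +++ g2) has_vector_derivative 2 *\<^sub>R D) (at t)"
    proof (rule has_vector_derivative_transform_within_open[OF chain[of g2 D t "- 1"]])
      show "t \<in> {1/2<..}" using t by auto
    qed (use D in \<open>auto simp: joinpaths_def\<close>)
    then show "nspeed (g1 +++ g2) t = 2 * nspeed g2 (2 * t - 1)"
      using D t by (simp add: nspeed_def vector_derivative_at) (simp add: joinpaths_def)
  qed
  ultimately have "(nspeed (g1 +++ g2) has_integral (i + j)) {0..1}"
    by (rule has_integral_combine[rotated 2]) auto
  then show ?thesis
    unfolding rpath_def using g1 g2
    by (intro exI[of _ "g1 +++ g2"]) (auto intro: valid_path_join simp: path_image_join)
qed

text \<open>A short path from \<open>q\<close> stays near \<open>q\<close>, where the conformal factor is bounded below.\<close>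

lemma rpath_lower:
  assumes q: "q \<in> M"
  obtains r k where "r > 0" "k > 0" "\<And>x i. rpath q x i \<Longrightarrow> k * min r (norm (x - q)) \<le> i"
proof -
  \<comment> \<open>Half the value of the factor at \<open>q\<close>, which bounds it from below
    near \<open>q\<close> by continuity.\<close>
  define k where "k = exp (- L q) / 2"
  have k: "k > 0" by (simp add: k_def)
  have "isCont (\<lambda>x. exp (- L x)) q"
    using smooth_on_continuous[OF smooth_L] open_cone M_cone[OF q] continuous_on_eq_continuous_at
    by (intro continuous_intros) blast
  then obtain r where r: "r > 0" "\<And>y. dist y q < r \<Longrightarrow> \<bar>exp (- L y) - exp (- L q)\<bar> < k"
    using k unfolding continuous_at_eps_delta dist_real_def by blast
  have low: "exp (- L y) \<ge> k" if "dist y q < r" for y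
    using r(2)[OF that] unfolding k_def by linarith
  have "k * min r (norm (x - q)) \<le> i" if rp: "rpath q x i" for x i
  proof -
    obtain \<gamma> where \<gamma>: "valid_path \<gamma>" "path_image \<gamma> \<subseteq> M" "pathstart \<gamma> = q" "pathfinish \<gamma> = x"
      "(nspeed \<gamma> has_integral i) {0..1}"
      using rp by (auto simp: rpath_def)
    have cont: "continuous_on {0..1} \<gamma>"
      using valid_path_imp_path[OF \<gamma>(1)] by (simp add: path_def)
    have ends: "\<gamma> 0 = q" "\<gamma> 1 = x"
      using \<gamma> by (auto simp: pathstart_def pathfinish_def)
    \<comment> \<open>\<open>u\<close> is the first time at distance at least \<open>r\<close> from
      \<open>q\<close>, or 1 if the path stays nearer; in both cases the bound on
      \<open>exp (- L y)\<close> is available before \<open>u\<close>.\<close>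
    obtain u where u: "0 \<le> u" "u \<le> 1" "\<And>t. 0 \<le> t \<Longrightarrow> t < u \<Longrightarrow> dist (\<gamma> t) q < r"
      "min r (norm (x - q)) \<le> norm (\<gamma> u - q)"
    proof (cases "\<forall>t\<in>{0..1}. dist (\<gamma> t) q < r")
      case True
      show ?thesis
        by (rule that[of 1]) (use True ends in auto)
    next
      case False
      let ?A = "{t \<in> {0..1}. r \<le> dist (\<gamma> t) q}"
      have "closed ?A"
        by (intro continuous_on_closed_Collect_le continuous_intros cont)
      moreover have "bounded ?A"
        by (rule bounded_subset[of "{0..1}"]) auto
      ultimately have "compact ?A"
        by (simp add: compact_eq_bounded_closed)
      then obtain u where u: "u \<in> ?A" "\<And>t. t \<in> ?A \<Longrightarrow> u \<le> t"
        using compact_attains_inf[of ?A] False by force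
      show ?thesis
      proof (rule that[of u])
        show "dist (\<gamma> t) q < r" if "0 \<le> t" "t < u" for t
          using u(1) u(2)[of t] that by force
      qed (use u in \<open>auto simp: dist_norm\<close>)
    qed
    obtain S where S: "finite S" "\<gamma> C1_differentiable_on {0..1} - S"
      using \<gamma>(1) by (auto simp: valid_path_def piecewise_C1_differentiable_on_def)
    \<comment> \<open>The value 0 at the exceptional parameters and at \<open>u\<close>, where the
      path may have left the ball, makes the norm bound hold everywhere without affecting the
      integral.\<close>
    define D where "D t = (if t \<in> S \<union> {u} then 0 else vector_derivative \<gamma> (at t))" for t
    have D: "(D has_integral (\<gamma> u - \<gamma> 0)) {0..u}"
    proof (rule fundamental_theorem_of_calculus_interior_strong[OF S(1) u(1)])
      show "continuous_on {0..u} \<gamma>"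
        by (rule continuous_on_subset[OF cont]) (use u(2) in auto)
      show "(\<gamma> has_vector_derivative D t) (at t)" if "t \<in> {0<..<u} - S" for t
      proof -
        have "t \<in> {0..1} - S" using that u by auto
        then obtain E where "(\<gamma> has_vector_derivative E) (at t)"
          using C1_differentiable_onD[OF S(2)] by blast
        then show ?thesis using that by (simp add: D_def vector_derivative_at)
      qed
    qed
    have int1: "nspeed \<gamma> integrable_on {0..1}"
      using \<gamma>(5) by (rule has_integral_integrable)
    then have int: "nspeed \<gamma> integrable_on {0..u}"
      by (rule integrable_on_subinterval) (use u(2) in auto)
    have "norm (integral {0..u} D) \<le> integral {0..u} (\<lambda>t. nspeed \<gamma> t / k)"
    proof (rule Henstock_Kurzweil_Integration.integral_norm_bound_integral)
      show "norm (D t) \<le> nspeed \<gamma> t / k" if t: "t \<in> {0..u}" for t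
      proof (cases "t \<in> S \<union> {u}")
        case True
        then show ?thesis using k by (simp add: D_def nspeed_def)
      next
        case False
        then have "k \<le> exp (- L (\<gamma> t))"
          using t by (intro low u(3)) auto
        then have "k * norm (vector_derivative \<gamma> (at t)) \<le> nspeed \<gamma> t"
          unfolding nspeed_def by (rule mult_right_mono) simp
        then show ?thesis
          using False k by (simp add: D_def field_simps)
      qed
      show "D integrable_on {0..u}"
        using D by (rule has_integral_integrable)
      show "(\<lambda>t. nspeed \<gamma> t / k) integrable_on {0..u}"
        unfolding divide_inverse by (rule integrable_on_mult_left[OF int])
    qed
    also have "integral {0..u} (\<lambda>t. nspeed \<gamma> t / k) = integral {0..u} (nspeed \<gamma>) / k"
      by simp
    also have "integral {0..u} (nspeed \<gamma>) \<le> integral {0..1} (nspeed \<gamma>)"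
      by (rule integral_subset_le[OF _ int int1]) (use u(2) in \<open>auto simp: nspeed_def\<close>)
    also have "integral {0..1} (nspeed \<gamma>) = i"
      using \<gamma>(5) by (rule integral_unique)
    finally have "norm (\<gamma> u - q) \<le> i / k"
      using k integral_unique[OF D] ends by (simp add: divide_right_mono)
    then show ?thesis
      using mult_left_mono[OF order_trans[OF u(4)], of "i / k" k] k by simp
  qed
  then show ?thesis
    using that r(1) k by blast
qed

lemma riemannian_dist_le:
  assumes "x \<in> M" "y \<in> M" "rpath x y i"
  shows "riemannian_dist M g x y \<le> i"
  unfolding riemannian_dist_rpath[OF assms(1,2)]
  by (rule cInf_lower) (use assms rpath_nonneg in \<open>auto intro!: bdd_belowI[of _ 0]\<close>)

text \<open>The hypothesis makes every set of lengths nonempty, so that the infima are genuine.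
  Definiteness comes from \<open>rpath_lower\<close>, the triangle inequality from
  concatenation.\<close>

lemma Metric_space_riemannian:
  assumes connected: "\<And>x y. x \<in> M \<Longrightarrow> y \<in> M \<Longrightarrow> \<exists>i. rpath x y i"
  shows "Metric_space M (riemannian_dist M g)"
proof
  fix x y z
  have greatest: "c \<le> riemannian_dist M g x y"
    if "x \<in> M" "y \<in> M" "\<And>i. rpath x y i \<Longrightarrow> c \<le> i" for x y c
    unfolding riemannian_dist_rpath[OF that(1,2)]
    by (rule cInf_greatest) (use connected[OF that(1,2)] that(3) in auto)
  show nonneg: "0 \<le> riemannian_dist M g x y"
  proof (cases "x \<in> M \<and> y \<in> M")
    case True
    then show ?thesis using rpath_nonneg by (intro greatest) auto
  next
    case False
    then show ?thesis by (auto simp: riemannian_dist_def)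
  qed
  have "rpath x y i \<longleftrightarrow> rpath y x i" for i
    using rpath_sym by blast
  then show "riemannian_dist M g x y = riemannian_dist M g y x"
    by (cases "x \<in> M \<and> y \<in> M") (auto simp: riemannian_dist_rpath riemannian_dist_def[of M g x y] riemannian_dist_def[of M g y x] simp flip: rpath_admissible)
  assume x: "x \<in> M" and y: "y \<in> M"
  show "riemannian_dist M g x y = 0 \<longleftrightarrow> x = y"
  proof
    assume "x = y"
    then show "riemannian_dist M g x y = 0"
      using riemannian_dist_le[OF x y] rpath_refl[OF x] nonneg by force
  next
    assume 0: "riemannian_dist M g x y = 0"
    obtain r k where rk: "r > 0" "k > 0" "\<And>y i. rpath x y i \<Longrightarrow> k * min r (norm (y - x)) \<le> i"
      using rpath_lower[OF x] by metis
    have "k * min r (norm (y - x)) \<le> 0"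
      using greatest[OF x y rk(3)] 0 by simp
    then have "min r (norm (y - x)) \<le> 0"
      using rk(2) by (simp add: mult_le_0_iff)
    then show "x = y"
      using rk(1) by (simp add: min_le_iff_disj)
  qed
  assume z: "z \<in> M"
  have "riemannian_dist M g x z - i \<le> riemannian_dist M g y z" if i: "rpath x y i" for i
  proof (rule greatest[OF y z])
    fix j assume "rpath y z j"
    from riemannian_dist_le[OF x z rpath_trans[OF i this]]
    show "riemannian_dist M g x z - i \<le> j" by simp
  qed
  then have "riemannian_dist M g x z - riemannian_dist M g y z \<le> riemannian_dist M g x y"
    by (intro greatest[OF x y]) (simp add: algebra_simps)
  then show "riemannian_dist M g x z \<le> riemannian_dist M g x y + riemannian_dist M g y z"
    by simp
qed


section \<open>Ambient curves and their radial projections to the sphere\<close>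

lemma has_vector_derivative_sgn:
  fixes c :: "real \<Rightarrow> 'a"
  assumes c: "(c has_vector_derivative c') (at t)" and nz: "c t \<noteq> 0"
  shows "((\<lambda>t. sgn (c t)) has_vector_derivative dd c' sgn (c t)) (at t)"
proof -
  have d: "(sgn :: 'a \<Rightarrow> 'a) differentiable (at (c t))"
    by (rule smooth_on_differentiable[OF smooth_on_sgn[of "- {0}"]]) (use nz in auto)
  have "((\<lambda>t. sgn (c t)) has_derivative (\<lambda>h. dd (h *\<^sub>R c') sgn (c t))) (at t)"
    using has_derivative_compose[OF c[unfolded has_vector_derivative_def] has_derivative_dd[OF d]] .
  then show ?thesis
    unfolding has_vector_derivative_def by (simp add: linear_cmul[OF linear_dd[OF d]])
qed

lemma continuous_dd_sgn:
  fixes c c' :: "real \<Rightarrow> 'a"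
  assumes "continuous_on A c" "continuous_on A c'" "\<And>t. t \<in> A \<Longrightarrow> c t \<noteq> 0"
  shows "continuous_on A (\<lambda>t. dd (c' t) sgn (c t))"
proof -
  have d: "smooth_on (- {0}) (sgn :: 'a \<Rightarrow> 'a)"
    by (rule smooth_on_sgn) auto
  have "continuous_on A (\<lambda>t. dd b sgn (c t))" for b
    by (rule continuous_on_compose2[OF smooth_on_continuous[OF smooth_on_dd[OF d]] assms(1)])
       (use assms(3) in auto)
  then have "continuous_on A (\<lambda>t. \<Sum>b\<in>Basis. (c' t \<bullet> b) *\<^sub>R dd b sgn (c t))"
    by (intro continuous_intros assms(2))
  then show ?thesis
    by (rule continuous_on_cong[THEN iffD1, rotated 2])
       (auto intro!: dd_basis[symmetric] smooth_on_differentiable[OF d] dest: assms(3))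
qed

text \<open>The curve lives in the ambient space and only its radial projection is a path in
  \<open>M\<close>. This admits polynomial curves, while the bound \<open>K\<close> concerns the
  projected velocity.\<close>

lemma rpath_curve:
  fixes c c' :: "real \<Rightarrow> 'a"
  assumes c: "\<And>t. (c has_vector_derivative c' t) (at t)" and c': "continuous_on UNIV c'"
    and ab: "a \<le> b" and cone: "\<And>t. t \<in> {a..b} \<Longrightarrow> c t \<in> Mcone"
    and K: "\<And>t. t \<in> {a..b} \<Longrightarrow> exp (- L (sgn (c t))) * norm (dd (c' t) sgn (c t)) \<le> K"
  obtains i where "rpath (sgn (c a)) (sgn (c b)) i" "i \<le> K * (b - a)"
proof -
  define h where "h s = a + s * (b - a)" for s
  define \<eta> where "\<eta> s = sgn (c (h s))" for s
  have h: "h s \<in> {a..b}" if "s \<in> {0..1}" for s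
  proof -
    have "0 \<le> s * (b - a)" "s * (b - a) \<le> b - a"
      using that ab by (auto intro: mult_left_le_one_le)
    then show ?thesis by (simp add: h_def)
  qed
  have conth: "continuous_on {0..1} h"
    unfolding h_def by (intro continuous_intros)
  have contc: "continuous_on UNIV c"
    using c by (meson continuous_at_imp_continuous_on has_vector_derivative_continuous)
  have D: "(\<eta> has_vector_derivative (b - a) *\<^sub>R dd (c' (h s)) sgn (c (h s))) (at s)" if "s \<in> {0..1}" for s
  proof -
    have "(h has_vector_derivative (b - a)) (at s)"
      unfolding h_def by (auto intro!: derivative_eq_intros)
    moreover have "((\<lambda>t. sgn (c t)) has_vector_derivative dd (c' (h s)) sgn (c (h s))) (at (h s))"
      using cone[OF h[OF that]] zero_notin_cone by (intro has_vector_derivative_sgn c) auto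
    ultimately show ?thesis
      using vector_diff_chain_at[of h "b - a" s "\<lambda>t. sgn (c t)"] by (simp add: o_def \<eta>_def[abs_def])
  qed
  have contch: "continuous_on {0..1} (\<lambda>s. c (h s))" "continuous_on {0..1} (\<lambda>s. c' (h s))"
    using continuous_on_compose2[OF contc conth] continuous_on_compose2[OF c' conth] by auto
  have contD: "continuous_on {0..1} (\<lambda>s. dd (c' (h s)) sgn (c (h s)))"
  proof (rule continuous_dd_sgn[OF contch])
    show "c (h s) \<noteq> 0" if "s \<in> {0..1}" for s
      using cone[OF h[OF that]] zero_notin_cone by metis
  qed
  have "\<eta> C1_differentiable_on {0..1}"
    unfolding C1_differentiable_on_def using D
    by (intro exI[of _ "\<lambda>s. (b - a) *\<^sub>R dd (c' (h s)) sgn (c (h s))"] conjI ballI continuous_intros contD)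
  then have valid: "valid_path \<eta>"
    unfolding valid_path_def by (rule C1_differentiable_imp_piecewise)
  have im: "path_image \<eta> \<subseteq> M"
    using cone[OF h] by (auto simp: path_image_def \<eta>_def Mcone_def)
  have sp: "nspeed \<eta> s = exp (- L (\<eta> s)) * ((b - a) * norm (dd (c' (h s)) sgn (c (h s))))" if "s \<in> {0..1}" for s
    using vector_derivative_at[OF D[OF that]] ab by (simp add: nspeed_def)
  have "continuous_on {0..1} \<eta>"
    using valid by (simp add: valid_path_def piecewise_C1_differentiable_on_def)
  then have "continuous_on {0..1} (\<lambda>s. L (\<eta> s))"
    by (rule continuous_on_compose2[OF smooth_on_continuous[OF smooth_L]])
       (use cone[OF h] M_cone sgn_cone in \<open>auto simp: \<eta>_def\<close>)
  then have "continuous_on {0..1} (\<lambda>s. exp (- L (\<eta> s)) * ((b - a) * norm (dd (c' (h s)) sgn (c (h s)))))"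
    by (intro continuous_intros contD)
  then have "(\<lambda>s. exp (- L (\<eta> s)) * ((b - a) * norm (dd (c' (h s)) sgn (c (h s))))) integrable_on {0..1}"
    by (rule integrable_continuous_real)
  then have "nspeed \<eta> integrable_on {0..1}"
    by (rule integrable_eq) (use sp in auto)
  then obtain i where i: "(nspeed \<eta> has_integral i) {0..1}"
    by (auto simp: integrable_on_def)
  have "i \<le> K * (b - a)"
  proof (rule has_integral_le[OF i])
    show "((\<lambda>s. K * (b - a)) has_integral K * (b - a)) {0..1::real}"
      using has_integral_const_real[of "K * (b - a)" 0 1] by simp
    fix s :: real assume s: "s \<in> {0..1}"
    have "nspeed \<eta> s = (exp (- L (\<eta> s)) * norm (dd (c' (h s)) sgn (c (h s)))) * (b - a)"
      by (simp add: sp[OF s])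
    also have "\<dots> \<le> K * (b - a)"
      unfolding \<eta>_def using ab by (intro mult_right_mono K h s) auto
    finally show "nspeed \<eta> s \<le> K * (b - a)" .
  qed
  moreover have "rpath (sgn (c a)) (sgn (c b)) i"
    unfolding rpath_def using valid im i
    by (intro exI[of _ \<eta>]) (auto simp: pathstart_def pathfinish_def \<eta>_def h_def)
  ultimately show ?thesis
    using that by blast
qed

lemma rpath_segment:
  assumes "\<And>t. t \<in> {0..1} \<Longrightarrow> (1 - t) *\<^sub>R x + t *\<^sub>R y \<in> Mcone"
  shows "\<exists>i. rpath (sgn x) (sgn y) i"
proof -
  let ?c = "\<lambda>t. (1 - t) *\<^sub>R x + t *\<^sub>R y"
  have contc: "continuous_on {0..1} ?c"
    by (intro continuous_intros)
  have nz: "?c t \<noteq> 0" if "t \<in> {0..1}" for t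
    using assms[OF that] zero_notin_cone by metis
  have "continuous_on {0..1} (\<lambda>t. sgn (?c t))"
    by (rule continuous_on_compose2[OF smooth_on_continuous[OF smooth_sgn] contc]) (use assms in auto)
  then have "continuous_on {0..1} (\<lambda>t. L (sgn (?c t)))"
    by (rule continuous_on_compose2[OF smooth_on_continuous[OF smooth_L]])
       (use assms sgn_cone M_cone in blast)
  moreover have "continuous_on {0..1} (\<lambda>t. dd (y - x) sgn (?c t))"
    by (rule continuous_dd_sgn[OF contc continuous_on_const nz])
  ultimately have "continuous_on {0..1} (\<lambda>t. exp (- L (sgn (?c t))) * norm (dd (y - x) sgn (?c t)))"
    by (intro continuous_intros)
  then obtain K where K: "\<And>t. t \<in> {0..1} \<Longrightarrow> exp (- L (sgn (?c t))) * norm (dd (y - x) sgn (?c t)) \<le> K"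
    using compact_continuous_image[THEN compact_imp_bounded, THEN bounded_imp_bdd_above, of "{0..1::real}"]
    by (force simp: bdd_above_def)
  have "(?c has_vector_derivative (y - x)) (at t)" for t
    by (auto intro!: derivative_eq_intros)
  then obtain i where "rpath (sgn (?c 0)) (sgn (?c 1)) i"
    by (rule rpath_curve[of ?c "\<lambda>t. y - x" 0 1 K]) (use assms K in auto)
  then show ?thesis by auto
qed

lemma rpath_exists:
  assumes M: "M = sphere 0 1 - \<Lambda>" and fin: "finite \<Lambda>" and dim: "DIM('a) \<ge> 3"
    and x: "x \<in> M" and y: "y \<in> M"
  shows "\<exists>i. rpath x y i"
proof -
  text \<open>Connect both points to some \<open>z\<close> outside the finitely many planes through them and \<open>\<Lambda>\<close>.\<close>
  define planes where "planes = (\<lambda>(a, p). span {a, p}) ` ({x, y} \<times> insert 0 \<Lambda>)"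
  have "negligible (\<Union>planes)"
  proof (rule negligible_Union)
    show "finite planes" using fin by (simp add: planes_def)
    fix A assume "A \<in> planes"
    then obtain a p where "A = span {a, p}" by (auto simp: planes_def)
    moreover have "dim (span {a, p}) \<le> 2"
      using dim_le_card'[of "{a, p}"] card_insert_le_m1[of 2 "{p}" a] by (simp add: card_insert_if split: if_splits)
    ultimately show "negligible A"
      using dim by (intro negligible_lowdim) simp
  qed
  then have "\<Union>planes \<noteq> UNIV" by (metis non_negligible_UNIV)
  then obtain z where z: "z \<notin> \<Union>planes" by auto
  have seg: "(1 - t) *\<^sub>R a + t *\<^sub>R z \<in> Mcone" if a: "a \<in> {x, y}" and t: "t \<in> {0..1}" for a t
  proof (cases "t = 0")
    case True
    then show ?thesis using x y a M_cone by auto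
  next
    case False
    let ?v = "(1 - t) *\<^sub>R a + t *\<^sub>R z"
    have out: "?v \<notin> span {a, p}" if "p \<in> insert 0 \<Lambda>" for p
    proof
      assume "?v \<in> span {a, p}"
      then have "(1 / t) *\<^sub>R (?v - (1 - t) *\<^sub>R a) \<in> span {a, p}"
        by (intro span_scale span_diff) (auto intro: span_base)
      then have "z \<in> span {a, p}" using False by simp
      then show False using z a that by (auto simp: planes_def)
    qed
    have v0: "?v \<noteq> 0" using out[of 0] span_zero[of "{a, 0}"] by auto
    have "sgn ?v \<notin> \<Lambda>"
    proof
      assume "sgn ?v \<in> \<Lambda>"
      moreover have "?v = norm ?v *\<^sub>R sgn ?v" using v0 by (simp add: sgn_div_norm)
      then have "?v \<in> span {a, sgn ?v}"
        by (metis insertI1 insertI2 span_base span_scale)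
      ultimately show False using out by blast
    qed
    then have "sgn ?v \<in> M"
      unfolding M using v0 by (simp add: norm_sgn)
    then show ?thesis
      by (simp add: Mcone_def)
  qed
  obtain i j where "rpath (sgn x) (sgn z) i" "rpath (sgn y) (sgn z) j"
    using rpath_segment[of x z] rpath_segment[of y z] seg by blast
  then show ?thesis
    using rpath_trans[OF _ rpath_sym] by (metis sgn_M x y)
qed

text \<open>A lower bound on \<open>exp (L (c t))\<close> bounds the length of the projected curve
  up to the puncture, so points approaching it form a Cauchy sequence. By completeness the sequence
  converges in \<open>M\<close>, but its Euclidean limit is the puncture.\<close>

lemma incomplete_curve:
  fixes c c' :: "real \<Rightarrow> 'a"
  assumes connected: "\<And>x y. x \<in> M \<Longrightarrow> y \<in> M \<Longrightarrow> \<exists>i. rpath x y i"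
    and complete: "complete_metric M g"
    and c: "\<And>t. (c has_vector_derivative c' t) (at t)" and c': "continuous_on UNIV c'"
    and d: "d > 0" and cone: "\<And>t. t \<in> {0<..d} \<Longrightarrow> c t \<in> Mcone"
    and c0: "c 0 \<noteq> 0" and out: "sgn (c 0) \<notin> M"
    and k: "k > 0" "\<And>t. t \<in> {0<..d} \<Longrightarrow> k \<le> exp (L (c t))"
  shows False
proof -
  interpret R: Metric_space M "riemannian_dist M g"
    by (rule Metric_space_riemannian[OF connected])
  have nz: "c t \<noteq> 0" if "t \<in> {0..d}" for t
    using that c0 cone[of t] zero_notin_cone by (cases "t = 0") auto
  have contc: "continuous_on UNIV c"
    using c by (meson continuous_at_imp_continuous_on has_vector_derivative_continuous)
  then have contd: "continuous_on {0..d} c" by (rule continuous_on_subset) simp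
  have "continuous_on {0..d} (\<lambda>t. norm (c t) / k * norm (dd (c' t) sgn (c t)))"
    using k(1) by (intro continuous_intros contd continuous_dd_sgn nz continuous_on_subset[OF c']) auto
  then have "bdd_above ((\<lambda>t. norm (c t) / k * norm (dd (c' t) sgn (c t))) ` {0..d})"
    by (intro bounded_imp_bdd_above compact_imp_bounded compact_continuous_image) auto
  then obtain K0 where "\<forall>t\<in>{0..d}. norm (c t) / k * norm (dd (c' t) sgn (c t)) \<le> K0"
    unfolding bdd_above_def by blast
  then have K0: "norm (c t) / k * norm (dd (c' t) sgn (c t)) \<le> K0" if "t \<in> {0..d}" for t
    using that by blast
  \<comment> \<open>The maximum with 1 makes \<open>K\<close> positive, so that one can divide by
    it.\<close>
  define K where "K = max K0 1"
  have K: "exp (- L (sgn (c t))) * norm (dd (c' t) sgn (c t)) \<le> K" if t: "t \<in> {0<..d}" for t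
  proof -
    have n: "norm (c t) > 0" using nz[of t] t by auto
    have "L (norm (c t) *\<^sub>R sgn (c t)) = L (sgn (c t)) + ln (norm (c t))"
      using sgn_cone[OF cone[OF t]] by (intro L_scaleR n) (simp add: sgn_M)
    moreover have "norm (c t) *\<^sub>R sgn (c t) = c t"
      using n by (simp add: sgn_div_norm)
    ultimately have "exp (- L (sgn (c t))) = norm (c t) / exp (L (c t))"
      using n by (simp add: exp_add exp_minus field_simps)
    also have "\<dots> \<le> norm (c t) / k"
      using k(2)[OF t] k(1) by (intro divide_left_mono) auto
    finally have "exp (- L (sgn (c t))) * norm (dd (c' t) sgn (c t)) \<le> norm (c t) / k * norm (dd (c' t) sgn (c t))"
      by (rule mult_right_mono) simp
    also have "\<dots> \<le> K"
      using K0[of t] t by (simp add: K_def)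
    finally show ?thesis .
  qed
  have dist: "riemannian_dist M g (sgn (c a)) (sgn (c b)) \<le> K * (b - a)"
    if ab: "0 < a" "a \<le> b" "b \<le> d" for a b
  proof -
    obtain i where "rpath (sgn (c a)) (sgn (c b)) i" "i \<le> K * (b - a)"
      by (rule rpath_curve[OF c c' ab(2), of K]) (use cone K ab in auto)
    moreover have "sgn (c a) \<in> M" "sgn (c b) \<in> M"
      using cone ab by (auto intro: sgn_cone)
    ultimately show ?thesis
      using riemannian_dist_le by force
  qed
  define t where "t m = d / real (Suc m)" for m
  have t: "0 < t m" "t m \<le> d" for m
    using d by (auto simp: t_def field_simps)
  define x where "x m = sgn (c (t m))" for m
  have xM: "x m \<in> M" for m
    using cone[of "t m"] t by (auto simp: x_def intro: sgn_cone)
  have dist_x: "riemannian_dist M g (x m) (x n) \<le> K * max (t m) (t n)" for m n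
  proof -
    have "riemannian_dist M g (x m) (x n) \<le> K * \<bar>t m - t n\<bar>"
    proof (cases "t m \<le> t n")
      case True
      then show ?thesis using dist[of "t m" "t n"] t by (simp add: x_def)
    next
      case False
      then show ?thesis using dist[of "t n" "t m"] t R.commute[of "x m"] by (simp add: x_def)
    qed
    also have "\<dots> \<le> K * max (t m) (t n)"
      using t(1)[of m] t(1)[of n] by (intro mult_left_mono) (auto simp: K_def)
    finally show ?thesis .
  qed
  have tlim: "t \<longlonglongrightarrow> 0"
    unfolding t_def using LIMSEQ_Suc[OF lim_const_over_n[of d]] by simp
  have "R.MCauchy x"
    unfolding R.MCauchy_def
  proof (intro conjI allI impI)
    fix e :: real assume e: "e > 0"
    then have "e / K > 0" by (simp add: K_def)
    then obtain N where N: "\<And>n. n \<ge> N \<Longrightarrow> \<bar>t n\<bar> < e / K"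
      using tlim by (auto simp: LIMSEQ_def dist_real_def)
    have "riemannian_dist M g (x m) (x n) < e" if "N \<le> m" "N \<le> n" for m n
    proof -
      have "max (t m) (t n) < e / K"
        using N[OF that(1)] N[OF that(2)] by auto
      moreover have "K > 0" by (simp add: K_def)
      ultimately have "K * max (t m) (t n) < e"
        by (simp only: pos_less_divide_eq mult.commute)
      then show ?thesis using dist_x[of m n] by linarith
    qed
    then show "\<exists>N. \<forall>n n'. N \<le> n \<longrightarrow> N \<le> n' \<longrightarrow> riemannian_dist M g (x n) (x n') < e" by blast
  qed (use xM in auto)
  then obtain q where "limitin R.mtopology x q sequentially"
    using complete unfolding complete_metric_def R.mcomplete_def by blast
  then have q: "q \<in> M" and lim: "\<And>e. e > 0 \<Longrightarrow> \<exists>N. \<forall>n\<ge>N. riemannian_dist M g (x n) q < e"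
    unfolding R.limit_metric_sequentially by blast+
  \<comment> \<open>The length bound at the limit turns convergence for the Riemannian distance into
    Euclidean convergence.\<close>
  obtain r \<kappa> where r: "r > 0" "\<kappa> > 0" "\<And>y i. rpath q y i \<Longrightarrow> \<kappa> * min r (norm (y - q)) \<le> i"
    using rpath_lower[OF q] by metis
  have lower: "\<kappa> * min r (norm (y - q)) \<le> riemannian_dist M g q y" if "y \<in> M" for y
    unfolding riemannian_dist_rpath[OF q that]
    by (rule cInf_greatest) (use connected[OF q that] r(3) in auto)
  have "x \<longlonglongrightarrow> q"
    unfolding LIMSEQ_def
  proof (intro allI impI)
    fix e :: real assume e: "e > 0"
    then have "\<kappa> * min r e > 0" using r by simp
    then obtain N where N: "\<And>n. n \<ge> N \<Longrightarrow> riemannian_dist M g (x n) q < \<kappa> * min r e"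
      using lim by blast
    have "dist (x n) q < e" if "n \<ge> N" for n
    proof -
      have "\<kappa> * min r (norm (x n - q)) < \<kappa> * min r e"
        using lower[OF xM[of n]] N[OF that] R.commute[of q "x n"] by simp
      then have "min r (norm (x n - q)) < min r e"
        using r(2) by simp
      then show ?thesis by (auto simp: dist_norm min_def split: if_splits)
    qed
    then show "\<exists>N. \<forall>n\<ge>N. dist (x n) q < e" by blast
  qed
  moreover have "x \<longlonglongrightarrow> sgn (c 0)"
  proof -
    have "isCont c 0" using contc by (simp add: continuous_on_eq_continuous_at)
    then have "(\<lambda>m. c (t m)) \<longlonglongrightarrow> c 0"
      using tlim by (rule isCont_tendsto_compose)
    then show ?thesis
      unfolding x_def[abs_def] by (intro tendsto_sgn c0)
  qed
  ultimately show False
    using LIMSEQ_unique q out by blast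
qed

text \<open>\<open>r\<close> extends the squared factor continuously to the puncture. If it were
  nonzero there, \<open>exp (L (c t))\<close> would be bounded below nearby, against
  \<open>incomplete_curve\<close>.\<close>

lemma conformal_factor_limit:
  fixes c c' :: "real \<Rightarrow> 'a"
  assumes connected: "\<And>x y. x \<in> M \<Longrightarrow> y \<in> M \<Longrightarrow> \<exists>i. rpath x y i"
    and complete: "complete_metric M g"
    and c: "\<And>t. (c has_vector_derivative c' t) (at t)" and c': "continuous_on UNIV c'"
    and d: "d > 0" and cone: "\<And>t. t \<in> {0<..d} \<Longrightarrow> c t \<in> Mcone"
    and c0: "c 0 \<noteq> 0" and out: "sgn (c 0) \<notin> M"
    and r: "\<And>t. t \<in> {0<..d} \<Longrightarrow> exp (2 * L (c t)) = r t" and cont: "isCont r 0"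
  shows "r 0 = 0"
proof (rule ccontr)
  assume nz: "r 0 \<noteq> 0"
  then obtain d1 where d1: "d1 > 0" "\<And>t. dist t 0 < d1 \<Longrightarrow> \<bar>r t - r 0\<bar> < \<bar>r 0\<bar> / 2"
    using cont unfolding continuous_at_eps_delta dist_real_def by (metis half_gt_zero zero_less_abs_iff)
  define d2 where "d2 = min d (d1 / 2)"
  have d2: "d2 > 0" "d2 \<le> d" "d2 < d1"
    using d d1(1) by (auto simp: d2_def min_def)
  have "sqrt (\<bar>r 0\<bar> / 2) \<le> exp (L (c t))" if t: "t \<in> {0<..d2}" for t
  proof -
    have "\<bar>r t - r 0\<bar> < \<bar>r 0\<bar> / 2"
      using t d2 by (intro d1(2)) auto
    moreover have rt: "r t = exp (2 * L (c t))"
      using t d2 r by auto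
    then have "r t > 0" by simp
    ultimately have "\<bar>r 0\<bar> / 2 \<le> r t" by arith
    also have "\<dots> = (exp (L (c t)))\<^sup>2"
      by (simp add: rt exp_double)
    finally show ?thesis
      by (intro real_le_lsqrt) auto
  qed
  from incomplete_curve[OF connected complete c c' d2(1) _ c0 out _ this] show False
    using nz cone d2(2) by auto
qed

end

section \<open>Three punctures\<close>

text \<open>A zero of a nonnegative polynomial is a minimum, so the derivative vanishes there
  too.\<close>

lemma double_root:
  fixes q :: "real poly"
  assumes nonneg: "\<And>x. poly q x \<ge> 0" and root: "poly q a = 0"
  shows "[:- a, 1:]\<^sup>2 dvd q"
proof -
  obtain r where r: "q = [:- a, 1:] * r"
    using root by (auto simp: poly_eq_0_iff_dvd dvd_def)
  have "poly (pderiv q) a = 0"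
    by (rule DERIV_local_min[OF poly_DERIV, of 1]) (use nonneg root in auto)
  moreover have "pderiv q = [:- a, 1:] * pderiv r + r * pderiv [:- a, 1:]"
    unfolding r by (rule pderiv_mult)
  ultimately have "poly r a = 0"
    by (simp only: poly_add poly_mult) (simp add: pderiv_pCons)
  then have "[:- a, 1:] dvd r"
    by (simp add: poly_eq_0_iff_dvd)
  then show ?thesis
    unfolding r power2_eq_square by (rule mult_dvd_mono[OF dvd_refl])
qed

text \<open>Both zeros are double, and two double zeros of a nonzero polynomial need degree
  4.\<close>

lemma nonneg_two_roots:
  fixes q :: "real poly"
  assumes nonneg: "\<And>x. poly q x \<ge> 0" and roots: "poly q a = 0" "poly q b = 0" "a \<noteq> b"
    and deg: "degree q < 4"
  shows "q = 0"
proof (rule ccontr)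
  assume q0: "q \<noteq> 0"
  obtain R where R: "q = [:- a, 1:]\<^sup>2 * R"
    using double_root[OF nonneg roots(1)] by (auto simp: dvd_def)
  have nz: "[:- a, 1:]\<^sup>2 * R \<noteq> 0" using q0 R by simp
  have "2 \<le> order b q"
    using double_root[OF nonneg roots(2)] q0 by (simp add: order_divides)
  also have "order b q = order b ([:- a, 1:]\<^sup>2) + order b R"
    unfolding R by (rule order_mult[OF nz])
  also have "order b ([:- a, 1:]\<^sup>2) = 0"
    by (rule order_0I) (use roots(3) in simp)
  finally have "2 \<le> degree R"
    using order_degree[of R b] nz by force
  moreover have "degree q = 2 + degree R"
    using nz unfolding R by (subst degree_mult_eq) (auto simp: degree_linear_power)
  ultimately show False using deg by simp
qed

lemma ex_unit_orthogonal:
  fixes u v :: "'a::euclidean_space"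
  assumes "DIM('a) \<ge> 3"
  obtains f where "f \<bullet> f = 1" "f \<bullet> u = 0" "f \<bullet> v = 0"
proof -
  have "card {u, v} \<le> 2"
    by (simp add: card_insert_if)
  then have "dim {u, v} < DIM('a)"
    using assms dim_le_card'[of "{u, v}"] by simp
  then obtain x where x: "x \<noteq> 0" "\<And>y. y \<in> span {u, v} \<Longrightarrow> orthogonal x y"
    using orthogonal_to_subspace_exists by blast
  have "x \<bullet> u = 0" "x \<bullet> v = 0"
    using x(2)[OF span_base] by (auto simp: orthogonal_def)
  then show ?thesis
    using x(1) by (intro that[of "sgn x"]) (simp_all add: sgn_div_norm dot_square_norm power2_eq_square)
qed

section \<open>Zeros of the polynomial at the punctures\<close>

context conformal_stereographic
begin

lemma Psi_nonzero: "Psi z \<noteq> 0"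
proof -
  have "norm (Psi z) > 0"
    unfolding norm_Psi by (smt (verit) inner_ge_zero half_gt_zero)
  then show ?thesis by auto
qed

lemma plane_e: "plane (s + t, 0) = plane (s, 0) + t *\<^sub>R e"
  by (simp add: plane_def scaleR_add_left)

text \<open>The polynomial provides the continuous extension to the puncture that
  \<open>conformal_factor_limit\<close> asks for; the curve approaches along the line from one
  side.\<close>

lemma F_limit:
  assumes connected: "\<And>x y. x \<in> M \<Longrightarrow> y \<in> M \<Longrightarrow> \<exists>i. rpath x y i"
    and complete: "complete_metric M g" and fin: "finite (- V)"
    and q: "\<And>s. (s, 0) \<in> V \<Longrightarrow> F (s, 0) = poly q s" and out: "(s, 0) \<notin> V"
  shows "poly q s = 0"
proof -
  have "finite (fst ` (- V))" using fin by simp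
  from eventually_notin_finite[OF this, of s]
  obtain d where d: "d > 0" "\<And>t. t \<noteq> s \<Longrightarrow> dist t s < d \<Longrightarrow> t \<notin> fst ` (- V)"
    unfolding eventually_at by auto
  have inV: "(s + t, 0) \<in> V" if t: "t \<in> {0<..d / 2}" for t
  proof -
    have "s + t \<notin> fst ` (- V)"
      using t d(1) by (intro d(2)) (auto simp: dist_real_def)
    then show ?thesis by force
  qed
  have "poly q (s + 0) = 0"
  proof (rule conformal_factor_limit[where c = "\<lambda>t. Psi (s + t, 0)" and c' = "\<lambda>t. vel (1, 0) (s + t, 0)"
        and r = "\<lambda>t. poly q (s + t)" and d = "d / 2", OF connected complete])
    show "((\<lambda>t. Psi (s + t, 0)) has_vector_derivative vel (1, 0) (s + t, 0)) (at t)" for t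
    proof -
      have "((\<lambda>t. (s + t, 0::real)) has_derivative (\<lambda>h. (h, 0))) (at t)"
        by (auto intro!: derivative_eq_intros)
      from has_derivative_compose[OF this Psi_has_derivative]
      have "((\<lambda>t. Psi (s + t, 0)) has_derivative (\<lambda>h. vel (h, 0) (s + t, 0))) (at t)" .
      moreover have "(\<lambda>h. vel (h, 0) (s + t, 0)) = (\<lambda>h. h *\<^sub>R vel (1, 0) (s + t, 0))"
        by (rule ext) (simp add: vel_def dirn_def scaleR_add_right)
      ultimately show ?thesis by (simp only: has_vector_derivative_def)
    qed
    show "continuous_on UNIV (\<lambda>t. vel (1, 0) (s + t, 0))"
      unfolding vel_def plane_e by (intro continuous_intros)
    show "d / 2 > 0" using d(1) by simp
    show "Psi (s + t, 0) \<in> Mcone" if "t \<in> {0<..d / 2}" for t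
      using inV[OF that] by (simp add: V_def)
    show "Psi (s + 0, 0) \<noteq> 0" by (rule Psi_nonzero)
    show "sgn (Psi (s + 0, 0)) \<notin> M" using out by (simp add: V_def Mcone_def)
    show "exp (2 * L (Psi (s + t, 0))) = poly q (s + t)" if "t \<in> {0<..d / 2}" for t
      using q[OF inV[OF that]] by (simp add: F_def l_def)
    show "isCont (\<lambda>t. poly q (s + t)) 0"
      by (intro continuous_intros)
  qed
  then show ?thesis by simp
qed

text \<open>Along the rescaled curve \<open>L\<close> grows by \<open>ln (t\<^sup>2)\<close>, so
  \<open>exp (2 * L (c t))\<close> is \<open>t ^ 4\<close> times the value of \<open>q\<close> at
  \<open>1 / t\<close>. This reverses the coefficients relative to degree 4, and the value at 0 is
  the coefficient of degree 4.\<close>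

lemma F_limit_infinity:
  assumes connected: "\<And>x y. x \<in> M \<Longrightarrow> y \<in> M \<Longrightarrow> \<exists>i. rpath x y i"
    and complete: "complete_metric M g" and fin: "finite (- V)"
    and q: "\<And>s. (s, 0) \<in> V \<Longrightarrow> F (s, 0) = poly q s" and deg: "degree q \<le> 4" and out: "N \<notin> M"
  shows "coeff q 4 = 0"
proof -
  text \<open>This curve is \<open>t\<^sup>2 Psi (1 / t, 0)\<close>, extended to \<open>t = 0\<close>.\<close>
  define h where "h t = (t\<^sup>2 * (y1 \<bullet> y1) + 2 * t * (e \<bullet> y1) + 1 - t\<^sup>2) / 2" for t
  define c where "c t = t\<^sup>2 *\<^sub>R y1 + t *\<^sub>R e + h t *\<^sub>R N" for t
  define c' where "c' t = (2 * t) *\<^sub>R y1 + 1 *\<^sub>R e + (t * (y1 \<bullet> y1) + e \<bullet> y1 - t) *\<^sub>R N" for t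
  define r where "r t = (\<Sum>i\<le>4. coeff q i * t ^ (4 - i))" for t
  have cP: "c t = t\<^sup>2 *\<^sub>R Psi (1 / t, 0)" if t: "t \<noteq> 0" for t
  proof -
    define w where "w = t *\<^sub>R y1 + e"
    have pl: "plane (1 / t, 0) = (1 / t) *\<^sub>R w"
      using t by (simp add: w_def plane_def scaleR_add_right)
    have "t\<^sup>2 * ((plane (1 / t, 0) \<bullet> plane (1 / t, 0) - 1) / 2) = (w \<bullet> w - t\<^sup>2) / 2"
      unfolding pl using t by (simp add: power2_eq_square field_simps)
    moreover have "w \<bullet> w = t\<^sup>2 * (y1 \<bullet> y1) + 2 * t * (e \<bullet> y1) + 1"
      using ef(1) by (simp add: w_def inner_add_left inner_add_right inner_commute[of y1 e] power2_eq_square algebra_simps)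
    moreover have "t\<^sup>2 *\<^sub>R plane (1 / t, 0) = t\<^sup>2 *\<^sub>R y1 + t *\<^sub>R e"
      unfolding pl w_def using t by (simp add: scaleR_add_right power2_eq_square)
    ultimately show ?thesis
      unfolding Psi_def scaleR_add_right scaleR_scaleR c_def h_def by simp
  qed
  have "finite (fst ` (- V))" using fin by simp
  then obtain b where b: "\<And>s. s \<in> fst ` (- V) \<Longrightarrow> s \<le> b"
    using bdd_above_finite by (metis bdd_above_def)
  \<comment> \<open>For positive \<open>t\<close> up to \<open>d\<close> the parameter
    \<open>1 / t\<close> lies beyond all excluded ones.\<close>
  define d where "d = 1 / (\<bar>b\<bar> + 1)"
  have d: "d > 0" by (simp add: d_def)
  have inV: "(1 / t, 0) \<in> V" if t: "t \<in> {0<..d}" for t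
  proof -
    have "1 / d \<le> 1 / t" using t by (intro divide_left_mono) auto
    then have "b < 1 / t" by (simp add: d_def)
    then have "1 / t \<notin> fst ` (- V)" using b by force
    then show ?thesis by force
  qed
  have "r 0 = 0"
  proof (rule conformal_factor_limit[where c = c and r = r and d = d
        and c' = c', OF connected complete])
    show "(c has_vector_derivative c' t) (at t)" for t
    proof -
      have const: "((\<lambda>t. k t *\<^sub>R v) has_vector_derivative k' *\<^sub>R v) (at t)"
        if "(k has_real_derivative k') (at t)" for k k' and v :: 'a
        using has_vector_derivative_scaleR[OF that has_vector_derivative_const[of v]] by simp
      have "(h has_real_derivative t * (y1 \<bullet> y1) + e \<bullet> y1 - t) (at t)"
        unfolding h_def by (auto intro!: derivative_eq_intros simp: field_simps)
      moreover have "((\<lambda>t. t\<^sup>2) has_real_derivative 2 * t) (at t)"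
        by (auto intro!: derivative_eq_intros)
      ultimately show ?thesis
        unfolding c_def c'_def by (intro has_vector_derivative_add const DERIV_ident)
    qed
    show "continuous_on UNIV c'"
      unfolding c'_def by (intro continuous_intros)
    show "d > 0" by (rule d)
    show "c t \<in> Mcone" if t: "t \<in> {0<..d}" for t
      using inV[OF t] t scaleR_cone[of "Psi (1 / t, 0)" "t\<^sup>2"] by (simp add: cP V_def)
    \<comment> \<open>The curve ends on the ray of the pole \<open>N\<close>, the puncture at
      infinity.\<close>
    have c0: "c 0 = (1 / 2) *\<^sub>R N"
      by (simp add: c_def h_def)
    have "N \<noteq> 0" "norm N = 1"
      using N(1) by (auto simp: norm_eq_1)
    then show "c 0 \<noteq> 0" "sgn (c 0) \<notin> M"
      using out unfolding c0 by (simp_all add: sgn_scaleR sgn_div_norm)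
    show "exp (2 * L (c t)) = r t" if t: "t \<in> {0<..d}" for t
    proof -
      have "L (c t) = L (Psi (1 / t, 0)) + ln (t\<^sup>2)"
        using inV[OF t] t by (simp add: cP V_def Mcone_def L_scaleR)
      then have "exp (2 * L (c t)) = F (1 / t, 0) * (t\<^sup>2)\<^sup>2"
        using t by (simp add: F_def l_def distrib_left exp_add exp_double[of "ln _"])
      also have "\<dots> = (\<Sum>i\<le>4. coeff q i * (1 / t) ^ i) * t ^ 4"
        unfolding q[OF inV[OF t]] poly_altdef
        using deg by (auto intro!: sum.mono_neutral_left intro: le_degree)
      also have "\<dots> = r t"
        unfolding r_def sum_distrib_right
      proof (rule sum.cong[OF refl])
        fix i :: nat assume "i \<in> {..4}"
        then have "t ^ 4 = t ^ i * t ^ (4 - i)" by (simp flip: power_add)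
        then show "coeff q i * (1 / t) ^ i * t ^ 4 = coeff q i * t ^ (4 - i)"
          using t by (simp add: power_one_over field_simps)
      qed
      finally show ?thesis .
    qed
    show "isCont r 0"
      unfolding r_def by (intro continuous_intros)
  qed
  moreover have "r 0 = coeff q 4"
    by (simp add: r_def atMost_nat_numeral)
  ultimately show ?thesis by simp
qed

lemma two_roots_contradiction:
  assumes connected: "\<And>x y. x \<in> M \<Longrightarrow> y \<in> M \<Longrightarrow> \<exists>i. rpath x y i"
    and complete: "complete_metric M g" and fin: "finite (- V)" and pole: "N \<notin> M"
    and out: "(s1, 0) \<notin> V" "(s2, 0) \<notin> V" "s1 \<noteq> s2"
  shows False
proof -
  obtain q where q: "degree q \<le> 4" "\<And>s. (s, 0) \<in> V \<Longrightarrow> F (s, 0) = poly q s"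
    using F_quartic[OF fin] by blast
  have ev: "\<forall>\<^sub>F t in at s. (t, 0) \<in> V" for s
  proof -
    have "\<forall>\<^sub>F t in at s. t \<notin> fst ` (- V)"
      using fin by (intro eventually_notin_finite) simp
    then show ?thesis by eventually_elim force
  qed
  have pos: "poly q t > 0" if "(t, 0) \<in> V" for t
    using q(2)[OF that] by (simp add: F_def flip: q(2)[OF that])
  \<comment> \<open>\<open>q\<close> is positive at all parameters in \<open>V\<close>, which are
    dense in the line, hence nonnegative everywhere by continuity.\<close>
  have "poly q s \<ge> 0" for s
  proof (rule tendsto_lowerbound)
    show "(poly q \<longlongrightarrow> poly q s) (at s)"
      using poly_isCont[of s q] by (simp add: isCont_def)
    show "\<forall>\<^sub>F t in at s. 0 \<le> poly q t"
      using ev by eventually_elim (use pos in force)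
  qed simp
  moreover have "poly q s1 = 0" "poly q s2 = 0"
    using F_limit[OF connected complete fin q(2)] out by auto
  moreover have "coeff q 4 = 0"
    by (rule F_limit_infinity[OF connected complete fin q(2,1) pole])
  then have "degree q < 4"
    using q(1) by (metis coeff_0_degree_minus_1 degree_0 leading_coeff_neq_0 le_neq_implies_less zero_less_numeral)
  ultimately have "q = 0"
    using out(3) by (intro nonneg_two_roots[of q s1 s2])
  moreover obtain t where "(t, 0) \<in> V"
    using eventually_happens[OF ev[of 0]] by auto
  ultimately show False
    using pos by force
qed

end

lemma stereographic_preimage:
  fixes N p :: "'a::euclidean_space"
  assumes N: "norm N = 1" and p: "norm p = 1" "p \<noteq> N"
  obtains k y where "k > 0" "y \<bullet> N = 0" "y + ((y \<bullet> y - 1) / 2) *\<^sub>R N = k *\<^sub>R p"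
proof -
  define a where "a = p \<bullet> N"
  have NN: "N \<bullet> N = 1" "p \<bullet> p = 1" using N p by (simp_all add: norm_eq_1)
  have "(p - N) \<bullet> (p - N) > 0" using p(2) by simp
  then have a: "1 - a > 0"
    using NN by (simp add: a_def inner_diff_left inner_diff_right inner_commute)
  \<comment> \<open>Points \<open>x\<close> in the image of \<open>Psi\<close> satisfy
    \<open>norm x - x \<bullet> N = 1\<close>, and for \<open>x = k *\<^sub>R p\<close> this forces
    the value of \<open>k\<close>. The vector \<open>y\<close> is then the part of \<open>x\<close>
    orthogonal to \<open>N\<close>.\<close>
  define k where "k = 1 / (1 - a)"
  define y where "y = k *\<^sub>R (p - a *\<^sub>R N)"
  have yy: "y \<bullet> y = k\<^sup>2 * (1 - a\<^sup>2)"
    using NN by (simp add: y_def inner_diff_left inner_diff_right inner_commute[of N p] a_def[symmetric] power2_eq_square algebra_simps)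
  have k: "k * (1 - a) = 1" using a by (simp add: k_def)
  have "y \<bullet> y = (k * (1 - a)) * (k * (1 + a))"
    unfolding yy by (simp add: power2_eq_square algebra_simps)
  then have "y \<bullet> y = k + k * a"
    unfolding k by (simp add: distrib_left)
  moreover have "k - k * a = 1"
    using k by (simp add: right_diff_distrib)
  moreover have "(s - 1) / 2 = m" if "s = k + m" "k - m = 1" for s m :: real
    using that by simp
  ultimately have "(y \<bullet> y - 1) / 2 = k * a"
    by blast
  then have "y + ((y \<bullet> y - 1) / 2) *\<^sub>R N = k *\<^sub>R p"
    by (simp add: y_def scaleR_diff_right)
  moreover have "y \<bullet> N = 0"
    using NN by (simp add: y_def inner_diff_left a_def)
  ultimately show ?thesis
    using a by (intro that[of k y]) (simp_all add: k_def)
qed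

lemma (in conformal_metric) not_parallel:
  assumes M: "M = sphere 0 1 - \<Lambda>" and \<Lambda>: "\<Lambda> \<subseteq> sphere 0 1" "finite \<Lambda>" "card \<Lambda> > 2"
    and dim: "DIM('a) \<ge> 3" and complete: "complete_metric M g"
    and T0: "\<And>p v. p \<in> M \<Longrightarrow> v \<bullet> p = 0 \<Longrightarrow> T p v v v = 0"
  shows False
proof -
  obtain p1 p2 N where p: "p1 \<in> \<Lambda>" "p2 \<in> \<Lambda>" "N \<in> \<Lambda>" "p1 \<noteq> p2" "p1 \<noteq> N" "p2 \<noteq> N"
  proof -
    have "3 \<le> card \<Lambda>" using \<Lambda>(3) by simp
    then obtain A where "A \<subseteq> \<Lambda>" "card A = 3"
      by (metis obtain_subset_with_card_n)
    then show ?thesis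
      using that by (auto simp: card_3_iff)
  qed
  have norms: "norm p1 = 1" "norm p2 = 1" "norm N = 1"
    using p \<Lambda>(1) by auto
  obtain k1 y1 where k1: "k1 > 0" "y1 \<bullet> N = 0" "y1 + ((y1 \<bullet> y1 - 1) / 2) *\<^sub>R N = k1 *\<^sub>R p1"
    by (rule stereographic_preimage[OF norms(3,1) p(5)])
  obtain k2 y2 where k2: "k2 > 0" "y2 \<bullet> N = 0" "y2 + ((y2 \<bullet> y2 - 1) / 2) *\<^sub>R N = k2 *\<^sub>R p2"
    by (rule stereographic_preimage[OF norms(3,2) p(6)])
  have ne: "y1 \<noteq> y2"
  proof
    assume "y1 = y2"
    then have eq: "k1 *\<^sub>R p1 = k2 *\<^sub>R p2" using k1 k2 by simp
    then have "norm (k1 *\<^sub>R p1) = norm (k2 *\<^sub>R p2)" by simp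
    then have "k1 = k2" using k1 k2 norms by simp
    then show False using eq k1 p(4) by simp
  qed
  \<comment> \<open>The line starts at \<open>y1\<close> in the direction of \<open>y2\<close>, so
    the two finite punctures have the parameters 0 and \<open>s2\<close>.\<close>
  define e where "e = sgn (y2 - y1)"
  define s2 where "s2 = norm (y2 - y1)"
  have s2: "s2 > 0" "s2 *\<^sub>R e = y2 - y1"
    using ne by (simp_all add: s2_def e_def sgn_div_norm)
  \<comment> \<open>The second direction of the plane in which the differential equation is
    posed.\<close>
  obtain f where f: "f \<bullet> f = 1" "f \<bullet> N = 0" "f \<bullet> e = 0"
    by (rule ex_unit_orthogonal[OF dim])
  have "e \<bullet> N = 0"
    using k1 k2 by (simp add: e_def sgn_div_norm inner_diff_left)
  moreover have "norm e = 1" using ne by (simp add: e_def norm_sgn)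
  ultimately interpret conformal_stereographic M L g N y1 e f
    using f k1 norms T0
    by unfold_locales (simp_all add: norm_eq_1 inner_commute)
  have pts: "Psi (0, 0) = k1 *\<^sub>R p1" "Psi (s2, 0) = k2 *\<^sub>R p2"
    using k1 k2 s2 by (simp_all add: Psi_def plane_def)
  \<comment> \<open>Every excluded parameter maps to a puncture, and by injectivity each puncture is
    hit at most once.\<close>
  have "- V \<subseteq> (\<lambda>z. sgn (Psi z)) -` \<Lambda>"
  proof
    fix z assume "z \<in> - V"
    then have "sgn (Psi z) \<notin> M" by (simp add: V_def Mcone_def)
    moreover have "sgn (Psi z) \<in> sphere 0 1" using Psi_nonzero by (simp add: norm_sgn)
    ultimately show "z \<in> (\<lambda>z. sgn (Psi z)) -` \<Lambda>" using M by auto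
  qed
  moreover have "finite ((\<lambda>z. sgn (Psi z)) -` \<Lambda>)"
    by (rule finite_vimageI[OF \<Lambda>(2)]) (auto intro: injI Psi_inj)
  ultimately have fin: "finite (- V)" by (rule finite_subset)
  have "sgn p1 = p1" "sgn p2 = p2" using norms by (simp_all add: sgn_div_norm)
  moreover have "p1 \<notin> M" "p2 \<notin> M" using p(1,2) M by auto
  ultimately have out: "(0, 0) \<notin> V" "(s2, 0) \<notin> V"
    using k1(1) k2(1) by (simp_all add: V_def Mcone_def pts sgn_scaleR)
  show False
    by (rule two_roots_contradiction[OF rpath_exists[OF M \<Lambda>(2) dim] complete fin _ out])
       (use p(3) s2(1) M in auto)
qed

theorem theorem2:
  fixes n k :: nat
    and \<Lambda> :: "'a::euclidean_space set"
    and g :: "'a metric_tensor"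
  assumes "n \<ge> 3"
    and "DIM('a) = n + 1"
    and "\<Lambda> \<subseteq> sphere 0 1"
    and "finite \<Lambda>"
    and "card \<Lambda> = k"
    and "k > 2"
    and "riemannian_metric (sphere 0 1 - \<Lambda>) g"
    and "complete_metric (sphere 0 1 - \<Lambda>) g"
    and "conformal_to_round n (sphere 0 1 - \<Lambda>) g"
    and "positive_constant_scalar_curvature (sphere 0 1 - \<Lambda>) g"
  shows "harmonic_curvature (sphere 0 1 - \<Lambda>) g \<and>
    (\<not> metric_eq_on (sphere 0 1 - \<Lambda>) g round_metric \<longrightarrow>
      \<not> parallel_ricci (sphere 0 1 - \<Lambda>) g)"
proof -
  define M where "M = sphere 0 1 - \<Lambda>"
  obtain u where u: "smooth_fun M u" "\<And>p. p \<in> M \<Longrightarrow> u p > 0"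
    "metric_eq_on M g (\<lambda>p v w. u p powr (4 / (real n - 2)) * round_metric p v w)"
    using assms(9) unfolding conformal_to_round_def M_def[symmetric] by blast
  let ?C = "{x. sgn x \<in> M}"
  \<comment> \<open>The first term gives the required scaling. The second is chosen such that
    \<open>exp (- 2 * L p)\<close> is \<open>u p powr (4 / (real n - 2))\<close> where
    \<open>norm p = 1\<close>.\<close>
  define L where "L x = ln (norm x) - 2 / (real n - 2) * ln (u (sgn x))" for x
  have "?C = (- {0}) \<inter> sgn -` (- \<Lambda>)"
    by (auto simp: M_def norm_sgn)
  moreover have "open ((- {0}) \<inter> sgn -` (- \<Lambda>))"
    using assms(4)
    by (intro continuous_open_preimage continuous_intros smooth_on_continuous[OF smooth_on_sgn])
       (auto simp: finite_imp_closed open_Compl)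
  ultimately have openC: "open ?C" by simp
  have C0: "x \<noteq> 0" if "x \<in> ?C" for x
    using that by (auto simp: M_def)
  have zero_M: "0 \<notin> M" by (simp add: M_def)
  have smooth_u: "smooth_on ?C (\<lambda>x. u (sgn x))"
    using u(1) by (simp add: smooth_fun_def smooth_on_def)
  interpret conformal_metric M L g
  proof
    show "M \<subseteq> sphere 0 1" by (auto simp: M_def)
    show "open ?C" by (rule openC)
    show "smooth_on ?C L"
      unfolding L_def
      by (intro smooth_intros openC smooth_u) (use C0 u(2) zero_M in auto)
    show "L (c *\<^sub>R x) = L x + ln c" if "c > 0" "sgn x \<in> M" for c x
      using that C0[of x] by (simp add: L_def sgn_scaleR ln_mult)
    show "g p v w = exp (- 2 * L p) * (v \<bullet> w)" if p: "p \<in> M" and "v \<bullet> p = 0" "w \<bullet> p = 0" for p v w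
    proof -
      have n: "norm p = 1" using p by (auto simp: M_def)
      have "g p v w = u p powr (4 / (real n - 2)) * (v \<bullet> w)"
        using u(3) that by (simp add: metric_eq_on_def tangent_space_def round_metric_def)
      also have "u p powr (4 / (real n - 2)) = exp (- 2 * L p)"
        using u(2)[OF p] by (simp add: L_def n sgn_div_norm powr_def)
      finally show ?thesis .
    qed
  qed
  obtain c where c: "\<And>p. p \<in> M \<Longrightarrow> scalar_curvature M g p = c"
    using assms(10) unfolding positive_constant_scalar_curvature_def M_def[symmetric] by blast
  \<comment> \<open>Since \<open>DIM('a) = n + 1\<close>, the factor in
    \<open>scalar_curvature_eq\<close> is 2 (n - 1).\<close>
  have tau: "tau p = c / (2 * (real n - 1))" if "p \<in> M" for p
    using c[OF that] scalar_curvature_eq[OF that] assms(1,2) by (simp add: field_simps)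
  have "\<not> parallel_ricci M g"
  proof
    assume "parallel_ricci M g"
    then have "T p v v v = 0" if "p \<in> M" "v \<bullet> p = 0" for p v
      using assms(1,2) that by (intro parallel_imp_T[OF tau]) auto
    then show False
      using not_parallel[OF M_def assms(3,4)] assms(1,2,5,6,8) by (simp add: M_def[symmetric])
  qed
  with harmonic[OF tau] show ?thesis
    by (simp add: M_def)
qed

end
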